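(* Suppose that $f_a:\mathbb{R}^{n\times m}\to\mathbb{R}$ satisfies the $\delta$-RIP$_{2r,2r}$ property with $\delta<1/3$. Let $\alpha>0$ be an arbitrary constant and let $\mu\in[(1-\delta)/3,\,1-\delta)$. Then there exist positive constants $$\epsilon_1=\epsilon_1(\delta,r,\mu,\sigma_r(M_a^* ),\|M_a^*\|_F,\alpha),\qquad \lambda_1=\lambda_1(\delta,r,\mu,\sigma_r(M_a^* ),\|M_a^*\|_F,\alpha),$$ depending only on the listed quantities, such that for every $\epsilon\in(0,\epsilon_1]$ and $\lambda\in(0,\lambda_1]$ the problem $$\min_{U\in\mathbb{R}^{n\times r},\,V\in\mathbb{R}^{m\times r}}\ \rho(U,V):=f_a(UV^T)+\frac{\mu}{4}\|U^TU-V^TV\|_F^2$$ satisfies the $(\alpha,\beta,\gamma)$-strict saddle property with $$\beta:=\min\left\{\mu(\epsilon/r)^{3/2},\ \lambda\right\},\qquad \gamma:=\mu\epsilon.$$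
   Context: $f_a$ is twice continuously differentiable. Standing assumptions: $f_a$ has a first-order critical point $M_a^*$ (i.e. $\nabla f_a(M_a^* )=0$) with $\mathrm{rank}(M_a^* )\le r$ (it is then the unique global minimizer of $f_a$ over matrices of rank at most $r$), and in fact $\mathrm{rank}(M_a^* )=r$. $\delta$-RIP$_{2r,2r}$ (with $\delta\in[0,1)$): $(1-\delta)\|K\|_F^2\le[\nabla^2f_a(M)](K,K)\le(1+\delta)\|K\|_F^2$ for all $M,K\in\mathbb{R}^{n\times m}$ of rank at most $2r$. Strict saddle property: for an optimization problem $\min_{x\in\mathcal X}F(x)$ with set of global minima $\mathcal X^*$, the problem satisfies the $(\alpha,\beta,\gamma)$-strict saddle property ($\alpha,\beta,\gamma>0$) if for every $x\in\mathcal X$ at least one of the following holds: $\mathrm{dist}(x,\mathcal X^* )\le\alpha$; $\|\nabla F(x)\|_F\ge\beta$; $\lambda_{min}[\nabla^2F(x)]\le-\gamma$. Here the distance is the Frobenius distance in the factor space of pairs $(U,V)$ (stacked as a matrix in $\mathbb{R}^{(n+m)\times r}$). $\sigma_r(\cdot)$ is the $r$-th largest singular value; $\lambda_{min}$ is the minimal eigenvalue. *)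

theory Defs
  imports
    "HOL-Analysis.Derivative"
    "HOL-Library.Multiset"
    "Jordan_Normal_Form.Char_Poly"
    "Jordan_Normal_Form.DL_Rank"
begin

text \<open>
  The space of real \<open>p \<times> q\<close> matrices is \<^term>\<open>carrier_mat p q\<close>.  A function on that space
  is a function on \<^typ>\<open>real mat\<close> of which only the values on \<^term>\<open>carrier_mat p q\<close> matter.
\<close>

definition fro_inner :: "real mat \<Rightarrow> real mat \<Rightarrow> real" where
  "fro_inner A B = (\<Sum>i<dim_row A. \<Sum>j<dim_col A. A $$ (i, j) * B $$ (i, j))"

definition fro_norm :: "real mat \<Rightarrow> real" where
  "fro_norm A = sqrt (fro_inner A A)"

abbreviation rank_mat :: "real mat \<Rightarrow> nat" where
  "rank_mat A \<equiv> vec_space.rank (dim_row A) A"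

text \<open>
  The squared singular values of an \<open>n \<times> m\<close> matrix \<open>A\<close> are the \<open>m\<close> eigenvalues of
  \<open>A\<^sup>T A\<close>, counted with multiplicity.  The index \<open>k\<close> is one-based, and
  \<open>sing_val k A\<close> is meaningful for \<open>1 \<le> k \<le> m\<close>.
\<close>

definition sing_val :: "nat \<Rightarrow> real mat \<Rightarrow> real" where
  "sing_val k A =
     rev (sorted_list_of_multiset
       (image_mset sqrt (proots (char_poly (transpose_mat A * A))))) ! (k - 1)"

definition unit_mat :: "nat \<Rightarrow> nat \<Rightarrow> nat \<times> nat \<Rightarrow> real mat" where
  "unit_mat p q ij = mat p q (\<lambda>kl. if kl = ij then 1 else 0)"

definition partial_deriv ::
  "nat \<Rightarrow> nat \<Rightarrow> nat \<times> nat \<Rightarrow> (real mat \<Rightarrow> real) \<Rightarrow> real mat \<Rightarrow> real" where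
  "partial_deriv p q ij F X = deriv (\<lambda>t. F (X + t \<cdot>\<^sub>m unit_mat p q ij)) 0"

definition gradient :: "nat \<Rightarrow> nat \<Rightarrow> (real mat \<Rightarrow> real) \<Rightarrow> real mat \<Rightarrow> real mat" where
  "gradient p q F X = mat p q (\<lambda>ij. partial_deriv p q ij F X)"

text \<open>
  The Hessian is the \<open>pq \<times> pq\<close> matrix of second partial derivatives; the matrix position
  \<open>(i, j)\<close> has the row-major linear index \<open>i * q + j\<close>.
\<close>

definition hessian :: "nat \<Rightarrow> nat \<Rightarrow> (real mat \<Rightarrow> real) \<Rightarrow> real mat \<Rightarrow> real mat" where
  "hessian p q F X = mat (p * q) (p * q) (\<lambda>(a, b).
     partial_deriv p q (b div q, b mod q) (partial_deriv p q (a div q, a mod q) F) X)"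

definition vectorize :: "real mat \<Rightarrow> real vec" where
  "vectorize K = vec (dim_row K * dim_col K) (\<lambda>a. K $$ (a div dim_col K, a mod dim_col K))"

definition hessian_form ::
  "nat \<Rightarrow> nat \<Rightarrow> (real mat \<Rightarrow> real) \<Rightarrow> real mat \<Rightarrow> real mat \<Rightarrow> real mat \<Rightarrow> real" where
  "hessian_form p q F X K L = vectorize K \<bullet> (hessian p q F X *\<^sub>v vectorize L)"

definition lambda_min :: "real mat \<Rightarrow> real" where
  "lambda_min A = Min {k. eigenvalue A k}"

text \<open>
  Frechet differentiability.  The derivative, if it exists, is given by the gradient, so no
  separate existential quantifier over linear maps is needed.
\<close>

definition mat_differentiable :: "nat \<Rightarrow> nat \<Rightarrow> (real mat \<Rightarrow> real) \<Rightarrow> real mat \<Rightarrow> bool" where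
  "mat_differentiable p q F X \<longleftrightarrow>
     (\<forall>e>0. \<exists>d>0. \<forall>H \<in> carrier_mat p q. fro_norm H < d \<longrightarrow>
        \<bar>F (X + H) - F X - fro_inner (gradient p q F X) H\<bar> \<le> e * fro_norm H)"

definition mat_continuous :: "nat \<Rightarrow> nat \<Rightarrow> (real mat \<Rightarrow> real) \<Rightarrow> real mat \<Rightarrow> bool" where
  "mat_continuous p q F X \<longleftrightarrow>
     (\<forall>e>0. \<exists>d>0. \<forall>Y \<in> carrier_mat p q. fro_norm (Y - X) < d \<longrightarrow> \<bar>F Y - F X\<bar> < e)"

definition twice_cont_diff :: "nat \<Rightarrow> nat \<Rightarrow> (real mat \<Rightarrow> real) \<Rightarrow> bool" where
  "twice_cont_diff p q F \<longleftrightarrow>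
     (\<forall>X \<in> carrier_mat p q. mat_differentiable p q F X \<and>
        (\<forall>ij \<in> {..<p} \<times> {..<q}. mat_differentiable p q (partial_deriv p q ij F) X \<and>
           (\<forall>kl \<in> {..<p} \<times> {..<q}.
              mat_continuous p q (partial_deriv p q kl (partial_deriv p q ij F)) X)))"

text \<open>\<open>\<delta>\<close>-RIP of order \<open>(s, t)\<close>; it is used with \<open>s = t = 2r\<close>.\<close>

definition RIP :: "nat \<Rightarrow> nat \<Rightarrow> nat \<Rightarrow> nat \<Rightarrow> real \<Rightarrow> (real mat \<Rightarrow> real) \<Rightarrow> bool" where
  "RIP n m s t \<delta> f \<longleftrightarrow> 0 \<le> \<delta> \<and> \<delta> < 1 \<and>
     (\<forall>M \<in> carrier_mat n m. \<forall>K \<in> carrier_mat n m. rank_mat M \<le> s \<longrightarrow> rank_mat K \<le> t \<longrightarrow>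
        (1 - \<delta>) * (fro_norm K)\<^sup>2 \<le> hessian_form n m f M K K \<and>
        hessian_form n m f M K K \<le> (1 + \<delta>) * (fro_norm K)\<^sup>2)"

definition global_minima :: "nat \<Rightarrow> nat \<Rightarrow> (real mat \<Rightarrow> real) \<Rightarrow> real mat set" where
  "global_minima p q F =
     {X \<in> carrier_mat p q. \<forall>Y \<in> carrier_mat p q. F X \<le> F Y}"

definition fro_infdist :: "real mat \<Rightarrow> real mat set \<Rightarrow> real" where
  "fro_infdist X S = (INF Y\<in>S. fro_norm (X - Y))"

text \<open>
  The distance to an empty set of minima is regarded as infinite, hence the guard below.
\<close>

definition strict_saddle ::
  "nat \<Rightarrow> nat \<Rightarrow> (real mat \<Rightarrow> real) \<Rightarrow> real \<Rightarrow> real \<Rightarrow> real \<Rightarrow> bool" where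
  "strict_saddle p q F \<alpha> \<beta> \<gamma> \<longleftrightarrow> 0 < \<alpha> \<and> 0 < \<beta> \<and> 0 < \<gamma> \<and>
     (\<forall>X \<in> carrier_mat p q.
        (global_minima p q F \<noteq> {} \<and> fro_infdist X (global_minima p q F) \<le> \<alpha>) \<or>
        \<beta> \<le> fro_norm (gradient p q F X) \<or>
        lambda_min (hessian p q F X) \<le> - \<gamma>)"

definition rho :: "(real mat \<Rightarrow> real) \<Rightarrow> real \<Rightarrow> real mat \<Rightarrow> real mat \<Rightarrow> real" where
  "rho f \<mu> U V = f (U * transpose_mat V) +
     \<mu> / 4 * (fro_norm (transpose_mat U * U - transpose_mat V * V))\<^sup>2"

text \<open>
  A pair \<open>(U, V)\<close> of an \<open>n \<times> r\<close> and an \<open>m \<times> r\<close> matrix is stored as the \<open>(n + m) \<times> r\<close>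
  matrix with \<open>U\<close> on top of \<open>V\<close>.
\<close>

definition upper_block :: "nat \<Rightarrow> nat \<Rightarrow> real mat \<Rightarrow> real mat" where
  "upper_block n r W = mat n r (\<lambda>(i, j). W $$ (i, j))"

definition lower_block :: "nat \<Rightarrow> nat \<Rightarrow> nat \<Rightarrow> real mat \<Rightarrow> real mat" where
  "lower_block n m r W = mat m r (\<lambda>(i, j). W $$ (n + i, j))"

definition rho_stacked ::
  "nat \<Rightarrow> nat \<Rightarrow> nat \<Rightarrow> (real mat \<Rightarrow> real) \<Rightarrow> real \<Rightarrow> real mat \<Rightarrow> real" where
  "rho_stacked n m r f \<mu> W = rho f \<mu> (upper_block n r W) (lower_block n m r W)"

lemma rho_stacked_append_rows:
  assumes "U \<in> carrier_mat n r" and "V \<in> carrier_mat m r"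
  shows "rho_stacked n m r f \<mu> (U @\<^sub>r V) = rho f \<mu> U V"
proof -
  have "upper_block n r (U @\<^sub>r V) = U" "lower_block n m r (U @\<^sub>r V) = V"
    using assms by (auto simp: upper_block_def lower_block_def append_rows_def)
  then show ?thesis by (simp add: rho_stacked_def)
qed

end

theory Submission
  imports Defs "HOL-Analysis.Function_Topology"
begin

text \<open>
  Write \<open>M = U V\<^sup>T\<close>, \<open>E = M - M\<^sup>*\<close>, \<open>G = \<nabla>f(M)\<close> and \<open>D = U\<^sup>T U - V\<^sup>T V\<close>.  At a point with small
  gradient and almost nonnegative Hessian, pairing the gradient with \<open>(U, V)\<close> bounds \<open>U\<close> and \<open>V\<close>,
  and pairing it with \<open>(U D, - V D)\<close> shows that \<open>D\<close>, \<open>G V\<close> and \<open>G\<^sup>T U\<close> are small.  The Hessian in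
  rank-one directions \<open>(x q\<^sup>T, y q\<^sup>T)\<close> then makes \<open>M\<close> almost a best rank-\<open>r\<close> approximation of
  \<open>M - G / (1 + \<delta>)\<close>, that is, \<open>2 \<langle>G, E\<rangle> / (1 + \<delta>)\<close> is at most \<open>\<parallel>E\<parallel>\<^sup>2\<close> up to a small error.
  On the other hand the restricted isometry property gives \<open>\<langle>G, E\<rangle> \<ge> (1 - \<delta>) \<parallel>E\<parallel>\<^sup>2\<close>, and
  \<open>2 (1 - \<delta>) > 1 + \<delta>\<close> exactly when \<open>\<delta> < 1/3\<close>; hence \<open>E\<close> is small.  Finally the distance of
  \<open>(U, V)\<close> to the balanced factorizations of \<open>M\<^sup>*\<close>, which are global minima, is controlled by
  \<open>D\<close> and \<open>E\<close>.
\<close>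

section \<open>Vectors and orthogonal matrices\<close>

text \<open>In the error-free case balance makes the columns of both rotated factors orthogonal with
  equal norms, so the numbers |u_k|^2 are the singular values of M, although no singular value
  decomposition of M is ever formed. The gradient condition makes G vanish on the column and row
  spaces of M, and the Hessian bounds the spectral norm of G / (1 + \<delta>) by the least of these
  singular values: these are the Eckart-Young conditions for M to be a truncation of M - G / (1 +
  \<delta>). The obstacle is that M may be almost rank-deficient, so that projecting onto its column
  space and dividing by its least singular value are unstable. Both are regularized by a ridge
  \<eta>, which inflates errors of size \<omega> to \<omega> / \<eta>. This dictates the order of
  choice: \<eta> from \<alpha>, then \<omega> of order \<eta>^3, then the gradient tolerance from
  \<omega>. Spectral decompositions are replaced by extremal problems over the orthogonal group,
  whose maximizers are tested with plane rotations and reflections.\<close>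

definition sdot :: "nat \<Rightarrow> (nat \<Rightarrow> real) \<Rightarrow> (nat \<Rightarrow> real) \<Rightarrow> real" where
  "sdot n x y = (\<Sum>i<n. x i * y i)"

lemma sdot_commute: "sdot n x y = sdot n y x"
  by (simp add: sdot_def mult.commute)

lemma sdot_add_left: "sdot n (\<lambda>i. x i + y i) z = sdot n x z + sdot n y z"
  and sdot_diff_left: "sdot n (\<lambda>i. x i - y i) z = sdot n x z - sdot n y z"
  and sdot_scale_left: "sdot n (\<lambda>i. c * x i) z = c * sdot n x z"
  by (simp_all add: sdot_def algebra_simps sum.distrib sum_subtractf sum_distrib_left)

lemma sdot_add_right: "sdot n z (\<lambda>i. x i + y i) = sdot n z x + sdot n z y"
  and sdot_diff_right: "sdot n z (\<lambda>i. x i - y i) = sdot n z x - sdot n z y"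
  and sdot_scale_right: "sdot n z (\<lambda>i. c * x i) = c * sdot n z x"
  by (simp_all add: sdot_def algebra_simps sum.distrib sum_subtractf sum_distrib_left)

lemma sdot_sum_left: "sdot n (\<lambda>i. \<Sum>k\<in>A. f k i) z = (\<Sum>k\<in>A. sdot n (f k) z)"
  unfolding sdot_def sum_distrib_right by (rule sum.swap)

lemma sdot_sum_right: "sdot n z (\<lambda>i. \<Sum>k\<in>A. f k i) = (\<Sum>k\<in>A. sdot n z (f k))"
  unfolding sdot_def sum_distrib_left by (rule sum.swap)

lemmas sdot_simps = sdot_add_left sdot_diff_left sdot_scale_left sdot_sum_left
  sdot_add_right sdot_diff_right sdot_scale_right sdot_sum_right

abbreviation sqnorm :: "nat \<Rightarrow> (nat \<Rightarrow> real) \<Rightarrow> real" where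
  "sqnorm n x \<equiv> sdot n x x"

lemma sdot_self_nonneg [simp]: "0 \<le> sqnorm n x"
  by (simp add: sdot_def sum_nonneg)

lemma sdot_self_eq_0_iff: "sqnorm n x = 0 \<longleftrightarrow> (\<forall>i<n. x i = 0)"
  by (auto simp: sdot_def sum_nonneg_eq_0_iff)

lemma Cauchy_Schwarz_sdot: "(sdot n x y)\<^sup>2 \<le> sqnorm n x * sqnorm n y"
  using Cauchy_Schwarz_ineq_sum[of x y "{..<n}"] by (simp add: sdot_def power2_eq_square)

lemma abs_sdot_le:
  assumes "sqnorm n x \<le> a\<^sup>2" and "sqnorm n y \<le> b\<^sup>2" and "0 \<le> a" and "0 \<le> b"
  shows "\<bar>sdot n x y\<bar> \<le> a * b"
proof (rule power2_le_imp_le)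
  have "\<bar>sdot n x y\<bar>\<^sup>2 \<le> sqnorm n x * sqnorm n y"
    using Cauchy_Schwarz_sdot by simp
  also have "\<dots> \<le> a\<^sup>2 * b\<^sup>2"
    using assms by (intro mult_mono) auto
  finally show "\<bar>sdot n x y\<bar>\<^sup>2 \<le> (a * b)\<^sup>2"
    by (simp add: power_mult_distrib)
qed (use assms in auto)

definition orthonormal :: "nat \<Rightarrow> nat \<Rightarrow> (nat \<Rightarrow> nat \<Rightarrow> real) \<Rightarrow> bool" where
  "orthonormal n p q \<longleftrightarrow> (\<forall>i<p. \<forall>j<p. sdot n (q i) (q j) = (if i = j then 1 else 0))"

text \<open>A one-sided inverse of a square matrix is two-sided, so orthonormal rows force
  orthonormal columns.\<close>

lemma orthonormal_complete:
  assumes "orthonormal r r q" and "i < r" and "j < r"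
  shows "(\<Sum>k<r. q k i * q k j) = (if i = j then 1 else 0)"
proof -
  let ?Q = "mat r r (\<lambda>(k, i). q k i)"
  have "?Q * transpose_mat ?Q = 1\<^sub>m r"
    using assms(1)
    by (intro eq_matI) (auto simp: orthonormal_def sdot_def scalar_prod_def atLeast0LessThan)
  then have "transpose_mat ?Q * ?Q = 1\<^sub>m r"
    by (intro mat_mult_left_right_inverse[of ?Q r "transpose_mat ?Q"]) auto
  then have "(transpose_mat ?Q * ?Q) $$ (i, j) = 1\<^sub>m r $$ (i, j)"
    by simp
  then show ?thesis
    using assms(2,3) by (simp add: scalar_prod_def atLeast0LessThan)
qed

section \<open>Maximization over the orthogonal group\<close>

lemma compact_Pi_UNIV:
  fixes S :: "'a \<Rightarrow> 'b::topological_space set"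
  assumes "\<And>i. compact (S i)"
  shows "compact {f. \<forall>i. f i \<in> S i}"
proof -
  have "compactin (product_topology (\<lambda>i. euclidean) UNIV) (PiE UNIV S)"
    unfolding compactin_PiE using assms by (simp add: compactin_euclidean_iff)
  moreover have "PiE UNIV S = {f. \<forall>i. f i \<in> S i}"
    by auto
  ultimately show ?thesis
    by (simp add: euclidean_product_topology compactin_euclidean_iff)
qed

lemma continuous_on_coord2:
  "continuous_on UNIV (\<lambda>Q :: nat \<Rightarrow> nat \<Rightarrow> real. Q i j)"
  by (rule continuous_on_product_then_coordinatewise) simp

lemma trace_sq_le:
  fixes S :: "nat \<Rightarrow> nat \<Rightarrow> real"
  shows "(\<Sum>k<r. S k k)\<^sup>2 \<le> r * (\<Sum>a<r. \<Sum>b<r. (S a b)\<^sup>2)"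
proof -
  have "(\<Sum>k<r. S k k)\<^sup>2 \<le> r * (\<Sum>k<r. (S k k)\<^sup>2)"
    using Cauchy_Schwarz_ineq_sum[of "\<lambda>k. S k k" "\<lambda>_. 1" "{..<r}"] by (simp add: mult.commute)
  also have "\<dots> \<le> r * (\<Sum>a<r. \<Sum>b<r. (S a b)\<^sup>2)"
    by (intro mult_left_mono sum_mono member_le_sum) auto
  finally show ?thesis .
qed

text \<open>A matrix is a function on all pairs of naturals, and such functions do not form a
  compact set. The assumption \<open>local\<close> permits truncation to the r by r block without
  changing the value of \<open>\<Phi>\<close>.\<close>

lemma orthonormal_attains_max:
  fixes \<Phi> :: "(nat \<Rightarrow> nat \<Rightarrow> real) \<Rightarrow> real"
  assumes cont: "continuous_on UNIV \<Phi>"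
    and local: "\<And>q q'. (\<And>i j. i < r \<Longrightarrow> j < r \<Longrightarrow> q i j = q' i j) \<Longrightarrow> \<Phi> q = \<Phi> q'"
  shows "\<exists>q. orthonormal r r q \<and> (\<forall>q'. orthonormal r r q' \<longrightarrow> \<Phi> q' \<le> \<Phi> q)"
proof -
  \<comment> \<open>Entries of an orthogonal matrix lie in [-1, 1]; pinning the remaining ones to 0
    makes the product compact by Tychonoff.\<close>
  define S where "S i j = (if i < r \<and> j < r then {-1..1::real} else {0})" for i j
  define B where "B = {q. \<forall>i. q i \<in> {x. \<forall>j. x j \<in> S i j}}"
  have "compact B"
    unfolding B_def by (intro compact_Pi_UNIV) (simp add: S_def)
  have "closed {q. orthonormal r r q}"
    unfolding orthonormal_def sdot_def
    by (intro closed_Collect_all closed_Collect_imp closed_Collect_eq open_Collect_const continuous_intros continuous_on_coord2)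
  then have comp: "compact (B \<inter> {q. orthonormal r r q})"
    using \<open>compact B\<close> by (rule compact_Int_closed[rotated])
  define trunc where "trunc q = (\<lambda>i j. if i < r \<and> j < r then q i j else 0)" for q :: "nat \<Rightarrow> nat \<Rightarrow> real"
  have trunc: "trunc q \<in> B \<inter> {q. orthonormal r r q}" if "orthonormal r r q" for q
  proof
    have "\<bar>q i j\<bar> \<le> 1" if "i < r" "j < r" for i j
    proof -
      have "(q i j)\<^sup>2 \<le> sqnorm r (q i)"
        unfolding sdot_def power2_eq_square using that by (intro member_le_sum) auto
      also have "\<dots> = 1"
        using \<open>orthonormal r r q\<close> that by (simp add: orthonormal_def)
      finally show ?thesis by (simp add: abs_square_le_1)
    qed
    then show "trunc q \<in> B"
      unfolding B_def S_def trunc_def by (auto simp: abs_le_iff)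
    show "trunc q \<in> {q. orthonormal r r q}"
      using that by (auto simp: orthonormal_def sdot_def trunc_def)
  qed
  have "orthonormal r r (\<lambda>i j. if i = j then 1 else 0)"
    by (auto simp: orthonormal_def sdot_def if_distrib cong: if_cong)
  then have "B \<inter> {q. orthonormal r r q} \<noteq> {}"
    using trunc by blast
  then obtain q where q: "q \<in> B \<inter> {q. orthonormal r r q}"
    "\<forall>q'\<in>B \<inter> {q. orthonormal r r q}. \<Phi> q' \<le> \<Phi> q"
    using continuous_attains_sup[OF comp] cont continuous_on_subset by (metis subset_UNIV)
  have "\<Phi> q' \<le> \<Phi> q" if "orthonormal r r q'" for q'
  proof -
    have "\<Phi> q' = \<Phi> (trunc q')"
      by (rule local) (simp add: trunc_def)
    then show ?thesis using q(2) trunc[OF that] by simp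
  qed
  then show ?thesis using q(1) by blast
qed

section \<open>Plane rotations, reflections and the conditions they impose on maximizers\<close>

definition givens :: "nat \<Rightarrow> nat \<Rightarrow> real \<Rightarrow> real \<Rightarrow> (nat \<Rightarrow> nat \<Rightarrow> real) \<Rightarrow> nat \<Rightarrow> nat \<Rightarrow> real" where
  "givens i j c s q k =
     (if k = i then (\<lambda>a. c * q i a + s * q j a)
      else if k = j then (\<lambda>a. c * q j a - s * q i a) else q k)"

lemma orthonormal_givens:
  assumes "orthonormal n p q" and "i < p" and "j < p" and "i \<noteq> j" and "c\<^sup>2 + s\<^sup>2 = 1"
  shows "orthonormal n p (givens i j c s q)"
  using assms unfolding orthonormal_def givens_def
  by (auto simp: sdot_simps power2_eq_square algebra_simps)

lemma sum_split_two:
  fixes f :: "nat \<Rightarrow> real"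
  assumes "i < r" "j < r" "i \<noteq> j"
  shows "(\<Sum>k<r. f k) = f i + f j + (\<Sum>k\<in>{..<r} - {i, j}. f k)"
proof -
  have "(\<Sum>k<r. f k) = f i + (\<Sum>k\<in>{..<r} - {i}. f k)"
    using assms by (subst sum.remove[of _ i]) auto
  also have "(\<Sum>k\<in>{..<r} - {i}. f k) = f j + (\<Sum>k\<in>{..<r} - {i} - {j}. f k)"
    using assms by (subst sum.remove[of _ j]) auto
  also have "{..<r} - {i} - {j} = {..<r} - {i, j}" by auto
  finally show ?thesis by simp
qed

definition rot :: "nat \<Rightarrow> (nat \<Rightarrow> nat \<Rightarrow> real) \<Rightarrow> (nat \<Rightarrow> nat \<Rightarrow> real) \<Rightarrow> nat \<Rightarrow> nat \<Rightarrow> real" where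
  "rot r q u k = (\<lambda>i. \<Sum>a<r. q k a * u a i)"

lemma rot_givens:
  "rot r (givens i j c s q) u k =
    (if k = i then (\<lambda>a. c * rot r q u i a + s * rot r q u j a)
     else if k = j then (\<lambda>a. c * rot r q u j a - s * rot r q u i a) else rot r q u k)"
  by (auto simp: rot_def givens_def algebra_simps sum.distrib sum_subtractf sum_distrib_left)

text \<open>A first-order condition without derivatives: the extremal problems are tested along
  curves on which the gain, up to a positive factor, is exactly quadratic in t.\<close>

lemma quadratic_stationary:
  fixes A B :: real
  assumes "\<And>t. t * A + t\<^sup>2 * B \<le> 0"
  shows "A = 0"
proof (rule ccontr)
  assume "A \<noteq> 0"
  \<comment> \<open>The summand 1 covers B = 0 and keeps the linear term strictly ahead of the
    quadratic one.\<close>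
  define t where "t = A / (\<bar>B\<bar> + 1)"
  have "t\<^sup>2 * - \<bar>B\<bar> \<le> t\<^sup>2 * B"
    by (intro mult_left_mono) auto
  then have le: "t * A - t\<^sup>2 * \<bar>B\<bar> \<le> t * A + t\<^sup>2 * B"
    by simp
  have "t * A - t\<^sup>2 * \<bar>B\<bar> = (A\<^sup>2 * (\<bar>B\<bar> + 1) - A\<^sup>2 * \<bar>B\<bar>) / (\<bar>B\<bar> + 1)\<^sup>2"
  proof -
    have "\<bar>B\<bar> + 1 \<noteq> 0" by linarith
    then have "t * A = A\<^sup>2 * (\<bar>B\<bar> + 1) / (\<bar>B\<bar> + 1)\<^sup>2"
      by (simp add: t_def power2_eq_square)
    moreover have "t\<^sup>2 * \<bar>B\<bar> = A\<^sup>2 * \<bar>B\<bar> / (\<bar>B\<bar> + 1)\<^sup>2"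
      by (simp add: t_def power_divide)
    ultimately show ?thesis by (simp add: diff_divide_distrib)
  qed
  also have "\<dots> = A\<^sup>2 / (\<bar>B\<bar> + 1)\<^sup>2"
    by (simp add: algebra_simps)
  also have "\<dots> > 0" using \<open>A \<noteq> 0\<close> by (simp add: zero_less_power2)
  finally show False using le assms[of t] by linarith
qed

text \<open>Maximizing a weighted sum of squared norms with distinct weights forces orthogonality:
  otherwise a small plane rotation would increase the sum.\<close>

lemma exists_orthogonalizing_rotation:
  "\<exists>q. orthonormal r r q \<and> (\<forall>i<r. \<forall>j<r. i \<noteq> j \<longrightarrow> sdot n (rot r q u i) (rot r q u j) = 0)"
proof -
  define \<Phi> where "\<Phi> q = (\<Sum>k<r. real k * sqnorm n (rot r q u k))" for q
  have "continuous_on UNIV \<Phi>"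
    unfolding \<Phi>_def sdot_def rot_def by (intro continuous_intros continuous_on_coord2)
  moreover have "\<Phi> q = \<Phi> q'" if "\<And>i j. i < r \<Longrightarrow> j < r \<Longrightarrow> q i j = q' i j" for q q'
    unfolding \<Phi>_def sdot_def rot_def using that by simp
  ultimately obtain q where q: "orthonormal r r q"
    and max: "\<And>q'. orthonormal r r q' \<Longrightarrow> \<Phi> q' \<le> \<Phi> q"
    using orthonormal_attains_max by blast
  have orth: "sdot n (rot r q u i) (rot r q u j) = 0" if ij: "i < r" "j < r" "j < i" for i j
  proof -
    let ?u = "rot r q u"
    define a where "a = sqnorm n (?u i)"
    define b where "b = sqnorm n (?u j)"
    define x where "x = sdot n (?u i) (?u j)"
    have "t * (2 * x) + t\<^sup>2 * (b - a) \<le> 0" for t :: real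
    proof -
      \<comment> \<open>The rotation is parametrized by its tangent t, so that after division by c^2
        the gain is a polynomial in t.\<close>
      define c where "c = 1 / sqrt (1 + t\<^sup>2)"
      have pos: "1 + t\<^sup>2 > 0" by (simp add: add_pos_nonneg)
      then have c2: "c\<^sup>2 = 1 / (1 + t\<^sup>2)" unfolding c_def by (simp add: power_divide)
      have one: "c\<^sup>2 + (t * c)\<^sup>2 = 1"
      proof -
        have "c\<^sup>2 + (t * c)\<^sup>2 = c\<^sup>2 * (1 + t\<^sup>2)" by (simp add: algebra_simps power_mult_distrib)
        then show ?thesis using c2 pos by simp
      qed
      have xs: "sdot n (?u j) (?u i) = x" by (simp add: x_def sdot_commute)
      let ?g = "givens i j c (t * c) q"
      have rest: "(\<Sum>k\<in>{..<r} - {i, j}. real k * sqnorm n (rot r ?g u k))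
          = (\<Sum>k\<in>{..<r} - {i, j}. real k * sqnorm n (?u k))"
        by (intro sum.cong) (auto simp: rot_givens)
      have gi: "sqnorm n (rot r ?g u i) = c\<^sup>2 * (a + t\<^sup>2 * b + 2 * t * x)"
        using ij by (simp add: rot_givens sdot_simps a_def[symmetric] b_def[symmetric] x_def[symmetric] xs algebra_simps power2_eq_square)
      have gj: "sqnorm n (rot r ?g u j) = c\<^sup>2 * (b + t\<^sup>2 * a - 2 * t * x)"
        using ij by (simp add: rot_givens sdot_simps a_def[symmetric] b_def[symmetric] x_def[symmetric] xs algebra_simps power2_eq_square)
      have "orthonormal r r ?g"
        using q ij one by (intro orthonormal_givens) auto
      from max[OF this] have "real i * (c\<^sup>2 * (a + t\<^sup>2 * b + 2 * t * x)) + real j * (c\<^sup>2 * (b + t\<^sup>2 * a - 2 * t * x))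
        \<le> real i * a + real j * b"
        unfolding \<Phi>_def using ij
        by (simp add: sum_split_two[of i r j] rest gi gj a_def[symmetric] b_def[symmetric])
      moreover have "c\<^sup>2 * (1 + t\<^sup>2) = 1" using c2 pos by simp
      ultimately have "real i * (c\<^sup>2 * (a + t\<^sup>2 * b + 2 * t * x)) + real j * (c\<^sup>2 * (b + t\<^sup>2 * a - 2 * t * x))
        \<le> real i * (c\<^sup>2 * (1 + t\<^sup>2) * a) + real j * (c\<^sup>2 * (1 + t\<^sup>2) * b)" by simp
      then have "(real i - real j) * c\<^sup>2 * (t * (2 * x) + t\<^sup>2 * (b - a)) \<le> 0"
        by (simp add: algebra_simps)
      moreover have "(real i - real j) * c\<^sup>2 > 0" using ij c2 pos by simp
      ultimately show ?thesis by (meson mult_pos_pos not_le)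
    qed
    from quadratic_stationary[OF this] show ?thesis by (simp add: x_def)
  qed
  have "sdot n (rot r q u i) (rot r q u j) = 0" if "i < r" "j < r" "i \<noteq> j" for i j
    using orth[of i j] orth[of j i] that by (metis nat_neq_iff sdot_commute)
  then show ?thesis using q by blast
qed

text \<open>The maximizer of the trace of \<open>C Q\<close>: plane rotations show that \<open>C Q\<close> is symmetric, and
  reflections show that it is positive semidefinite.\<close>

lemma exists_polar_rotation:
  fixes C :: "nat \<Rightarrow> nat \<Rightarrow> real"
  shows "\<exists>q. orthonormal r r q \<and>
    (\<forall>i<r. \<forall>j<r. sdot r (C i) (q j) = sdot r (C j) (q i)) \<and>
    (\<forall>x. 0 \<le> (\<Sum>i<r. \<Sum>j<r. x i * x j * sdot r (C i) (q j)))"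
proof -
  define \<Phi> where "\<Phi> q = (\<Sum>k<r. sdot r (C k) (q k))" for q
  have "continuous_on UNIV \<Phi>"
    unfolding \<Phi>_def sdot_def by (intro continuous_intros continuous_on_coord2)
  moreover have "\<Phi> q = \<Phi> q'" if "\<And>i j. i < r \<Longrightarrow> j < r \<Longrightarrow> q i j = q' i j" for q q'
    unfolding \<Phi>_def sdot_def using that by simp
  ultimately obtain q where q: "orthonormal r r q"
    and max: "\<And>q'. orthonormal r r q' \<Longrightarrow> \<Phi> q' \<le> \<Phi> q"
    using orthonormal_attains_max by blast
  define P where "P i j = sdot r (C i) (q j)" for i j
  have sym: "P i j = P j i" if ij: "i < r" "j < r" "i \<noteq> j" for i j
  proof (rule ccontr)
    assume ne: "P i j \<noteq> P j i"
    \<comment> \<open>A rotation (c, s) turns the trace contribution S of the two rows into c S + s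
      T. On the unit circle this is largest at (S, T) / N, with value N, and N > S because T is
      nonzero.\<close>
    define S where "S = P i i + P j j"
    define T where "T = P i j - P j i"
    define N where "N = sqrt (S\<^sup>2 + T\<^sup>2)"
    have N2: "N\<^sup>2 = S\<^sup>2 + T\<^sup>2" by (simp add: N_def)
    have T2: "T\<^sup>2 > 0" using ne by (simp add: T_def)
    have N: "N > 0" "N > S"
    proof -
      show "N > 0" unfolding N_def using T2 by (simp add: add_nonneg_pos)
      then show "N > S" using N2 T2 by (smt (verit) power2_less_imp_less)
    qed
    define c where "c = S / N"
    define s where "s = T / N"
    have one: "c\<^sup>2 + s\<^sup>2 = 1"
      using N N2 T2 by (simp add: c_def s_def power_divide add_divide_distrib[symmetric])
    have "orthonormal r r (givens i j c s q)"
      using q ij one by (intro orthonormal_givens) auto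
    from max[OF this] have "c * S + s * T \<le> S"
    proof -
      have rest: "(\<Sum>k\<in>{..<r} - {i, j}. sdot r (C k) (givens i j c s q k)) = (\<Sum>k\<in>{..<r} - {i, j}. sdot r (C k) (q k))"
        by (intro sum.cong) (auto simp: givens_def)
      show ?thesis using \<open>\<Phi> (givens i j c s q) \<le> \<Phi> q\<close> ij
        unfolding \<Phi>_def sum_split_two[OF ij] rest
        by (simp add: givens_def sdot_simps S_def T_def P_def algebra_simps)
    qed
    moreover have "c * S + s * T = N"
    proof -
      have "c * S + s * T = N\<^sup>2 / N"
        unfolding N2 by (simp add: c_def s_def add_divide_distrib power2_eq_square)
      then show ?thesis using N by (simp add: power2_eq_square)
    qed
    ultimately show False using N by simp
  qed
  have psd: "0 \<le> (\<Sum>i<r. \<Sum>j<r. x i * x j * P i j)" for x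
  proof (cases "sqnorm r x = 0")
    case True
    then show ?thesis by (auto simp: sdot_self_eq_0_iff)
  next
    case False
    then have xx: "sqnorm r x > 0" using sdot_self_nonneg[of r x] by linarith
    \<comment> \<open>Householder reflection: \<open>q'\<close> arises from \<open>q\<close> by
      reflecting in the hyperplane orthogonal to \<open>w\<close>, and k = 2 / |w|^2 because |w| =
      |x|. The trace drops by k times the quadratic form in question.\<close>
    define k where "k = 2 / sqnorm r x"
    define w where "w = (\<lambda>a. \<Sum>b<r. x b * q b a)"
    define q' where "q' j = (\<lambda>a. q j a - (k * x j) * w a)" for j
    have qq: "sdot r (q i) (q j) = (if i = j then 1 else 0)" if "i < r" "j < r" for i j
      using q that by (simp add: orthonormal_def)
    have wq: "sdot r w (q j) = x j" "sdot r (q j) w = x j" if "j < r" for j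
      using that by (simp_all add: w_def sdot_simps qq if_distrib cong: if_cong)
    have ww: "sqnorm r w = sqnorm r x"
    proof -
      have "sqnorm r w = (\<Sum>b<r. x b * sdot r (q b) w)"
        by (subst (1) w_def) (simp add: sdot_simps)
      also have "\<dots> = (\<Sum>b<r. x b * x b)" by (intro sum.cong) (simp_all add: wq)
      finally show ?thesis by (simp add: sdot_def)
    qed
    have "orthonormal r r q'"
      unfolding orthonormal_def q'_def
    proof (intro allI impI)
      fix i j assume "i < r" "j < r"
      have "sdot r (\<lambda>a. q i a - (k * x i) * w a) (\<lambda>a. q j a - (k * x j) * w a)
        = (if i = j then 1 else 0) + x i * x j * (k * (k * sqnorm r x) - 2 * k)"
        unfolding sdot_simps using \<open>i < r\<close> \<open>j < r\<close> by (simp add: qq wq ww algebra_simps)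
      also have "k * (k * sqnorm r x) - 2 * k = 0" using xx by (simp add: k_def)
      finally show "sdot r (\<lambda>a. q i a - (k * x i) * w a) (\<lambda>a. q j a - (k * x j) * w a) = (if i = j then 1 else 0)"
        by simp
    qed
    from max[OF this] have "k * (\<Sum>i<r. x i * sdot r (C i) w) \<ge> 0"
      unfolding \<Phi>_def q'_def by (simp add: sdot_simps sum_subtractf sum_distrib_left mult.assoc)
    then have "(\<Sum>i<r. x i * sdot r (C i) w) \<ge> 0"
      using xx by (simp add: k_def zero_le_divide_iff)
    then show ?thesis
      by (simp add: w_def sdot_simps sum_distrib_left P_def mult.assoc)
  qed
  have "sdot r (C i) (q j) = sdot r (C j) (q i)" if "i < r" "j < r" for i j
    using sym[OF that] by (cases "i = j") (auto simp: P_def)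
  then show ?thesis using q psd unfolding P_def by blast
qed

section \<open>The estimate at an approximate critical point\<close>

definition mat_app :: "nat \<Rightarrow> (nat \<Rightarrow> nat \<Rightarrow> real) \<Rightarrow> (nat \<Rightarrow> real) \<Rightarrow> nat \<Rightarrow> real" where
  "mat_app m g y i = (\<Sum>j<m. g i j * y j)"

definition mat_app_t :: "nat \<Rightarrow> (nat \<Rightarrow> nat \<Rightarrow> real) \<Rightarrow> (nat \<Rightarrow> real) \<Rightarrow> nat \<Rightarrow> real" where
  "mat_app_t n g x j = (\<Sum>i<n. g i j * x i)"

lemma sdot_mat_app: "sdot n x (mat_app m g y) = sdot m (mat_app_t n g x) y"
proof -
  have "sdot n x (mat_app m g y) = (\<Sum>i<n. \<Sum>j<m. g i j * x i * y j)"
    by (simp add: sdot_def mat_app_def sum_distrib_left algebra_simps)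
  also have "\<dots> = (\<Sum>j<m. \<Sum>i<n. g i j * x i * y j)"
    by (rule sum.swap)
  also have "\<dots> = sdot m (mat_app_t n g x) y"
    by (simp add: sdot_def mat_app_t_def sum_distrib_right)
  finally show ?thesis .
qed

lemma sum_sdot_mat_app:
  "(\<Sum>k<r. sdot n (x k) (mat_app m A (v k))) = (\<Sum>i<n. \<Sum>j<m. A i j * (\<Sum>k<r. x k i * v k j))"
proof -
  have "(\<Sum>k<r. sdot n (x k) (mat_app m A (v k))) = (\<Sum>k<r. \<Sum>i<n. \<Sum>j<m. A i j * (x k i * v k j))"
    by (simp add: sdot_def mat_app_def sum_distrib_left ac_simps)
  also have "\<dots> = (\<Sum>i<n. \<Sum>k<r. \<Sum>j<m. A i j * (x k i * v k j))"
    by (rule sum.swap)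
  also have "\<dots> = (\<Sum>i<n. \<Sum>j<m. \<Sum>k<r. A i j * (x k i * v k j))"
    by (rule sum.cong[OF refl], rule sum.swap)
  finally show ?thesis by (simp only: sum_distrib_left)
qed

lemma mat_app_t_lincomb:
  "mat_app_t n g (\<lambda>i. x i - (\<Sum>k\<in>A. c k * u k i)) j = mat_app_t n g x j - (\<Sum>k\<in>A. c k * mat_app_t n g (u k) j)"
proof -
  have "(\<Sum>i<n. \<Sum>k\<in>A. g i j * (c k * u k i)) = (\<Sum>k\<in>A. \<Sum>i<n. g i j * (c k * u k i))"
    by (rule sum.swap)
  then show ?thesis
    by (simp add: mat_app_t_def right_diff_distrib sum_subtractf sum_distrib_left algebra_simps)
qed

text \<open>The situation at an approximate second-order critical point \<open>(U, V)\<close>, after a rotation that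
  makes the columns of \<open>U\<close> orthogonal.  The columns are \<open>u k\<close> and \<open>v k\<close>, the matrix \<open>g\<close> is the
  gradient of the objective at \<open>U V\<^sup>T\<close>, and the target is \<open>\<Sum>\<^sub>j l\<^sub>j n\<^sub>j\<^sup>T\<close>.  The second-order
  condition is the one for the directions \<open>(x q\<^sup>T, y q\<^sup>T)\<close> with \<open>q\<close> a coordinate vector.\<close>

locale approx_critical =
  fixes n m r :: nat and u v l nn g :: "nat \<Rightarrow> nat \<Rightarrow> real" and \<delta> \<mu> \<eta> \<omega> R F :: real
  assumes r: "1 \<le> r"
    and \<delta>: "0 \<le> \<delta>" "\<delta> < 1" and \<mu>: "0 \<le> \<mu>" "\<mu> \<le> 1"
    and \<eta>: "0 < \<eta>" "\<eta> \<le> 1" and \<omega>: "0 \<le> \<omega>" "\<omega> \<le> \<eta> ^ 3" "3 * \<omega> \<le> \<eta>"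
    and RF: "0 \<le> R" "0 \<le> F"
    and u_orth: "\<And>k k'. k < r \<Longrightarrow> k' < r \<Longrightarrow> k \<noteq> k' \<Longrightarrow> sdot n (u k) (u k') = 0"
    and l_orth: "orthonormal n r l"
    and u_bd: "\<And>k. k < r \<Longrightarrow> sqnorm n (u k) \<le> R\<^sup>2"
    and n_bd: "\<And>j. j < r \<Longrightarrow> sqnorm m (nn j) \<le> F\<^sup>2"
    and gv: "\<And>k. k < r \<Longrightarrow> sqnorm n (mat_app m g (v k)) \<le> \<omega>\<^sup>2"
    and gu: "\<And>k. k < r \<Longrightarrow> sqnorm m (mat_app_t n g (u k)) \<le> \<omega>\<^sup>2"
    and bal: "\<And>k k'. k < r \<Longrightarrow> k' < r \<Longrightarrow> \<bar>sdot n (u k) (u k') - sdot m (v k) (v k')\<bar> \<le> \<omega>"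
    and second_order: "\<And>p x y. p < r \<Longrightarrow>
      0 \<le> (1 + \<delta>) * (sqnorm n x * sqnorm m (v p) + sqnorm n (u p) * sqnorm m y
              + 2 * (sdot n x (u p) * sdot m y (v p)))
        + 2 * sdot m (mat_app_t n g x) y
        + 2 * \<mu> * (\<Sum>k<r. (sdot n (u k) x - sdot m (v k) y)\<^sup>2)
        + \<mu> * (sqnorm n (u p) - sqnorm m (v p)) * (sqnorm n x - sqnorm m y)
        + \<omega> * (sqnorm n x + sqnorm m y)"
begin

text \<open>\<open>x j\<close> is \<open>l j\<close> minus its projection onto the span of the columns of \<open>U\<close>; the ridge
  parameter \<open>\<eta>\<close> keeps it bounded when \<open>U\<close> is almost rank-deficient.  The second-order condition
  is applied to the directions \<open>(x\<^sub>j q\<^sup>T, - \<tau> h\<^sub>j q\<^sup>T)\<close>, where \<open>q\<close> belongs to the shortest column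
  of \<open>U\<close>.\<close>

definition "a k = sqnorm n (u k)"
definition "w k j = sdot n (u k) (l j)"
definition "x j = (\<lambda>i. l j i - (\<Sum>k<r. w k j / (a k + \<eta>) * u k i))"
definition "h j = mat_app_t n g (x j)"
definition "pu k = (\<lambda>i. u k i - (\<Sum>j<r. w k j * l j i))"
definition "P k k' = sdot n (u k) (u k') - (\<Sum>j<r. w k j * w k' j)"

lemma a_nonneg: "0 \<le> a k" by (simp add: a_def)

lemma a_eta: "0 < a k + \<eta>" using a_nonneg[of k] \<eta> by linarith

lemma u_gram: "k < r \<Longrightarrow> k' < r \<Longrightarrow> sdot n (u k) (u k') = (if k = k' then a k else 0)"
  using u_orth by (auto simp: a_def)

lemma l_gram: "i < r \<Longrightarrow> j < r \<Longrightarrow> sdot n (l i) (l j) = (if i = j then 1 else 0)"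
  using l_orth by (simp add: orthonormal_def)

lemma l_u_eq: "sdot n (l j) (u k) = w k j" by (simp add: w_def sdot_commute)

lemma u_x_eq:
  assumes "k < r"
  shows "sdot n (u k) (x j) = w k j * (\<eta> / (a k + \<eta>))"
proof -
  have "sdot n (u k) (x j) = w k j - (\<Sum>k'<r. w k' j / (a k' + \<eta>) * sdot n (u k) (u k'))"
    unfolding x_def sdot_simps by (simp add: w_def)
  also have "(\<Sum>k'<r. w k' j / (a k' + \<eta>) * sdot n (u k) (u k')) = (\<Sum>k'<r. if k = k' then w k j / (a k + \<eta>) * a k else 0)"
    using assms by (intro sum.cong) (auto simp: u_gram)
  also have "\<dots> = w k j / (a k + \<eta>) * a k"
    using assms by simp
  also have "w k j - w k j / (a k + \<eta>) * a k = w k j * (\<eta> / (a k + \<eta>))"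
    using a_eta[of k] by (simp add: field_simps)
  finally show ?thesis .
qed

text \<open>For an exact projection |x_j|^2 would equal <l_j, x_j>. With the ridge the two differ by
  a sum of terms w^2 \<eta> / (a_k + \<eta>)^2, whose sign is known.\<close>

lemma x_norm_le:
  assumes "j < r"
  shows "sqnorm n (x j) \<le> 1 - (\<Sum>k<r. (w k j)\<^sup>2 / (a k + \<eta>))"
proof -
  have lx: "sdot n (l j) (x j) = 1 - (\<Sum>k<r. (w k j)\<^sup>2 / (a k + \<eta>))"
    unfolding x_def sdot_simps using assms by (simp add: l_gram l_u_eq power2_eq_square)
  have "sqnorm n (x j) = sdot n (l j) (x j) - (\<Sum>k<r. w k j / (a k + \<eta>) * sdot n (u k) (x j))"
    by (subst (1) x_def) (simp only: sdot_simps)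
  moreover have "0 \<le> (\<Sum>k<r. w k j / (a k + \<eta>) * sdot n (u k) (x j))"
  proof (rule sum_nonneg)
    fix k assume "k \<in> {..<r}"
    then have "w k j / (a k + \<eta>) * sdot n (u k) (x j) = (w k j)\<^sup>2 * \<eta> / (a k + \<eta>)\<^sup>2"
      by (simp add: u_x_eq power2_eq_square)
    also have "\<dots> \<ge> 0" using \<eta> by simp
    finally show "0 \<le> w k j / (a k + \<eta>) * sdot n (u k) (x j)" .
  qed
  ultimately show ?thesis using lx by linarith
qed

lemma x_norm_le_1: "j < r \<Longrightarrow> sqnorm n (x j) \<le> 1"
proof -
  assume "j < r"
  have "0 \<le> (\<Sum>k<r. (w k j)\<^sup>2 / (a k + \<eta>))"
    using a_eta by (intro sum_nonneg divide_nonneg_pos) auto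
  then show ?thesis using x_norm_le[OF \<open>j < r\<close>] by linarith
qed

text \<open>\<open>pu k\<close> is the component of u_k orthogonal to the span of the l_j, so
  \<open>P\<close> is a Gram matrix: the part of U^T U that the target's column space does not
  see.\<close>

lemma P_eq:
  "P k k' = sdot n (pu k) (pu k')"
proof -
  have "sdot n (l j) (pu k') = 0" if "j < r" for j
  proof -
    have "(\<Sum>i<r. w k' i * sdot n (l j) (l i)) = (\<Sum>i<r. if j = i then w k' j else 0)"
      using that by (intro sum.cong) (auto simp: l_gram)
    then show ?thesis
      unfolding pu_def sdot_simps using that by (simp add: l_u_eq)
  qed
  then have "sdot n (pu k) (pu k') = sdot n (u k) (pu k')"
    by (subst (1) pu_def) (simp add: sdot_simps)
  also have "\<dots> = P k k'"
    unfolding pu_def sdot_simps P_def by (simp add: w_def mult.commute)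
  finally show ?thesis ..
qed

lemma P_nonneg: "0 \<le> P k k" by (simp add: P_eq)

lemma P_diag_le: "P k k \<le> a k"
  by (simp add: P_def a_def sum_nonneg)

lemma a_le: "k < r \<Longrightarrow> a k \<le> R\<^sup>2"
  using u_bd by (simp add: a_def)

lemma P_abs_le:
  assumes "k < r" "k' < r"
  shows "\<bar>P k k'\<bar> \<le> R\<^sup>2"
proof -
  have "sqnorm n (pu i) \<le> R\<^sup>2" if "i < r" for i
    using P_diag_le[of i] a_le[OF that] by (simp add: P_eq)
  then have "\<bar>sdot n (pu k) (pu k')\<bar> \<le> R * R"
    using assms RF(1) by (intro abs_sdot_le) simp_all
  then show ?thesis
    by (simp add: P_eq power2_eq_square)
qed

lemma w_sq_le: "j < r \<Longrightarrow> (w k j)\<^sup>2 \<le> a k"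
proof -
  assume "j < r"
  then have "(w k j)\<^sup>2 \<le> (\<Sum>j<r. w k j * w k j)"
    unfolding power2_eq_square by (intro member_le_sum) auto
  then show ?thesis using P_nonneg[of k] by (simp add: P_def a_def)
qed

lemma w_abs_le: "k < r \<Longrightarrow> j < r \<Longrightarrow> \<bar>w k j\<bar> \<le> R"
  using order_trans[OF w_sq_le[of j k] a_le[of k]] RF(1) by (simp add: power2_le_iff_abs_le)

text \<open>Moving G to the other side of the product gives <x_j, G v_k>, where G V is known to be
  small.\<close>

lemma v_h_abs_le:
  assumes "k < r" "j < r"
  shows "\<bar>sdot m (v k) (h j)\<bar> \<le> \<omega>"
proof -
  have "sdot m (v k) (h j) = sdot m (h j) (v k)"
    by (rule sdot_commute)
  also have "\<dots> = sdot n (x j) (mat_app m g (v k))"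
    by (simp add: sdot_mat_app h_def)
  finally have "sdot m (v k) (h j) = sdot n (x j) (mat_app m g (v k))" .
  then show ?thesis
    using abs_sdot_le[of n "x j" 1 "mat_app m g (v k)" \<omega>] x_norm_le_1 gv assms \<omega> by simp
qed

text \<open>The bound is uniform in the length of u_k: w^2 \<le> a_k, and a_k \<eta> \<le> (a_k +
  \<eta>)^2 whether a_k is large or small.\<close>

lemma u_x_sq_le:
  assumes "k < r" "j < r"
  shows "(sdot n (u k) (x j))\<^sup>2 \<le> \<eta>"
proof -
  have "(sdot n (u k) (x j))\<^sup>2 = (w k j)\<^sup>2 * \<eta>\<^sup>2 / (a k + \<eta>)\<^sup>2"
    using assms by (simp add: u_x_eq power_mult_distrib power_divide)
  also have "\<dots> \<le> a k * \<eta>\<^sup>2 / (a k + \<eta>)\<^sup>2"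
    using w_sq_le assms by (intro divide_right_mono mult_right_mono) auto
  also have "\<dots> \<le> \<eta>"
  proof -
    have "a k * \<eta> \<le> (a k + \<eta>)\<^sup>2"
      using a_nonneg[of k] \<eta> by (simp add: power2_eq_square algebra_simps add_nonneg_nonneg)
    then have "(a k * \<eta>) * \<eta> \<le> (a k + \<eta>)\<^sup>2 * \<eta>"
      using \<eta> by (intro mult_right_mono) auto
    moreover have "a k * \<eta>\<^sup>2 = (a k * \<eta>) * \<eta>"
      by (simp add: power2_eq_square)
    ultimately have "a k * \<eta>\<^sup>2 \<le> \<eta> * (a k + \<eta>)\<^sup>2"
      by (simp only: mult.commute[of \<eta> "(a k + \<eta>)\<^sup>2"])
    then show ?thesis using a_eta[of k] by (simp add: divide_le_eq)
  qed
  finally show ?thesis .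
qed

section \<open>The Hessian test along the shortest column\<close>

definition "p = (SOME p. p < r \<and> (\<forall>k<r. a p \<le> a k))"

lemma p: "p < r" "k < r \<Longrightarrow> a p \<le> a k"
proof -
  have "finite (a ` {..<r})" "a ` {..<r} \<noteq> {}"
    using r by (auto simp: lessThan_empty_iff)
  from Min_in[OF this] obtain q where "q < r" "a q = Min (a ` {..<r})" by auto
  then have "\<exists>p. p < r \<and> (\<forall>k<r. a p \<le> a k)" by (intro exI[of _ q]) auto
  from someI_ex[OF this] show "p < r" "k < r \<Longrightarrow> a p \<le> a k"
    by (simp_all add: p_def)
qed

text \<open>In the balanced limit a_p is the least singular value of M; \<open>s\<close> is its
  regularized form and serves as the bound for the norm of t G.\<close>

definition "s = a p + \<eta>"

lemma s: "0 < s" "\<eta> \<le> s" "s \<le> R\<^sup>2 + 1"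
  unfolding s_def using a_eta a_nonneg a_le[OF p(1)] \<eta> by (auto simp: add_mono)

definition "t = 1 / (1 + \<delta>)"

lemma t: "0 < t" "t \<le> 1" "(1 + \<delta>) * t = 1"
  using \<delta> by (auto simp: t_def)

text \<open>The ridge denominators are at least \<eta>, so errors of size \<omega> reappear as
  \<omega> / \<eta>; the cubic relation between the two parameters keeps these below \<eta>.\<close>

lemma omega_div_eta: "\<omega> / \<eta> \<le> \<eta>" "\<omega> \<le> \<eta>" "\<omega> / \<eta> \<le> 1" "0 \<le> \<omega> / \<eta>"
proof -
  have "\<omega> \<le> \<eta> * \<eta>\<^sup>2" using \<omega> by (simp add: power3_eq_cube power2_eq_square)
  also have "\<eta> * \<eta>\<^sup>2 \<le> \<eta> * \<eta>"
    using \<eta> by (simp add: power2_eq_square mult_left_le)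
  finally show *: "\<omega> / \<eta> \<le> \<eta>" using \<eta> by (simp add: divide_le_eq)
  then show "\<omega> / \<eta> \<le> 1" using \<eta> by linarith
  show "\<omega> \<le> \<eta>" using \<omega> by linarith
  show "0 \<le> \<omega> / \<eta>" using \<omega> \<eta> by simp
qed

text \<open>The error-free content is |G^T x| \<le> (1 + \<delta>) s |x|, a spectral bound on G by
  the least singular value of M, needed only for the vectors x_j.\<close>

lemma h_bound:
  assumes j: "j < r"
  shows "t\<^sup>2 * sqnorm m (h j) \<le> s\<^sup>2 * sqnorm n (x j) + (R\<^sup>2 + 1) * (4 * R + 8 * r) * \<eta>"
proof -
  define X where "X = sqnorm n (x j)"
  define H where "H = sqnorm m (h j)"
  \<comment> \<open>With y = - \<tau> h the main part (1 + \<delta>) s (|x|^2 + |y|^2) + 2 <h, y> is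
    minimal at \<tau> = 1 / ((1 + \<delta>) s), which is t / s.\<close>
  define \<tau> where "\<tau> = t / s"
  define y where "y = (\<lambda>i. (- \<tau>) * h j i)"
  define vp where "vp = sqnorm m (v p)"
  define e where "e = (4 * R + 8 * r) * \<eta>"
  have \<tau>: "0 < \<tau>" "(1 + \<delta>) * s * \<tau> = 1" "\<tau> \<le> 1 / \<eta>"
  proof -
    show "0 < \<tau>" using t s by (simp add: \<tau>_def)
    show "(1 + \<delta>) * s * \<tau> = 1" using t s by (simp add: \<tau>_def)
    show "\<tau> \<le> 1 / \<eta>" unfolding \<tau>_def using t s \<eta> by (intro frac_le) auto
  qed
  have X: "0 \<le> X" "X \<le> 1" using x_norm_le_1[OF j] by (simp_all add: X_def)
  have H: "0 \<le> H" by (simp add: H_def)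
  have yy: "sqnorm m y = \<tau>\<^sup>2 * H"
    unfolding y_def sdot_simps by (simp add: H_def power2_eq_square)
  have hy: "sdot m (mat_app_t n g (x j)) y = - \<tau> * H"
    unfolding y_def sdot_simps by (simp add: H_def h_def)
  have vy: "\<bar>sdot m (v k) y\<bar> \<le> \<omega> / \<eta>" if "k < r" for k
  proof -
    have "\<bar>sdot m (v k) y\<bar> = \<tau> * \<bar>sdot m (v k) (h j)\<bar>"
      unfolding y_def sdot_simps using \<tau> by (simp add: abs_mult)
    also have "\<dots> \<le> 1 / \<eta> * \<omega>"
      using \<tau> v_h_abs_le[OF that j] \<eta> by (intro mult_mono) auto
    finally show ?thesis by simp
  qed
  \<comment> \<open>The cross term and the imbalance derivative (\<open>e2\<close>) are harmless
    because x_j is almost orthogonal to the u_k or y to the v_k.\<close>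
  have e1: "sdot n (x j) (u p) * sdot m y (v p) \<le> R * \<eta>"
  proof -
    have "\<bar>sdot n (x j) (u p)\<bar> \<le> 1 * R"
      using X u_bd[OF p(1)] RF by (intro abs_sdot_le) (auto simp: X_def)
    moreover have "\<bar>sdot m y (v p)\<bar> \<le> \<eta>"
      using vy[OF p(1)] omega_div_eta by (simp add: sdot_commute)
    ultimately have "\<bar>sdot n (x j) (u p)\<bar> * \<bar>sdot m y (v p)\<bar> \<le> R * \<eta>"
      using RF by (intro mult_mono) auto
    then show ?thesis using abs_ge_self order_trans unfolding abs_mult[symmetric] by blast
  qed
  have e2: "(\<Sum>k<r. (sdot n (u k) (x j) - sdot m (v k) y)\<^sup>2) \<le> 4 * r * \<eta>"
  proof -
    have "(sdot n (u k) (x j) - sdot m (v k) y)\<^sup>2 \<le> 4 * \<eta>" if "k < r" for k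
    proof -
      have "(sdot m (v k) y)\<^sup>2 \<le> (\<omega> / \<eta>)\<^sup>2"
        using vy[OF that] omega_div_eta(4) by (simp add: power2_le_iff_abs_le)
      also have "\<dots> \<le> \<eta>"
      proof -
        have "(\<omega> / \<eta>)\<^sup>2 \<le> \<eta> * 1"
          unfolding power2_eq_square using omega_div_eta \<eta> by (intro mult_mono) auto
        then show ?thesis by simp
      qed
      finally have "(sdot m (v k) y)\<^sup>2 \<le> \<eta>" .
      moreover have "(sdot n (u k) (x j) - sdot m (v k) y)\<^sup>2
          \<le> 2 * (sdot n (u k) (x j))\<^sup>2 + 2 * (sdot m (v k) y)\<^sup>2"
        using zero_le_power2[of "sdot n (u k) (x j) + sdot m (v k) y"]
        unfolding power2_sum power2_diff by linarith
      ultimately show ?thesis using u_x_sq_le[OF that j] by linarith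
    qed
    then have "(\<Sum>k<r. (sdot n (u k) (x j) - sdot m (v k) y)\<^sup>2) \<le> (\<Sum>k<r. 4 * \<eta>)"
      by (intro sum_mono) auto
    then show ?thesis by simp
  qed
  have b: "\<bar>a p - vp\<bar> \<le> \<omega>"
    using bal[OF p(1) p(1)] by (simp add: a_def vp_def)
  have e3: "\<mu> * (a p - vp) * (X - \<tau>\<^sup>2 * H) \<le> \<omega> * (X + \<tau>\<^sup>2 * H)"
  proof -
    have "\<mu> * (a p - vp) * (X - \<tau>\<^sup>2 * H) \<le> \<bar>\<mu> * (a p - vp)\<bar> * \<bar>X - \<tau>\<^sup>2 * H\<bar>"
      unfolding abs_mult[symmetric] by (rule abs_ge_self)
    also have "\<dots> \<le> \<omega> * (X + \<tau>\<^sup>2 * H)"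
    proof (rule mult_mono)
      show "\<bar>\<mu> * (a p - vp)\<bar> \<le> \<omega>"
      proof -
        have "\<mu> * \<bar>a p - vp\<bar> \<le> 1 * \<omega>"
          using b \<mu> by (intro mult_mono) auto
        then show ?thesis using \<mu> by (simp add: abs_mult)
      qed
      have "0 \<le> \<tau>\<^sup>2 * H" using H by simp
      then show "\<bar>X - \<tau>\<^sup>2 * H\<bar> \<le> X + \<tau>\<^sup>2 * H"
        using X by linarith
    qed (use \<omega> in auto)
    finally show ?thesis .
  qed
  have e1': "(1 + \<delta>) * (2 * (sdot n (x j) (u p) * sdot m y (v p))) \<le> 4 * R * \<eta>"
  proof -
    have "(1 + \<delta>) * (2 * (sdot n (x j) (u p) * sdot m y (v p))) \<le> (1 + \<delta>) * (2 * (R * \<eta>))"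
      using e1 \<delta> by (intro mult_left_mono) auto
    also have "\<dots> \<le> 2 * (2 * (R * \<eta>))"
      using \<delta> RF \<eta> by (intro mult_right_mono) auto
    finally show ?thesis by simp
  qed
  have e2': "2 * \<mu> * (\<Sum>k<r. (sdot n (u k) (x j) - sdot m (v k) y)\<^sup>2) \<le> 8 * r * \<eta>"
  proof -
    have "\<mu> * (\<Sum>k<r. (sdot n (u k) (x j) - sdot m (v k) y)\<^sup>2) \<le> 1 * (4 * r * \<eta>)"
      using e2 \<mu> by (intro mult_mono) (auto intro: sum_nonneg)
    then show ?thesis by linarith
  qed
  \<comment> \<open>Three copies of \<omega> have to fit into the ridge: one for replacing |v_p|^2
    by a_p, one from \<open>e3\<close>, one from the slack in the Hessian condition. This is the
    origin of 3 \<omega> \<le> \<eta>.\<close>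
  have X': "(1 + \<delta>) * (X * vp) + 2 * \<omega> * X \<le> (1 + \<delta>) * s * X"
  proof -
    have "(1 + \<delta>) * vp + 2 * \<omega> \<le> (1 + \<delta>) * (a p + \<omega>) + (1 + \<delta>) * (2 * \<omega>)"
    proof (rule add_mono)
      show "(1 + \<delta>) * vp \<le> (1 + \<delta>) * (a p + \<omega>)"
        using b \<delta> by (intro mult_left_mono) auto
      show "2 * \<omega> \<le> (1 + \<delta>) * (2 * \<omega>)" using \<delta> \<omega> by (simp add: algebra_simps)
    qed
    also have "\<dots> = (1 + \<delta>) * (a p + 3 * \<omega>)" by (simp add: algebra_simps)
    also have "\<dots> \<le> (1 + \<delta>) * s"
      unfolding s_def using \<omega> \<delta> by (intro mult_left_mono) auto
    finally have "((1 + \<delta>) * vp + 2 * \<omega>) * X \<le> (1 + \<delta>) * s * X"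
      using X by (intro mult_right_mono)
    then show ?thesis by (simp add: algebra_simps)
  qed
  have Y': "(1 + \<delta>) * (a p * (\<tau>\<^sup>2 * H)) + 2 * \<omega> * (\<tau>\<^sup>2 * H) \<le> \<tau> * H"
  proof -
    have "(1 + \<delta>) * a p + 2 * \<omega> \<le> (1 + \<delta>) * a p + (1 + \<delta>) * \<eta>"
    proof -
      have "0 \<le> \<delta> * \<eta>" using \<delta> \<eta> by simp
      then show ?thesis using \<omega> by (simp add: distrib_right)
    qed
    also have "\<dots> = (1 + \<delta>) * s" by (simp add: s_def algebra_simps)
    finally have "((1 + \<delta>) * a p + 2 * \<omega>) * (\<tau>\<^sup>2 * H) \<le> (1 + \<delta>) * s * (\<tau>\<^sup>2 * H)"
      using H by (intro mult_right_mono) auto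
    also have "\<dots> = ((1 + \<delta>) * s * \<tau>) * (\<tau> * H)"
      by (simp add: power2_eq_square)
    also have "\<dots> = \<tau> * H" using \<tau> by simp
    finally show ?thesis by (simp add: algebra_simps)
  qed
  have so': "0 \<le> (1 + \<delta>) * (X * vp) + (1 + \<delta>) * (a p * (\<tau>\<^sup>2 * H))
        + (1 + \<delta>) * (2 * (sdot n (x j) (u p) * sdot m y (v p)))
        + 2 * (- \<tau> * H)
        + 2 * \<mu> * (\<Sum>k<r. (sdot n (u k) (x j) - sdot m (v k) y)\<^sup>2)
        + \<mu> * (a p - vp) * (X - \<tau>\<^sup>2 * H)
        + \<omega> * (X + \<tau>\<^sup>2 * H)"
    using second_order[OF p(1), of "x j" y]
    unfolding yy hy X_def[symmetric] vp_def[symmetric] a_def[symmetric] distrib_left[of "1 + \<delta>"] .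
  have \<omega>': "\<omega> * (X + \<tau>\<^sup>2 * H) = \<omega> * X + \<omega> * (\<tau>\<^sup>2 * H)"
    by (rule distrib_left)
  have e: "e = 4 * R * \<eta> + 8 * r * \<eta>"
    by (simp add: e_def distrib_right)
  have "\<tau> * H \<le> (1 + \<delta>) * s * X + e"
    using so' e1' e2' e3 X' Y' unfolding e \<omega>' by linarith
  then have "(t * s) * (\<tau> * H) \<le> (t * s) * ((1 + \<delta>) * s * X + e)"
    using t s by (intro mult_left_mono) auto
  moreover have "(t * s) * (\<tau> * H) = t\<^sup>2 * H"
    using s(1) by (simp add: \<tau>_def power2_eq_square)
  moreover have "(t * s) * ((1 + \<delta>) * s * X + e) = s\<^sup>2 * X + t * s * e"
  proof -
    have "(t * s) * ((1 + \<delta>) * s * X + e) = ((1 + \<delta>) * t) * (s\<^sup>2 * X) + t * s * e"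
      by (simp add: power2_eq_square algebra_simps)
    then show ?thesis by (simp only: t(3) mult_1)
  qed
  moreover have "t * s * e \<le> (R\<^sup>2 + 1) * e"
  proof (rule mult_right_mono)
    have "t * s \<le> 1 * (R\<^sup>2 + 1)" using t s by (intro mult_mono) auto
    then show "t * s \<le> R\<^sup>2 + 1" by simp
    show "0 \<le> e" using RF \<eta> by (simp add: e_def)
  qed
  ultimately have "t\<^sup>2 * H \<le> s\<^sup>2 * X + (R\<^sup>2 + 1) * e" by linarith
  then show ?thesis unfolding X_def H_def e_def by (simp only: mult.assoc)
qed

text \<open>Two r-dimensional spaces make the same principal angles seen from either side:
  exchanging the sums over j and k turns the residuals of the l_j against U into those of the u_k
  against the l_j. Then s \<le> a_k + \<eta>, by the choice of the shortest column, converts s^2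
  into the weights a_k.\<close>

lemma sum_x_norm_le: "s\<^sup>2 * (\<Sum>j<r. sqnorm n (x j)) \<le> (\<Sum>k<r. a k * P k k) + r * (2 * R\<^sup>2 + 1) * \<eta>"
proof -
  have "(\<Sum>j<r. sqnorm n (x j)) \<le> (\<Sum>j<r. 1 - (\<Sum>k<r. (w k j)\<^sup>2 / (a k + \<eta>)))"
    by (intro sum_mono x_norm_le) auto
  also have "\<dots> = r - (\<Sum>k<r. \<Sum>j<r. (w k j)\<^sup>2 / (a k + \<eta>))"
    by (simp add: sum_subtractf) (rule sum.swap)
  also have "\<dots> = (\<Sum>k<r. 1 - (\<Sum>j<r. (w k j)\<^sup>2 / (a k + \<eta>)))"
    by (simp add: sum_subtractf)
  also have "\<dots> = (\<Sum>k<r. (P k k + \<eta>) / (a k + \<eta>))"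
  proof (rule sum.cong)
    fix k assume "k \<in> {..<r}"
    have "P k k = a k - (\<Sum>j<r. (w k j)\<^sup>2)"
      by (simp add: P_def a_def power2_eq_square)
    then show "1 - (\<Sum>j<r. (w k j)\<^sup>2 / (a k + \<eta>)) = (P k k + \<eta>) / (a k + \<eta>)"
      using a_eta[of k] by (simp add: sum_divide_distrib[symmetric] field_simps)
  qed simp
  finally have "s\<^sup>2 * (\<Sum>j<r. sqnorm n (x j)) \<le> s\<^sup>2 * (\<Sum>k<r. (P k k + \<eta>) / (a k + \<eta>))"
    by (intro mult_left_mono) auto
  also have "\<dots> = (\<Sum>k<r. s\<^sup>2 * ((P k k + \<eta>) / (a k + \<eta>)))"
    by (simp add: sum_distrib_left)
  also have "\<dots> \<le> (\<Sum>k<r. a k * P k k + (2 * R\<^sup>2 + 1) * \<eta>)"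
  proof (rule sum_mono)
    fix k assume "k \<in> {..<r}"
    then have k: "k < r" by simp
    have "s\<^sup>2 * ((P k k + \<eta>) / (a k + \<eta>)) \<le> (a k + \<eta>)\<^sup>2 * ((P k k + \<eta>) / (a k + \<eta>))"
      using p(2)[OF k] s P_nonneg[of k] a_eta[of k] \<eta>
      by (intro mult_right_mono power_mono divide_nonneg_pos) (auto simp: s_def)
    also have "\<dots> = (a k + \<eta>) * (P k k + \<eta>)"
      using a_eta[of k] by (simp add: power2_eq_square)
    also have "\<dots> = a k * P k k + (a k + P k k + \<eta>) * \<eta>"
      by (simp add: algebra_simps)
    also have "\<dots> \<le> a k * P k k + (2 * R\<^sup>2 + 1) * \<eta>"
      using a_le[OF k] P_diag_le[of k] \<eta> by (intro add_left_mono mult_right_mono) auto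
    finally show "s\<^sup>2 * ((P k k + \<eta>) / (a k + \<eta>)) \<le> a k * P k k + (2 * R\<^sup>2 + 1) * \<eta>" .
  qed
  also have "\<dots> = (\<Sum>k<r. a k * P k k) + r * (2 * R\<^sup>2 + 1) * \<eta>"
    by (simp add: sum.distrib algebra_simps)
  finally show ?thesis .
qed

section \<open>Orthogonal splitting of the error and the pairing with the gradient\<close>

definition "M i j = (\<Sum>k<r. u k i * v k j)"
definition "N i j = (\<Sum>k<r. l k i * nn k j)"
text \<open>This is (M - N)^T l_j, since M^T l_j combines the v_k with the weights w and N^T l_j is
  n_j.\<close>

definition "d j = (\<lambda>i. (\<Sum>k<r. w k j * v k i) - nn j i)"

end

text \<open>The identity <U V^T, U' V'^T> = <U^T U', V^T V'> reduces every Frobenius product in the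
  proof to Gram matrices.\<close>

lemma sum_outer_products:
  "(\<Sum>i<n. \<Sum>j<m. (\<Sum>k<p. u k i * v k j) * (\<Sum>k<q. u' k i * v' k j))
    = (\<Sum>k<p. \<Sum>k'<q. sdot n (u k) (u' k') * sdot m (v k) (v' k'))"
proof -
  let ?A = "\<lambda>i j. \<Sum>k<q. u' k i * v' k j"
  have "mat_app m ?A y = (\<lambda>i. \<Sum>k<q. sdot m y (v' k) * u' k i)" for y
  proof
    fix i
    have "mat_app m ?A y i = (\<Sum>j<m. \<Sum>k<q. y j * v' k j * u' k i)"
      by (simp add: mat_app_def sum_distrib_left ac_simps)
    also have "\<dots> = (\<Sum>k<q. sdot m y (v' k) * u' k i)"
      unfolding sdot_def sum_distrib_right by (rule sum.swap)
    finally show "mat_app m ?A y i = (\<Sum>k<q. sdot m y (v' k) * u' k i)" .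
  qed
  then have "(\<Sum>k<p. sdot n (u k) (mat_app m ?A (v k)))
      = (\<Sum>k<p. \<Sum>k'<q. sdot m (v k) (v' k') * sdot n (u k) (u' k'))"
    by (simp only: sdot_sum_right sdot_scale_right)
  then show ?thesis
    unfolding sum_sdot_mat_app by (simp only: mult.commute)
qed

text \<open>The summands are, in order: the pairing <G, M>; replacing l_j by x_j; replacing - n_j by
  d_j; \<open>h_bound\<close>; \<open>sum_x_norm_le\<close>; and the passage from V^T V to U^T U in
  \<open>E_norm_ge\<close>.\<close>

definition err_const :: "nat \<Rightarrow> real \<Rightarrow> real \<Rightarrow> real" where
  "err_const r R F = 2 * r * R + 2 * r\<^sup>2 * R * F + 2 * r\<^sup>2 * R + r * (R\<^sup>2 + 1) * (4 * R + 8 * r)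
   + r * (2 * R\<^sup>2 + 1) + r\<^sup>2 * R\<^sup>2"

context approx_critical
begin

text \<open>Pythagoras for the projection onto the span of the l_j: inside it the rows of M - N are
  the d_j, outside it N vanishes and M is the sum of the products of pu_k and v_k.\<close>

lemma E_norm:
  "(\<Sum>i<n. \<Sum>j<m. (M i j - N i j)\<^sup>2)
     = (\<Sum>j<r. sqnorm m (d j)) + (\<Sum>k<r. \<Sum>k'<r. P k k' * sdot m (v k) (v k'))"
proof -
  have "(\<Sum>i<n. \<Sum>j<m. (M i j - N i j)\<^sup>2)
      = (\<Sum>i<n. \<Sum>j<m. M i j * M i j) - 2 * (\<Sum>i<n. \<Sum>j<m. M i j * N i j) + (\<Sum>i<n. \<Sum>j<m. N i j * N i j)"
    by (simp add: power2_eq_square algebra_simps sum.distrib sum_subtractf sum_distrib_left)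
  also have "(\<Sum>i<n. \<Sum>j<m. M i j * M i j) = (\<Sum>k<r. \<Sum>k'<r. sdot n (u k) (u k') * sdot m (v k) (v k'))"
    unfolding M_def by (rule sum_outer_products)
  also have "(\<Sum>i<n. \<Sum>j<m. M i j * N i j) = (\<Sum>k<r. \<Sum>j<r. w k j * sdot m (v k) (nn j))"
    unfolding M_def N_def sum_outer_products by (simp add: w_def)
  also have "(\<Sum>i<n. \<Sum>j<m. N i j * N i j) = (\<Sum>j<r. sqnorm m (nn j))"
  proof -
    have "(\<Sum>i<n. \<Sum>j<m. N i j * N i j) = (\<Sum>k<r. \<Sum>k'<r. sdot n (l k) (l k') * sdot m (nn k) (nn k'))"
      unfolding N_def by (rule sum_outer_products)
    also have "\<dots> = (\<Sum>k<r. \<Sum>k'<r. if k = k' then sqnorm m (nn k) else 0)"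
      by (intro sum.cong) (auto simp: l_gram)
    finally show ?thesis by simp
  qed
  finally have 1: "(\<Sum>i<n. \<Sum>j<m. (M i j - N i j)\<^sup>2) = (\<Sum>k<r. \<Sum>k'<r. sdot n (u k) (u k') * sdot m (v k) (v k'))
     - 2 * (\<Sum>k<r. \<Sum>j<r. w k j * sdot m (v k) (nn j)) + (\<Sum>j<r. sqnorm m (nn j))" .
  have "sqnorm m (d j) = (\<Sum>k<r. \<Sum>k'<r. w k j * w k' j * sdot m (v k) (v k'))
      - 2 * (\<Sum>k<r. w k j * sdot m (v k) (nn j)) + sqnorm m (nn j)" for j
  proof -
    have "sdot m (nn j) (v k) = sdot m (v k) (nn j)" for k by (rule sdot_commute)
    then show ?thesis
      unfolding d_def sdot_simps
      by (simp add: sum_distrib_left mult.assoc sum_subtractf right_diff_distrib sum_negf)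
  qed
  then have 2: "(\<Sum>j<r. sqnorm m (d j)) = (\<Sum>j<r. \<Sum>k<r. \<Sum>k'<r. w k j * w k' j * sdot m (v k) (v k'))
      - 2 * (\<Sum>j<r. \<Sum>k<r. w k j * sdot m (v k) (nn j)) + (\<Sum>j<r. sqnorm m (nn j))"
    by (simp add: sum.distrib sum_subtractf sum_distrib_left)
  have 3: "(\<Sum>j<r. \<Sum>k<r. w k j * sdot m (v k) (nn j)) = (\<Sum>k<r. \<Sum>j<r. w k j * sdot m (v k) (nn j))"
    by (rule sum.swap)
  have 4: "(\<Sum>j<r. \<Sum>k<r. \<Sum>k'<r. w k j * w k' j * sdot m (v k) (v k'))
     = (\<Sum>k<r. \<Sum>k'<r. (\<Sum>j<r. w k j * w k' j) * sdot m (v k) (v k'))"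
  proof -
    have "(\<Sum>j<r. \<Sum>k<r. \<Sum>k'<r. w k j * w k' j * sdot m (v k) (v k'))
      = (\<Sum>k<r. \<Sum>j<r. \<Sum>k'<r. w k j * w k' j * sdot m (v k) (v k'))" by (rule sum.swap)
    also have "\<dots> = (\<Sum>k<r. \<Sum>k'<r. \<Sum>j<r. w k j * w k' j * sdot m (v k) (v k'))"
      by (rule sum.cong[OF refl], rule sum.swap)
    finally show ?thesis by (simp add: sum_distrib_right)
  qed
  show ?thesis
    unfolding 1 2 3 4 P_def by (simp add: left_diff_distrib sum_subtractf)
qed

text \<open>Near balance allows V^T V to be replaced by U^T U, which is diagonal, so only the
  diagonal of \<open>P\<close> survives.\<close>

lemma E_norm_ge:
  "(\<Sum>j<r. sqnorm m (d j)) + (\<Sum>k<r. a k * P k k)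
    \<le> (\<Sum>i<n. \<Sum>j<m. (M i j - N i j)\<^sup>2) + r\<^sup>2 * R\<^sup>2 * \<eta>"
proof -
  have "(\<Sum>k<r. a k * P k k) = (\<Sum>k<r. \<Sum>k'<r. P k k' * sdot n (u k) (u k'))"
  proof (rule sum.cong)
    fix k assume "k \<in> {..<r}"
    then have "(\<Sum>k'<r. P k k' * sdot n (u k) (u k')) = (\<Sum>k'<r. if k = k' then P k k * a k else 0)"
      by (intro sum.cong) (auto simp: u_gram)
    then show "a k * P k k = (\<Sum>k'<r. P k k' * sdot n (u k) (u k'))"
      using \<open>k \<in> {..<r}\<close> by simp
  qed simp
  also have "\<dots> = (\<Sum>k<r. \<Sum>k'<r. P k k' * sdot m (v k) (v k'))
      + (\<Sum>k<r. \<Sum>k'<r. P k k' * (sdot n (u k) (u k') - sdot m (v k) (v k')))"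
    by (simp add: right_diff_distrib sum_subtractf)
  finally have eq: "(\<Sum>k<r. a k * P k k) = (\<Sum>k<r. \<Sum>k'<r. P k k' * sdot m (v k) (v k'))
      + (\<Sum>k<r. \<Sum>k'<r. P k k' * (sdot n (u k) (u k') - sdot m (v k) (v k')))" .
  have "(\<Sum>k<r. \<Sum>k'<r. P k k' * (sdot n (u k) (u k') - sdot m (v k) (v k')))
     \<le> (\<Sum>k<r. \<Sum>k'<r. R\<^sup>2 * \<eta>)"
  proof (intro sum_mono)
    fix k k' assume "k \<in> {..<r}" "k' \<in> {..<r}"
    then have kk: "k < r" "k' < r" by auto
    have "\<bar>P k k'\<bar> * \<bar>sdot n (u k) (u k') - sdot m (v k) (v k')\<bar> \<le> R\<^sup>2 * \<eta>"
      using P_abs_le[OF kk] bal[OF kk] omega_div_eta by (intro mult_mono) auto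
    then show "P k k' * (sdot n (u k) (u k') - sdot m (v k) (v k')) \<le> R\<^sup>2 * \<eta>"
      by (metis abs_ge_self abs_mult order_trans)
  qed
  also have "\<dots> = r\<^sup>2 * R\<^sup>2 * \<eta>"
    by (simp add: power2_eq_square mult.assoc)
  finally show ?thesis
    unfolding E_norm using eq by linarith
qed

text \<open>Without the error terms this is the statement that \<open>M\<close> is a best approximation of rank
  \<open>r\<close> of \<open>M - t G\<close>, so that \<open>\<parallel>M - t G - N\<parallel> \<ge> \<parallel>t G\<parallel>\<close> for the rank-\<open>r\<close> matrix \<open>N\<close>.\<close>

lemma gradient_pairing_le:
  "2 * t * ((\<Sum>k<r. sdot n (u k) (mat_app m g (v k))) - (\<Sum>j<r. sdot n (l j) (mat_app m g (nn j))))
    \<le> (\<Sum>i<n. \<Sum>j<m. (M i j - N i j)\<^sup>2) + err_const r R F * \<eta>"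
proof -
  have A: "(\<Sum>k<r. sdot n (u k) (mat_app m g (v k))) \<le> r * R * \<eta>"
  proof -
    have "sdot n (u k) (mat_app m g (v k)) \<le> R * \<eta>" if "k < r" for k
    proof -
      have "\<bar>sdot n (u k) (mat_app m g (v k))\<bar> \<le> R * \<omega>"
        using u_bd gv that RF \<omega> by (intro abs_sdot_le) auto
      also have "\<dots> \<le> R * \<eta>" using omega_div_eta RF by (intro mult_left_mono) auto
      finally show ?thesis by simp
    qed
    then have "(\<Sum>k<r. sdot n (u k) (mat_app m g (v k))) \<le> (\<Sum>k<r. R * \<eta>)"
      by (intro sum_mono) auto
    then show ?thesis by simp
  qed
  have B: "- (2 * t * sdot n (l j) (mat_app m g (nn j)))
      \<le> t\<^sup>2 * sqnorm m (h j) + sqnorm m (d j) + (2 * r * R * F + 2 * r * R) * \<eta>"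
    if j: "j < r" for j
  proof -
    \<comment> \<open>x_j differs from l_j by a combination of the u_k, and G^T U is small; the
      coefficients cost a factor 1 / \<eta>.\<close>
    have "sdot n (l j) (mat_app m g (nn j)) = sdot m (h j) (nn j)
        + (\<Sum>k<r. w k j / (a k + \<eta>) * sdot m (mat_app_t n g (u k)) (nn j))"
    proof -
      have "h j = (\<lambda>i. mat_app_t n g (l j) i - (\<Sum>k<r. w k j / (a k + \<eta>) * mat_app_t n g (u k) i))"
        unfolding h_def x_def by (rule ext) (rule mat_app_t_lincomb)
      then have "sdot m (h j) (nn j) = sdot m (mat_app_t n g (l j)) (nn j)
         - (\<Sum>k<r. w k j / (a k + \<eta>) * sdot m (mat_app_t n g (u k)) (nn j))"
        by (simp only: sdot_simps)
      then show ?thesis by (simp add: sdot_mat_app)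
    qed
    moreover have "\<bar>\<Sum>k<r. w k j / (a k + \<eta>) * sdot m (mat_app_t n g (u k)) (nn j)\<bar> \<le> (\<Sum>k<r. R * F * \<eta>)"
    proof (rule order_trans[OF sum_abs], rule sum_mono)
      fix k assume "k \<in> {..<r}"
      then have k: "k < r" by simp
      have "\<bar>sdot m (mat_app_t n g (u k)) (nn j)\<bar> \<le> \<omega> * F"
        using gu[OF k] n_bd[OF j] \<omega> RF by (intro abs_sdot_le) auto
      moreover have "\<bar>w k j / (a k + \<eta>)\<bar> \<le> R / \<eta>"
        using w_abs_le[OF k j] a_eta[of k] a_nonneg[of k] \<eta> RF
        by (simp add: abs_div_pos[symmetric] del: abs_divide) (intro frac_le, auto)
      ultimately have "\<bar>w k j / (a k + \<eta>)\<bar> * \<bar>sdot m (mat_app_t n g (u k)) (nn j)\<bar> \<le> R / \<eta> * (\<omega> * F)"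
        using RF \<eta> by (intro mult_mono) auto
      also have "\<dots> = R * F * (\<omega> / \<eta>)" by simp
      also have "\<dots> \<le> R * F * \<eta>" using omega_div_eta RF by (intro mult_left_mono) auto
      finally show "\<bar>w k j / (a k + \<eta>) * sdot m (mat_app_t n g (u k)) (nn j)\<bar> \<le> R * F * \<eta>"
        by (simp add: abs_mult)
    qed
    ultimately have 1: "- (sdot n (l j) (mat_app m g (nn j))) \<le> - sdot m (h j) (nn j) + r * R * F * \<eta>"
      by (auto simp: abs_le_iff)
    \<comment> \<open>d_j differs from - n_j by a combination of the v_k, to which h_j is almost
      orthogonal.\<close>
    have "sdot m (h j) (d j) = (\<Sum>k<r. w k j * sdot m (v k) (h j)) - sdot m (h j) (nn j)"
      unfolding d_def sdot_simps by (simp add: sdot_commute)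
    moreover have "\<bar>\<Sum>k<r. w k j * sdot m (v k) (h j)\<bar> \<le> (\<Sum>k<r. R * \<eta>)"
    proof (rule order_trans[OF sum_abs], rule sum_mono)
      fix k assume "k \<in> {..<r}"
      then have k: "k < r" by simp
      show "\<bar>w k j * sdot m (v k) (h j)\<bar> \<le> R * \<eta>"
        unfolding abs_mult using w_abs_le[OF k j] v_h_abs_le[OF k j] omega_div_eta RF by (intro mult_mono) auto
    qed
    ultimately have 2: "- sdot m (h j) (nn j) \<le> sdot m (h j) (d j) + r * R * \<eta>"
      by (auto simp: abs_le_iff)
    \<comment> \<open>Completing the square is the only loss here, and the two squares are exactly
      what \<open>h_bound\<close> and \<open>E_norm_ge\<close> absorb.\<close>
    have 3: "2 * t * sdot m (h j) (d j) \<le> t\<^sup>2 * sqnorm m (h j) + sqnorm m (d j)"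
    proof -
      have "0 \<le> sqnorm m (\<lambda>i. t * h j i - d j i)" by simp
      also have "\<dots> = t\<^sup>2 * sqnorm m (h j) + sqnorm m (d j) - 2 * t * sdot m (h j) (d j)"
        unfolding sdot_simps sdot_commute[of m "d j" "h j"] by (simp add: power2_eq_square algebra_simps)
      finally show ?thesis by simp
    qed
    have "- (sdot n (l j) (mat_app m g (nn j))) \<le> sdot m (h j) (d j) + (r * R * F + r * R) * \<eta>"
      using 1 2 by (simp add: algebra_simps)
    then have "2 * t * - (sdot n (l j) (mat_app m g (nn j))) \<le> 2 * t * (sdot m (h j) (d j) + (r * R * F + r * R) * \<eta>)"
      using t by (intro mult_left_mono) auto
    also have "\<dots> \<le> 2 * t * sdot m (h j) (d j) + 2 * 1 * ((r * R * F + r * R) * \<eta>)"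
      unfolding distrib_left using t RF \<eta> by (intro add_left_mono mult_right_mono) auto
    finally show ?thesis using 3 by (simp add: algebra_simps)
  qed
  have eq: "2 * t * ((\<Sum>k<r. sdot n (u k) (mat_app m g (v k))) - (\<Sum>j<r. sdot n (l j) (mat_app m g (nn j))))
     = 2 * t * (\<Sum>k<r. sdot n (u k) (mat_app m g (v k))) + (\<Sum>j<r. - (2 * t * sdot n (l j) (mat_app m g (nn j))))"
    by (simp add: right_diff_distrib sum_distrib_left sum_negf)
  have s1: "2 * t * (\<Sum>k<r. sdot n (u k) (mat_app m g (v k))) \<le> 2 * (r * R * \<eta>)"
  proof -
    have "t * (\<Sum>k<r. sdot n (u k) (mat_app m g (v k))) \<le> t * (r * R * \<eta>)"
      using A t by (intro mult_left_mono) auto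
    also have "\<dots> \<le> 1 * (r * R * \<eta>)"
      using t RF \<eta> by (intro mult_right_mono) auto
    finally show ?thesis by simp
  qed
  have "(\<Sum>j<r. - (2 * t * sdot n (l j) (mat_app m g (nn j))))
      \<le> (\<Sum>j<r. t\<^sup>2 * sqnorm m (h j) + sqnorm m (d j) + (2 * r * R * F + 2 * r * R) * \<eta>)"
    using B by (intro sum_mono) simp
  also have "\<dots> = (\<Sum>j<r. t\<^sup>2 * sqnorm m (h j)) + (\<Sum>j<r. sqnorm m (d j))
      + r * ((2 * r * R * F + 2 * r * R) * \<eta>)"
    by (simp add: sum.distrib)
  finally have s2: "(\<Sum>j<r. - (2 * t * sdot n (l j) (mat_app m g (nn j))))
      \<le> (\<Sum>j<r. t\<^sup>2 * sqnorm m (h j)) + (\<Sum>j<r. sqnorm m (d j))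
      + r * ((2 * r * R * F + 2 * r * R) * \<eta>)" .
  have "(\<Sum>j<r. t\<^sup>2 * sqnorm m (h j))
      \<le> (\<Sum>j<r. s\<^sup>2 * sqnorm n (x j) + (R\<^sup>2 + 1) * (4 * R + 8 * r) * \<eta>)"
    using h_bound by (intro sum_mono) simp
  also have "\<dots> = s\<^sup>2 * (\<Sum>j<r. sqnorm n (x j)) + r * ((R\<^sup>2 + 1) * (4 * R + 8 * r) * \<eta>)"
    by (simp add: sum.distrib sum_distrib_left)
  finally have s3: "(\<Sum>j<r. t\<^sup>2 * sqnorm m (h j))
      \<le> s\<^sup>2 * (\<Sum>j<r. sqnorm n (x j)) + r * ((R\<^sup>2 + 1) * (4 * R + 8 * r) * \<eta>)" .
  have "err_const r R F * \<eta> = 2 * (r * R * \<eta>) + r * ((2 * r * R * F + 2 * r * R) * \<eta>)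
      + r * ((R\<^sup>2 + 1) * (4 * R + 8 * r) * \<eta>) + r * (2 * R\<^sup>2 + 1) * \<eta> + r\<^sup>2 * R\<^sup>2 * \<eta>"
    by (simp add: err_const_def power2_eq_square algebra_simps)
  then show ?thesis
    unfolding eq using s1 s2 s3 sum_x_norm_le E_norm_ge by linarith
qed

end

section \<open>Balanced factorizations\<close>

lemma orthonormal_parseval:
  assumes "orthonormal r r q"
  shows "(\<Sum>k<r. (\<Sum>a<r. q k a * f a) * (\<Sum>a<r. q k a * g a)) = (\<Sum>a<r. f a * g a)"
proof -
  have "(\<Sum>k<r. (\<Sum>a<r. q k a * f a) * (\<Sum>a<r. q k a * g a))
      = (\<Sum>k<r. \<Sum>a<r. \<Sum>b<r. (f a * g b) * (q k a * q k b))"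
    by (simp add: sum_product ac_simps)
  also have "\<dots> = (\<Sum>a<r. \<Sum>k<r. \<Sum>b<r. (f a * g b) * (q k a * q k b))"
    by (rule sum.swap)
  also have "\<dots> = (\<Sum>a<r. \<Sum>b<r. \<Sum>k<r. (f a * g b) * (q k a * q k b))"
    by (rule sum.cong[OF refl], rule sum.swap)
  also have "\<dots> = (\<Sum>a<r. \<Sum>b<r. (f a * g b) * (\<Sum>k<r. q k a * q k b))"
    by (simp add: sum_distrib_left)
  also have "\<dots> = (\<Sum>a<r. \<Sum>b<r. if a = b then f a * g a else 0)"
    by (intro sum.cong) (auto simp: orthonormal_complete[OF assms])
  finally show ?thesis by simp
qed

lemma rot_outer:
  assumes "orthonormal r r q"
  shows "(\<Sum>k<r. rot r q u k i * rot r q v k j) = (\<Sum>k<r. u k i * v k j)"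
  unfolding rot_def by (rule orthonormal_parseval[OF assms])

lemma sdot_rot: "sdot n (rot r q u k) (rot r q v k') = (\<Sum>a<r. q k a * (\<Sum>b<r. q k' b * sdot n (u a) (v b)))"
  unfolding rot_def sdot_simps by (simp add: sum_distrib_left)

lemma orthonormal_rot:
  assumes q: "orthonormal r r q" and l: "orthonormal n r l"
  shows "orthonormal n r (rot r q l)"
  unfolding orthonormal_def
proof (intro allI impI)
  fix i j assume ij: "i < r" "j < r"
  have "sdot n (rot r q l i) (rot r q l j) = (\<Sum>a<r. q i a * (\<Sum>b<r. if a = b then q j b else 0))"
    unfolding sdot_rot using l by (intro sum.cong arg_cong2[where f = times]) (auto simp: orthonormal_def)
  also have "\<dots> = sdot r (q i) (q j)"
    by (simp add: sdot_def)
  finally show "sdot n (rot r q l i) (rot r q l j) = (if i = j then 1 else 0)"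
    using q ij by (simp add: orthonormal_def)
qed

lemma sum_sq_rot2:
  assumes q: "orthonormal r r q"
  shows "(\<Sum>k<r. \<Sum>k'<r. (\<Sum>a<r. q k a * (\<Sum>b<r. q k' b * D a b))\<^sup>2) = (\<Sum>a<r. \<Sum>b<r. (D a b)\<^sup>2)"
proof -
  have "(\<Sum>k<r. \<Sum>k'<r. (\<Sum>a<r. q k a * (\<Sum>b<r. q k' b * D a b))\<^sup>2)
     = (\<Sum>k'<r. \<Sum>k<r. (\<Sum>a<r. q k a * (\<Sum>b<r. q k' b * D a b))\<^sup>2)"
    by (rule sum.swap)
  also have "\<dots> = (\<Sum>k'<r. \<Sum>a<r. (\<Sum>b<r. q k' b * D a b) * (\<Sum>b<r. q k' b * D a b))"
    unfolding power2_eq_square orthonormal_parseval[OF q] ..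
  also have "\<dots> = (\<Sum>a<r. \<Sum>k'<r. (\<Sum>b<r. q k' b * D a b) * (\<Sum>b<r. q k' b * D a b))"
    by (rule sum.swap)
  also have "\<dots> = (\<Sum>a<r. \<Sum>b<r. (D a b)\<^sup>2)"
    unfolding power2_eq_square orthonormal_parseval[OF q] ..
  finally show ?thesis .
qed

definition balanced :: "nat \<Rightarrow> nat \<Rightarrow> nat \<Rightarrow> (nat \<Rightarrow> nat \<Rightarrow> real) \<Rightarrow> (nat \<Rightarrow> nat \<Rightarrow> real) \<Rightarrow> bool" where
  "balanced n m r u v \<longleftrightarrow> (\<forall>k<r. \<forall>k'<r. sdot n (u k) (u k') = sdot m (v k) (v k'))"

lemma balanced_rot:
  assumes "balanced n m r u v"
  shows "balanced n m r (rot r q u) (rot r q v)"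
proof -
  have "(\<Sum>a<r. q k a * (\<Sum>b<r. q k' b * sdot n (u a) (u b)))
      = (\<Sum>a<r. q k a * (\<Sum>b<r. q k' b * sdot m (v a) (v b)))" for k k'
    using assms by (intro sum.cong refl arg_cong2[where f = times]) (simp add: balanced_def)
  then show ?thesis unfolding balanced_def sdot_rot by blast
qed

text \<open>Orthogonalizing the n_j while keeping the l_j orthonormal amounts to a singular value
  decomposition; balance results from giving each side the square root of the singular
  values.\<close>

lemma exists_balanced_factor:
  assumes l: "orthonormal n r l"
  shows "\<exists>u v. (\<forall>i<n. \<forall>j<m. (\<Sum>k<r. u k i * v k j) = (\<Sum>k<r. l k i * nn k j)) \<and> balanced n m r u v"
proof -
  obtain q where q: "orthonormal r r q"
    and orth: "\<And>i j. i < r \<Longrightarrow> j < r \<Longrightarrow> i \<noteq> j \<Longrightarrow> sdot m (rot r q nn i) (rot r q nn j) = 0"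
    using exists_orthogonalizing_rotation[of r m nn] by blast
  define n' where "n' = rot r q nn"
  define l' where "l' = rot r q l"
  define b where "b k = sqrt (sqnorm m (n' k))" for k
  define c where "c k = sqrt (b k)" for k
  define u where "u k = (\<lambda>i. c k * l' k i)" for k
  define v where "v k = (\<lambda>i. (1 / c k) * n' k i)" for k
  have b2: "b k * b k = sqnorm m (n' k)" "0 \<le> b k" for k by (simp_all add: b_def)
  have c2: "c k * c k = b k" for k using b2(2)[of k] by (simp add: c_def)
  have "(\<Sum>k<r. u k i * v k j) = (\<Sum>k<r. l' k i * n' k j)" if "i < n" "j < m" for i j
  proof (rule sum.cong)
    fix k assume "k \<in> {..<r}"
    show "u k i * v k j = l' k i * n' k j"
    \<comment> \<open>A vanishing singular value makes 1 / c_k equal to 0 by convention; n'_k is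
      then zero as well, so the product is unchanged.\<close>
    proof (cases "c k = 0")
      case True
      then have "sqnorm m (n' k) = 0" using b2(1)[of k] c2[of k] by simp
      then have "n' k j = 0" using that by (simp add: sdot_self_eq_0_iff)
      then show ?thesis by (simp add: u_def v_def)
    qed (simp add: u_def v_def)
  qed simp
  moreover have "(\<Sum>k<r. l' k i * n' k j) = (\<Sum>k<r. l k i * nn k j)" for i j
    unfolding l'_def n'_def by (rule rot_outer[OF q])
  moreover have "balanced n m r u v"
    unfolding balanced_def
  proof (intro allI impI)
    fix k k' assume k: "k < r" "k' < r"
    have u: "sdot n (u k) (u k') = (if k = k' then b k else 0)"
      using orthonormal_rot[OF q l] k c2 unfolding u_def sdot_simps l'_def by (auto simp: orthonormal_def)
    have "sdot m (v k) (v k') = (if k = k' then b k else 0)"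
    proof (cases "k = k'")
      case True
      have "sqnorm m (v k) = (b k * b k) / (c k * c k)"
        unfolding v_def sdot_simps by (simp add: b2)
      then show ?thesis using True by (simp add: c2)
    next
      case False
      then show ?thesis using orth[OF k False] unfolding v_def sdot_simps n'_def by simp
    qed
    then show "sdot n (u k) (u k') = sdot m (v k) (v k')" using u by simp
  qed
  ultimately show ?thesis by (intro exI[of _ u] exI[of _ v]) auto
qed

text \<open>The nearest factor is the one for which \<open>P = W\<^sup>T W'\<close> is symmetric and positive semidefinite;
  then \<open>\<langle>\<Delta>\<^sup>T \<Delta>, P\<rangle> \<ge> 0\<close> for \<open>\<Delta> = W - W'\<close>, which is all that the estimate needs.\<close>

lemma exists_near_balanced_factor:
  assumes bal: "balanced n m r us vs"
  shows "\<exists>u' v'. (\<forall>i j. (\<Sum>k<r. u' k i * v' k j) = (\<Sum>k<r. us k i * vs k j)) \<and> balanced n m r u' v' \<and>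
    (\<Sum>k<r. sqnorm n (\<lambda>i. u k i - u' k i) + sqnorm m (\<lambda>i. v k i - v' k i))\<^sup>2
    \<le> 2 * r * ((\<Sum>k<r. \<Sum>k'<r. (sdot n (u k) (u k') - sdot m (v k) (v k'))\<^sup>2)
      + 4 * (\<Sum>i<n. \<Sum>j<m. ((\<Sum>k<r. u k i * v k j) - (\<Sum>k<r. us k i * vs k j))\<^sup>2))"
proof -
  let ?E = "(\<Sum>i<n. \<Sum>j<m. ((\<Sum>k<r. u k i * v k j) - (\<Sum>k<r. us k i * vs k j))\<^sup>2)"
  define Cm where "Cm i j = sdot n (u i) (us j) + sdot m (v i) (vs j)" for i j
  obtain q where q: "orthonormal r r q"
    and sym: "\<And>i j. i < r \<Longrightarrow> j < r \<Longrightarrow> sdot r (Cm i) (q j) = sdot r (Cm j) (q i)"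
    and psd: "\<And>x. 0 \<le> (\<Sum>i<r. \<Sum>j<r. x i * x j * sdot r (Cm i) (q j))"
    using exists_polar_rotation[of r Cm] by blast
  define u' where "u' = rot r q us"
  define v' where "v' = rot r q vs"
  have Mu: "(\<Sum>k<r. u' k i * v' k j) = (\<Sum>k<r. us k i * vs k j)" for i j
    unfolding u'_def v'_def by (rule rot_outer[OF q])
  have bal': "balanced n m r u' v'"
    unfolding u'_def v'_def by (rule balanced_rot[OF bal])
  define A where "A i j = sdot n (u i) (u j)" for i j
  define B where "B i j = sdot m (v i) (v j)" for i j
  define As where "As i j = sdot n (u' i) (u' j)" for i j
  define p where "p i j = sdot n (u i) (u' j)" for i j
  define p' where "p' i j = sdot m (v i) (v' j)" for i j
  define P where "P i j = p i j + p' i j" for i j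
  define du where "du k = (\<lambda>i. u k i - u' k i)" for k
  define dv where "dv k = (\<lambda>i. v k i - v' k i)" for k
  \<comment> \<open>\<open>S\<close> is \<Delta>^T \<Delta>; its trace is the squared distance to be
    bounded.\<close>
  define S where "S i j = sdot n (du i) (du j) + sdot m (dv i) (dv j)" for i j
  have PC: "P i j = sdot r (Cm i) (q j)" for i j
  proof -
    have "sdot r (Cm i) (q j) = (\<Sum>a<r. q j a * sdot n (u i) (us a)) + (\<Sum>a<r. q j a * sdot m (v i) (vs a))"
      by (simp add: sdot_def[of r] Cm_def algebra_simps sum.distrib)
    then show ?thesis
      unfolding P_def p_def p'_def u'_def v'_def rot_def sdot_simps by simp
  qed
  have Psym: "P i j = P j i" if "i < r" "j < r" for i j
    using sym[OF that] by (simp add: PC)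
  have S_eq: "S i j = A i j + B i j + 2 * As i j - 2 * P i j" if "i < r" "j < r" for i j
  proof -
    have "sdot m (v' i) (v' j) = As i j"
      using bal' that by (simp add: balanced_def As_def)
    moreover have "sdot n (u' i) (u j) = p j i" "sdot m (v' i) (v j) = p' j i"
      unfolding p_def p'_def by (rule sdot_commute)+
    ultimately show ?thesis
      unfolding S_def du_def dv_def sdot_simps
      using Psym[OF that] P_def[of i j] P_def[of j i] A_def[of i j] B_def[of i j] As_def[of i j]
        p_def[of i j] p'_def[of i j] by linarith
  qed
  have SP: "0 \<le> (\<Sum>i<r. \<Sum>j<r. S i j * P i j)"
  proof -
    have gen: "0 \<le> (\<Sum>i<r. \<Sum>j<r. sdot d (e i) (e j) * P i j)" for d and e :: "nat \<Rightarrow> nat \<Rightarrow> real"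
    proof -
      have "(\<Sum>i<r. \<Sum>j<r. sdot d (e i) (e j) * P i j) = (\<Sum>i<r. \<Sum>j<r. \<Sum>x<d. e i x * e j x * P i j)"
        by (simp add: sdot_def sum_distrib_right)
      also have "\<dots> = (\<Sum>i<r. \<Sum>x<d. \<Sum>j<r. e i x * e j x * P i j)"
        by (rule sum.cong[OF refl], rule sum.swap)
      also have "\<dots> = (\<Sum>x<d. \<Sum>i<r. \<Sum>j<r. e i x * e j x * P i j)"
        by (rule sum.swap)
      also have "\<dots> \<ge> 0"
        unfolding PC by (intro sum_nonneg psd)
      finally show ?thesis .
    qed
    from gen[of n du] gen[of m dv] show ?thesis
      by (simp add: S_def distrib_right sum.distrib)
  qed
  have E: "?E
      = (\<Sum>i<r. \<Sum>j<r. A i j * B i j) - 2 * (\<Sum>i<r. \<Sum>j<r. p i j * p' i j) + (\<Sum>i<r. \<Sum>j<r. (As i j)\<^sup>2)"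
  proof -
    have "?E
       = (\<Sum>i<n. \<Sum>j<m. ((\<Sum>k<r. u k i * v k j) - (\<Sum>k<r. u' k i * v' k j))\<^sup>2)"
      by (simp add: Mu)
    also have "\<dots> = (\<Sum>i<n. \<Sum>j<m. (\<Sum>k<r. u k i * v k j) * (\<Sum>k<r. u k i * v k j))
       - 2 * (\<Sum>i<n. \<Sum>j<m. (\<Sum>k<r. u k i * v k j) * (\<Sum>k<r. u' k i * v' k j))
       + (\<Sum>i<n. \<Sum>j<m. (\<Sum>k<r. u' k i * v' k j) * (\<Sum>k<r. u' k i * v' k j))"
      by (simp only: power2_eq_square left_diff_distrib right_diff_distrib sum_subtractf)
        (simp add: mult.commute)
    also have "(\<Sum>i<n. \<Sum>j<m. (\<Sum>k<r. u' k i * v' k j) * (\<Sum>k<r. u' k i * v' k j)) = (\<Sum>i<r. \<Sum>j<r. (As i j)\<^sup>2)"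
      unfolding sum_outer_products using bal'
      by (intro sum.cong) (auto simp: As_def balanced_def power2_eq_square)
    finally show ?thesis
      unfolding sum_outer_products by (simp add: A_def B_def p_def p'_def)
  qed
  \<comment> \<open>Adding two nonnegative quantities, |A + B - 2 As|^2 and 4 <S, P>, to |S|^2 makes
    an exact identity available: the sum is 2 (|A - B|^2 + 4 |E|^2) - 4 |p - p'|^2.\<close>
  have "(\<Sum>i<r. \<Sum>j<r. (S i j)\<^sup>2) \<le> (\<Sum>i<r. \<Sum>j<r. (S i j)\<^sup>2) + (\<Sum>i<r. \<Sum>j<r. (A i j + B i j - 2 * As i j)\<^sup>2)
      + 4 * (\<Sum>i<r. \<Sum>j<r. S i j * P i j)"
    using SP by (simp add: sum_nonneg)
  also have "\<dots> = (\<Sum>i<r. \<Sum>j<r. (S i j)\<^sup>2 + (A i j + B i j - 2 * As i j)\<^sup>2 + 4 * (S i j * P i j))"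
    by (simp add: sum.distrib sum_distrib_left)
  also have "\<dots> = (\<Sum>i<r. \<Sum>j<r. 2 * ((A i j - B i j)\<^sup>2 + 4 * (A i j * B i j - 2 * (p i j * p' i j) + (As i j)\<^sup>2))
      - 4 * (p i j - p' i j)\<^sup>2)"
  proof (intro sum.cong refl)
    fix i j assume "i \<in> {..<r}" "j \<in> {..<r}"
    then show "(S i j)\<^sup>2 + (A i j + B i j - 2 * As i j)\<^sup>2 + 4 * (S i j * P i j)
      = 2 * ((A i j - B i j)\<^sup>2 + 4 * (A i j * B i j - 2 * (p i j * p' i j) + (As i j)\<^sup>2)) - 4 * (p i j - p' i j)\<^sup>2"
      by (simp add: S_eq P_def power2_eq_square algebra_simps)
  qed
  also have "\<dots> \<le> (\<Sum>i<r. \<Sum>j<r. 2 * ((A i j - B i j)\<^sup>2 + 4 * (A i j * B i j - 2 * (p i j * p' i j) + (As i j)\<^sup>2)))"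
    by (intro sum_mono) simp
  also have "\<dots> = 2 * ((\<Sum>i<r. \<Sum>j<r. (A i j - B i j)\<^sup>2) + 4 * ((\<Sum>i<r. \<Sum>j<r. A i j * B i j)
        - 2 * (\<Sum>i<r. \<Sum>j<r. p i j * p' i j) + (\<Sum>i<r. \<Sum>j<r. (As i j)\<^sup>2)))"
    by (simp add: sum.distrib sum_subtractf sum_distrib_left[symmetric])
  finally have S2: "(\<Sum>i<r. \<Sum>j<r. (S i j)\<^sup>2) \<le> \<dots>" .
  have "(\<Sum>k<r. S k k)\<^sup>2 \<le> r * (\<Sum>i<r. \<Sum>j<r. (S i j)\<^sup>2)"
    by (rule trace_sq_le)
  also have "\<dots> \<le> r * (2 * ((\<Sum>i<r. \<Sum>j<r. (A i j - B i j)\<^sup>2) + 4 * ((\<Sum>i<r. \<Sum>j<r. A i j * B i j)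
        - 2 * (\<Sum>i<r. \<Sum>j<r. p i j * p' i j) + (\<Sum>i<r. \<Sum>j<r. (As i j)\<^sup>2))))"
    using S2 by (intro mult_left_mono) auto
  finally have "(\<Sum>k<r. S k k)\<^sup>2 \<le> 2 * r * ((\<Sum>i<r. \<Sum>j<r. (A i j - B i j)\<^sup>2)
      + 4 * ?E)"
    unfolding E by (simp add: algebra_simps)
  then have bound: "(\<Sum>k<r. sqnorm n (\<lambda>i. u k i - u' k i)
        + sqnorm m (\<lambda>i. v k i - v' k i))\<^sup>2
    \<le> 2 * r * ((\<Sum>k<r. \<Sum>k'<r. (sdot n (u k) (u k') - sdot m (v k) (v k'))\<^sup>2)
      + 4 * ?E)"
    unfolding S_def du_def dv_def A_def B_def .
  show ?thesis
  proof (rule exI[of _ u'], rule exI[of _ v'], intro conjI allI)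
    show "(\<Sum>k<r. u' k i * v' k j) = (\<Sum>k<r. us k i * vs k j)" for i j
      by (rule Mu)
  qed (use bal' bound in simp_all)
qed

section \<open>Consequences of a small gradient\<close>

lemma discriminant_le:
  fixes X L Y :: real
  assumes q: "\<And>s. 0 \<le> X - 2 * s * L + s\<^sup>2 * Y" and Y: "0 \<le> Y"
  shows "L\<^sup>2 \<le> X * Y"
proof (cases "Y = 0")
  case True
  have "L = 0"
  proof (rule ccontr)
    assume "L \<noteq> 0"
    \<comment> \<open>With Y = 0 this value of s makes the affine expression equal to -1.\<close>
    with q[of "(X + 1) / (2 * L)"] True show False by simp
  qed
  then show ?thesis using True by simp
next
  case False
  with Y have pos: "Y > 0" by simp
  have "0 \<le> (X - 2 * (L / Y) * L + (L / Y)\<^sup>2 * Y) * Y"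
    by (rule mult_nonneg_nonneg[OF q Y])
  also have "\<dots> = X * Y - L\<^sup>2"
    using pos by (simp add: power2_eq_square field_simps)
  finally show ?thesis by simp
qed

text \<open>Cauchy-Schwarz on the space of pairs (U, V), obtained from the discriminant so that the
  two blocks need not be merged into one index set.\<close>

lemma sdot_families_Cauchy_Schwarz:
  "((\<Sum>k<r. sdot n (x k) (y k)) + (\<Sum>k<r. sdot m (x' k) (y' k)))\<^sup>2
    \<le> (\<Sum>k<r. sqnorm n (x k) + sqnorm m (x' k)) * (\<Sum>k<r. sqnorm n (y k) + sqnorm m (y' k))"
    (is "?L\<^sup>2 \<le> ?X * ?Y")
proof -
  have q: "0 \<le> ?X - 2 * s * ?L + s\<^sup>2 * ?Y" for s
  proof -
    have "0 \<le> (\<Sum>k<r. sqnorm n (\<lambda>i. x k i - s * y k i)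
      + sqnorm m (\<lambda>i. x' k i - s * y' k i))"
      by (intro sum_nonneg) simp
    also have "\<dots> = (\<Sum>k<r. (sqnorm n (x k) + sqnorm m (x' k)) - 2 * s * (sdot n (x k) (y k) + sdot m (x' k) (y' k))
        + s\<^sup>2 * (sqnorm n (y k) + sqnorm m (y' k)))"
    proof (rule sum.cong)
      fix k
      show "sqnorm n (\<lambda>i. x k i - s * y k i)
          + sqnorm m (\<lambda>i. x' k i - s * y' k i)
        = (sqnorm n (x k) + sqnorm m (x' k)) - 2 * s * (sdot n (x k) (y k) + sdot m (x' k) (y' k))
        + s\<^sup>2 * (sqnorm n (y k) + sqnorm m (y' k))"
        unfolding sdot_simps sdot_commute[of n "y k" "x k"] sdot_commute[of m "y' k" "x' k"]
        by (simp add: power2_eq_square algebra_simps)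
    qed simp
    also have "\<dots> = ?X - 2 * s * ?L + s\<^sup>2 * ?Y"
      by (simp add: sum.distrib sum_subtractf sum_distrib_left[symmetric] distrib_left)
    finally show ?thesis .
  qed
  have "0 \<le> ?Y" by (intro sum_nonneg) simp
  with q show ?thesis by (rule discriminant_le)
qed

text \<open>\<open>W\<close> will be the norm of (U, V): regularizer and objective grow like its
  fourth power, whereas a bounded gradient contributes only linearly.\<close>

lemma power4_bound:
  fixes W K F :: real
  assumes "0 \<le> W" and "0 < K" and "W ^ 4 \<le> K * (W + F\<^sup>2)"
  shows "W \<le> 1 + K * (1 + F\<^sup>2)"
proof (rule ccontr)
  assume "\<not> W \<le> 1 + K * (1 + F\<^sup>2)"
  then have W: "W > 1 + K * (1 + F\<^sup>2)" by simp
  moreover have "0 \<le> K * (1 + F\<^sup>2)" using assms by simp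
  ultimately have "W \<ge> 1" by linarith
  then have "W + F\<^sup>2 \<le> W * (1 + F\<^sup>2)"
    by (simp add: algebra_simps mult_le_cancel_right1)
  then have "K * (W + F\<^sup>2) \<le> K * (W * (1 + F\<^sup>2))" using assms by (intro mult_left_mono) auto
  then have "W * W ^ 3 \<le> W * (K * (1 + F\<^sup>2))"
    using assms(3) by (simp add: power_Suc[symmetric] algebra_simps del: power_Suc)
  then have "W ^ 3 \<le> K * (1 + F\<^sup>2)" using \<open>W \<ge> 1\<close> by simp
  moreover have "W \<le> W ^ 3" using \<open>W \<ge> 1\<close> self_le_power[of W 3] by simp
  ultimately show False using W by simp
qed

definition imbalance :: "nat \<Rightarrow> nat \<Rightarrow> (nat \<Rightarrow> nat \<Rightarrow> real) \<Rightarrow> (nat \<Rightarrow> nat \<Rightarrow> real) \<Rightarrow> nat \<Rightarrow> nat \<Rightarrow> real" where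
  "imbalance n m u v a b = sdot n (u a) (u b) - sdot m (v a) (v b)"

text \<open>The columns of the two blocks of the gradient of
  \<open>f(U V\<^sup>T) + \<mu>/4 \<parallel>U\<^sup>T U - V\<^sup>T V\<parallel>\<^sup>2\<close>, where \<open>g\<close> is the gradient of \<open>f\<close> at \<open>U V\<^sup>T\<close>.\<close>

definition grad_left where
  "grad_left n m r \<mu> g u v k = (\<lambda>i. mat_app m g (v k) i + \<mu> * (\<Sum>a<r. imbalance n m u v a k * u a i))"

definition grad_right where
  "grad_right n m r \<mu> g u v k = (\<lambda>j. mat_app_t n g (u k) j - \<mu> * (\<Sum>a<r. imbalance n m u v a k * v a j))"

text \<open>The bound of \<open>power4_bound\<close> for K = 4 r / \<mu>.\<close>

definition radius :: "nat \<Rightarrow> real \<Rightarrow> real \<Rightarrow> real" where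
  "radius r \<mu> F = 1 + 4 * r / \<mu> * (1 + F\<^sup>2)"

text \<open>The assumption \<open>coercive\<close> abstracts what the isometry property says about
  <G, M>; it will be used with c = 1 - \<delta> and F the norm of the target.\<close>

locale small_gradient =
  fixes n m r :: nat and u v g :: "nat \<Rightarrow> nat \<Rightarrow> real" and \<mu> \<beta> c F :: real
  assumes r: "1 \<le> r" and \<mu>: "0 < \<mu>" and \<beta>: "0 \<le> \<beta>" "\<beta> \<le> 1" and c: "\<mu> \<le> c"
    and grad: "(\<Sum>k<r. sqnorm n (grad_left n m r \<mu> g u v k)
      + sqnorm m (grad_right n m r \<mu> g u v k)) \<le> \<beta>\<^sup>2"
    and coercive: "c / 2 * (\<Sum>i<n. \<Sum>j<m. (\<Sum>k<r. u k i * v k j)\<^sup>2) - F\<^sup>2 / 2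
      \<le> (\<Sum>k<r. sdot n (u k) (mat_app m g (v k)))"
begin

abbreviation "D \<equiv> imbalance n m u v"
abbreviation "gU \<equiv> grad_left n m r \<mu> g u v"
abbreviation "gV \<equiv> grad_right n m r \<mu> g u v"

lemmas D_def = imbalance_def[of n m u v]
lemmas gU_def = grad_left_def[of n m r \<mu> g u v]
lemmas gV_def = grad_right_def[of n m r \<mu> g u v]

definition "T = (\<Sum>k<r. sqnorm n (u k) + sqnorm m (v k))"
definition "uD k = (\<lambda>i. \<Sum>a<r. D a k * u a i)"
definition "vD k = (\<lambda>i. \<Sum>a<r. D a k * v a i)"
definition "Z = (\<Sum>k<r. sqnorm n (uD k) + sqnorm m (vD k))"
abbreviation "R \<equiv> radius r \<mu> F"

lemma T_nonneg: "0 \<le> T" unfolding T_def by (intro sum_nonneg) simp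
lemma Z_nonneg: "0 \<le> Z" unfolding Z_def by (intro sum_nonneg) simp

lemma D_sym: "D a b = D b a"
  by (simp add: D_def sdot_commute)

lemma uD_sum: "(\<Sum>k<r. sdot n (u k) (uD k)) - (\<Sum>k<r. sdot m (v k) (vD k)) = (\<Sum>a<r. \<Sum>b<r. (D a b)\<^sup>2)"
proof -
  have "(\<Sum>k<r. sdot n (u k) (uD k)) - (\<Sum>k<r. sdot m (v k) (vD k))
    = (\<Sum>k<r. \<Sum>a<r. D a k * (sdot n (u k) (u a) - sdot m (v k) (v a)))"
    unfolding uD_def vD_def sdot_simps by (simp add: sum_subtractf right_diff_distrib)
  also have "\<dots> = (\<Sum>k<r. \<Sum>a<r. (D k a)\<^sup>2)"
    unfolding D_def[symmetric] by (simp add: D_sym power2_eq_square)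
  finally show ?thesis .
qed

lemma gU_eq: "gU k = (\<lambda>i. mat_app m g (v k) i + \<mu> * uD k i)"
  and gV_eq: "gV k = (\<lambda>j. mat_app_t n g (u k) j - \<mu> * vD k j)"
  by (simp_all add: gU_def gV_def uD_def vD_def)

lemma pairing_abs_le:
  "\<bar>(\<Sum>k<r. sdot n (x k) (gU k)) + (\<Sum>k<r. sdot m (y k) (gV k))\<bar>
    \<le> sqrt (\<Sum>k<r. sqnorm n (x k) + sqnorm m (y k)) * \<beta>"
proof -
  have "((\<Sum>k<r. sdot n (x k) (gU k)) + (\<Sum>k<r. sdot m (y k) (gV k)))\<^sup>2
      \<le> (\<Sum>k<r. sqnorm n (x k) + sqnorm m (y k)) * (\<Sum>k<r. sqnorm n (gU k) + sqnorm m (gV k))"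
    by (rule sdot_families_Cauchy_Schwarz)
  also have "\<dots> \<le> (\<Sum>k<r. sqnorm n (x k) + sqnorm m (y k)) * \<beta>\<^sup>2"
    using grad by (intro mult_left_mono sum_nonneg) auto
  finally have "sqrt (((\<Sum>k<r. sdot n (x k) (gU k)) + (\<Sum>k<r. sdot m (y k) (gV k)))\<^sup>2)
     \<le> sqrt ((\<Sum>k<r. sqnorm n (x k) + sqnorm m (y k)) * \<beta>\<^sup>2)"
    by (rule real_sqrt_le_mono)
  then show ?thesis using \<beta> by (simp add: real_sqrt_mult)
qed

lemma M_norm: "(\<Sum>i<n. \<Sum>j<m. (\<Sum>k<r. u k i * v k j)\<^sup>2) = (\<Sum>a<r. \<Sum>b<r. sdot n (u a) (u b) * sdot m (v a) (v b))"
  unfolding power2_eq_square by (rule sum_outer_products)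

text \<open>U^T U + V^T V has trace T, and its squared norm is |D|^2 + 4 |U V^T|^2.\<close>

lemma T_sq_le: "T\<^sup>2 \<le> 4 * r * ((\<Sum>a<r. \<Sum>b<r. (D a b)\<^sup>2) + (\<Sum>i<n. \<Sum>j<m. (\<Sum>k<r. u k i * v k j)\<^sup>2))"
proof -
  define S where "S a b = sdot n (u a) (u b) + sdot m (v a) (v b)" for a b
  have "T\<^sup>2 = (\<Sum>k<r. S k k)\<^sup>2" by (simp add: T_def S_def)
  also have "\<dots> \<le> r * (\<Sum>a<r. \<Sum>b<r. (S a b)\<^sup>2)"
    by (rule trace_sq_le)
  also have "\<dots> = r * (\<Sum>a<r. \<Sum>b<r. (D a b)\<^sup>2 + 4 * (sdot n (u a) (u b) * sdot m (v a) (v b)))"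
    by (simp add: S_def D_def power2_eq_square algebra_simps)
  also have "\<dots> \<le> r * (\<Sum>a<r. \<Sum>b<r. 4 * (D a b)\<^sup>2 + 4 * (sdot n (u a) (u b) * sdot m (v a) (v b)))"
    by (intro mult_left_mono sum_mono add_right_mono) auto
  also have "\<dots> = 4 * r * ((\<Sum>a<r. \<Sum>b<r. (D a b)\<^sup>2) + (\<Sum>a<r. \<Sum>b<r. sdot n (u a) (u b) * sdot m (v a) (v b)))"
    by (simp add: sum.distrib sum_distrib_left distrib_left mult.assoc mult.left_commute)
  finally show ?thesis unfolding M_norm .
qed

lemma R_ge_1: "1 \<le> R" using \<mu> r by (simp add: radius_def)

text \<open>Pairing the gradient with (U, V) itself yields 2 <G, M> + \<mu> |D|^2. By coercivity and
  \<mu> \<le> c this controls |D|^2 + |M|^2, hence T^2, by sqrt T.\<close>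

lemma T_le: "T \<le> R\<^sup>2"
proof -
  let ?D = "\<Sum>a<r. \<Sum>b<r. (D a b)\<^sup>2"
  let ?M = "\<Sum>i<n. \<Sum>j<m. (\<Sum>k<r. u k i * v k j)\<^sup>2"
  define X where "X = (\<Sum>k<r. sdot n (u k) (mat_app m g (v k)))"
  have D0: "0 \<le> ?D" "0 \<le> ?M" by (intro sum_nonneg; simp)+
  have "(\<Sum>k<r. sdot m (v k) (mat_app_t n g (u k))) = X"
    unfolding X_def sdot_mat_app by (simp add: sdot_commute)
  then have "(\<Sum>k<r. sdot n (u k) (gU k)) + (\<Sum>k<r. sdot m (v k) (gV k)) = 2 * X + \<mu> * ?D"
    unfolding gU_eq gV_eq sdot_simps uD_sum[symmetric]
    by (simp add: X_def sum.distrib sum_subtractf sum_distrib_left right_diff_distrib)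
  then have "2 * X + \<mu> * ?D \<le> sqrt T * \<beta>"
    using pairing_abs_le[of u v] unfolding T_def by linarith
  moreover have "sqrt T * \<beta> \<le> sqrt T" using \<beta> T_nonneg by (simp add: mult_left_le)
  moreover have "c * ?M - F\<^sup>2 \<le> 2 * X" using coercive unfolding X_def[symmetric] by simp
  moreover have "\<mu> * ?M \<le> c * ?M" using c D0 by (intro mult_right_mono)
  ultimately have "\<mu> * (?D + ?M) \<le> sqrt T + F\<^sup>2" by (simp add: distrib_left)
  then have "4 * r / \<mu> * (\<mu> * (?D + ?M)) \<le> 4 * r / \<mu> * (sqrt T + F\<^sup>2)"
    using \<mu> by (intro mult_left_mono) auto
  then have "4 * r * (?D + ?M) \<le> 4 * r / \<mu> * (sqrt T + F\<^sup>2)" using \<mu> by simp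
  then have "(sqrt T) ^ 4 \<le> 4 * r / \<mu> * (sqrt T + F\<^sup>2)"
  proof -
    have "(sqrt T) ^ 4 = ((sqrt T)\<^sup>2)\<^sup>2" by (simp flip: power_mult)
    also have "\<dots> = T\<^sup>2" using T_nonneg by simp
    finally show ?thesis
      using T_sq_le \<open>4 * r * (?D + ?M) \<le> 4 * r / \<mu> * (sqrt T + F\<^sup>2)\<close> by linarith
  qed
  then have "sqrt T \<le> R"
    unfolding radius_def using r \<mu> T_nonneg by (intro power4_bound) auto
  then have "(sqrt T)\<^sup>2 \<le> R\<^sup>2"
    using T_nonneg by (intro power_mono) auto
  then show ?thesis using T_nonneg by simp
qed

text \<open>The gradient is paired with \<open>(U D, - V D)\<close>: the contributions of \<open>f\<close> cancel.\<close>

lemma sqrt_Z_le: "\<mu> * sqrt Z \<le> \<beta>"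
proof -
  have anti: "(\<Sum>k<r. sdot n (uD k) (mat_app m g (v k))) = (\<Sum>k<r. sdot m (vD k) (mat_app_t n g (u k)))"
  proof -
    have "(\<Sum>k<r. sdot n (uD k) (mat_app m g (v k))) = (\<Sum>k<r. \<Sum>a<r. D a k * sdot n (u a) (mat_app m g (v k)))"
      unfolding uD_def sdot_simps ..
    also have "\<dots> = (\<Sum>a<r. \<Sum>k<r. D a k * sdot n (u a) (mat_app m g (v k)))"
      by (rule sum.swap)
    also have "\<dots> = (\<Sum>a<r. \<Sum>k<r. D k a * sdot m (v k) (mat_app_t n g (u a)))"
    proof (intro sum.cong refl)
      fix a k
      have "sdot n (u a) (mat_app m g (v k)) = sdot m (v k) (mat_app_t n g (u a))"
        unfolding sdot_mat_app by (rule sdot_commute)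
      then show "D a k * sdot n (u a) (mat_app m g (v k)) = D k a * sdot m (v k) (mat_app_t n g (u a))"
        by (simp add: D_sym[of a k])
    qed
    also have "\<dots> = (\<Sum>k<r. sdot m (vD k) (mat_app_t n g (u k)))"
      unfolding vD_def sdot_simps ..
    finally show ?thesis .
  qed
  have "(\<Sum>k<r. sdot n (uD k) (gU k)) + (\<Sum>k<r. sdot m (\<lambda>j. (-1) * vD k j) (gV k)) = \<mu> * Z"
    unfolding gU_eq gV_eq sdot_simps
    by (simp add: sum.distrib sum_subtractf sum_negf anti Z_def sum_distrib_left distrib_left)
  moreover have "(\<Sum>k<r. sqnorm n (uD k) + sqnorm m (\<lambda>j. (-1) * vD k j)) = Z"
    unfolding sdot_simps by (simp add: Z_def)
  ultimately have "\<mu> * Z \<le> sqrt Z * \<beta>"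
    using pairing_abs_le[of uD "\<lambda>k j. (-1) * vD k j"] by simp
  moreover have "sqrt Z * (\<mu> * sqrt Z) = \<mu> * Z"
    using Z_nonneg by (simp only: mult.left_commute real_sqrt_mult_self abs_of_nonneg)
  ultimately have "sqrt Z * (\<mu> * sqrt Z) \<le> sqrt Z * \<beta>"
    by linarith
  then show ?thesis
    using Z_nonneg \<beta> by (cases "Z = 0") auto
qed

text \<open>By \<open>uD_sum\<close>, |D|^2 is the pairing of (U, - V) with (U D, V D), so it is at
  most the product of their norms.\<close>

lemma D_le: "\<mu> * (\<Sum>a<r. \<Sum>b<r. (D a b)\<^sup>2) \<le> R * \<beta>"
proof -
  have "((\<Sum>k<r. sdot n (u k) (uD k)) + (\<Sum>k<r. sdot m (v k) (\<lambda>j. (-1) * vD k j)))\<^sup>2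
    \<le> T * (\<Sum>k<r. sqnorm n (uD k) + sqnorm m (\<lambda>j. (-1) * vD k j))"
    unfolding T_def by (rule sdot_families_Cauchy_Schwarz)
  then have "(\<Sum>a<r. \<Sum>b<r. (D a b)\<^sup>2)\<^sup>2 \<le> T * Z"
    unfolding sdot_simps uD_sum[symmetric] by (simp add: Z_def sum_negf)
  also have "\<dots> \<le> R\<^sup>2 * (sqrt Z)\<^sup>2" using T_le Z_nonneg by (simp add: mult_right_mono)
  finally have "(\<Sum>a<r. \<Sum>b<r. (D a b)\<^sup>2)\<^sup>2 \<le> (R * sqrt Z)\<^sup>2"
    by (simp add: power_mult_distrib)
  then have "(\<Sum>a<r. \<Sum>b<r. (D a b)\<^sup>2) \<le> R * sqrt Z"
    by (rule power2_le_imp_le) (use R_ge_1 Z_nonneg in simp)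
  note DZ = this
  have "\<mu> * (\<Sum>a<r. \<Sum>b<r. (D a b)\<^sup>2) \<le> R * (\<mu> * sqrt Z)"
  proof -
    from DZ have "\<mu> * (\<Sum>a<r. \<Sum>b<r. (D a b)\<^sup>2) \<le> \<mu> * (R * sqrt Z)"
      using \<mu> by (intro mult_left_mono) auto
    then show ?thesis by (simp only: mult.left_commute)
  qed
  also have "\<dots> \<le> R * \<beta>" using sqrt_Z_le R_ge_1 by (intro mult_left_mono) auto
  finally show ?thesis .
qed

text \<open>G V is the U-block of the gradient minus \<mu> U D, and both have norm at most \<beta>;
  similarly for G^T U.\<close>

lemma g_bound:
  assumes k: "k < r"
  shows "sqnorm n (mat_app m g (v k)) \<le> (2 * \<beta>)\<^sup>2"
    and "sqnorm m (mat_app_t n g (u k)) \<le> (2 * \<beta>)\<^sup>2"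
proof -
  have Z: "sqnorm n (uD k) + sqnorm m (vD k) \<le> Z"
    unfolding Z_def using k by (intro member_le_sum) auto
  have G: "sqnorm n (gU k) + sqnorm m (gV k) \<le> \<beta>\<^sup>2"
  proof -
    have "sqnorm n (gU k) + sqnorm m (gV k) \<le> (\<Sum>k<r. sqnorm n (gU k) + sqnorm m (gV k))"
      using k by (intro member_le_sum) auto
    then show ?thesis using grad by linarith
  qed
  have Z': "sqnorm n (uD k) \<le> Z" "sqnorm m (vD k) \<le> Z"
    using Z sdot_self_nonneg[of n "uD k"] sdot_self_nonneg[of m "vD k"] by linarith+
  have "\<mu>\<^sup>2 * Z = (\<mu> * sqrt Z)\<^sup>2" using Z_nonneg by (simp add: power_mult_distrib)
  also have "\<dots> \<le> \<beta>\<^sup>2" using sqrt_Z_le \<mu> Z_nonneg by (intro power_mono) auto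
  finally have Z2: "\<mu>\<^sup>2 * Z \<le> \<beta>\<^sup>2" .
  have key: "sqnorm N (\<lambda>i. x i - c * y i) \<le> (2 * \<beta>)\<^sup>2"
    if "sqnorm N x \<le> \<beta>\<^sup>2" "sqnorm N y \<le> Z" "c\<^sup>2 = \<mu>\<^sup>2" for N x y c
  proof -
    have "0 \<le> sqnorm N (\<lambda>i. x i + c * y i)" by simp
    then have "sqnorm N (\<lambda>i. x i - c * y i) \<le> 2 * sqnorm N x + 2 * (c\<^sup>2 * sqnorm N y)"
      unfolding sdot_simps by (simp add: power2_eq_square algebra_simps)
    moreover have "c\<^sup>2 * sqnorm N y \<le> \<mu>\<^sup>2 * Z"
      unfolding that(3) using that(2) by (intro mult_left_mono) auto
    ultimately show ?thesis using that(1) Z2 by (simp add: power_mult_distrib)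
  qed
  have G': "sqnorm n (gU k) \<le> \<beta>\<^sup>2" "sqnorm m (gV k) \<le> \<beta>\<^sup>2"
    using G sdot_self_nonneg[of n "gU k"] sdot_self_nonneg[of m "gV k"] by linarith+
  have "mat_app m g (v k) = (\<lambda>i. gU k i - \<mu> * uD k i)" "mat_app_t n g (u k) = (\<lambda>i. gV k i - (- \<mu>) * vD k i)"
    by (simp_all add: gU_eq gV_eq)
  then show "sqnorm n (mat_app m g (v k)) \<le> (2 * \<beta>)\<^sup>2" "sqnorm m (mat_app_t n g (u k)) \<le> (2 * \<beta>)\<^sup>2"
    using key[OF G'(1) Z'(1), of \<mu>] key[OF G'(2) Z'(2), of "- \<mu>"] by simp_all
qed

end

section \<open>Rank and the least eigenvalue\<close>

lemma rank_sum_outer_le: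
  assumes "A \<in> carrier_mat n m"
    and "\<And>i j. i < n \<Longrightarrow> j < m \<Longrightarrow> A $$ (i, j) = (\<Sum>k<p. u k i * v k j :: real)"
  shows "rank_mat A \<le> p"
proof -
  have "vec_space.rank n A \<le> p"
    using assms
  proof (induction p arbitrary: A)
    case 0
    then have "A = 0\<^sub>m n m" by (intro eq_matI) auto
    then show ?case by (simp add: vec_space.rank_0I)
  next
    case (Suc p)
    define B where "B = mat n m (\<lambda>(i, j). \<Sum>k<p. u k i * v k j)"
    define C where "C = mat n m (\<lambda>(i, j). u p i * v p j)"
    have carr: "B \<in> carrier_mat n m" "C \<in> carrier_mat n m" by (simp_all add: B_def C_def)
    have "A = B + C"
      using Suc.prems by (intro eq_matI) (auto simp: B_def C_def)
    moreover have "vec_space.rank n B \<le> p"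
      by (rule Suc.IH) (auto simp: B_def)
    moreover have "vec_space.rank n C \<le> 1"
      by (rule vec_space.rank_le_1_product_entries[OF carr(2), of "u p" "v p"]) (auto simp: C_def)
    ultimately show ?case
      using vec_space.rank_subadditive[OF carr] by simp
  qed
  then show ?thesis using assms(1) by auto
qed

text \<open>A maximal independent set of columns has as many elements as the rank and spans every
  column; its vectors give the u_k and the coefficients give the v_k.\<close>

lemma rank_factorization:
  fixes A :: "real mat"
  assumes A: "A \<in> carrier_mat n m"
  shows "\<exists>u v. \<forall>i<n. \<forall>j<m. A $$ (i, j) = (\<Sum>k<rank_mat A. u k i * v k j)"
proof -
  interpret vec_space "TYPE(real)" n .
  define P where "P T \<longleftrightarrow> T \<subseteq> set (cols A) \<and> lin_indpt T" for T
  have cols: "set (cols A) \<subseteq> carrier_vec n" using cols_dim A by blast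
  have "P {}"
    unfolding P_def by (metis empty_subsetI fin_dim finite_basis_exists subset_li_is_li vec_vs vectorspace.basis_def)
  then obtain S where S: "finite S" "maximal S P"
    using maximal_exists_superset[of "set (cols A)" P "{}"] by (auto simp: P_def)
  have max: "maximal S (\<lambda>T. T \<subseteq> set (cols A) \<and> lin_indpt T)"
    using S(2) unfolding P_def .
  have card: "card S = rank_mat A"
    using rank_card_indpt[OF A max] A by simp
  have SP: "S \<subseteq> set (cols A)" "lin_indpt S" using max unfolding maximal_def by auto
  have Sc: "S \<subseteq> carrier_vec n" using SP cols by blast
  have span: "x \<in> span S" if "x \<in> set (cols A)" for x
  proof (rule ccontr)
    assume x: "x \<notin> span S"
    then have "lin_indpt (S \<union> {x})"
      using lindep_span SP Sc cols that S(1) lin_dep_iff_in_span[of S x] by (metis in_own_span subset_iff)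
    moreover have "S \<union> {x} \<subseteq> set (cols A)" using that SP by auto
    ultimately have "S = S \<union> {x}" using max unfolding maximal_def by (metis Un_upper1)
    then have "x \<in> S" by blast
    then show False using x Sc in_own_span by blast
  qed
  obtain e where e: "bij_betw e {..<rank_mat A} S"
    using ex_bij_betw_nat_finite[OF S(1)] card by (auto simp: atLeast0LessThan)
  have "\<exists>c. \<forall>i<n. A $$ (i, j) = (\<Sum>k<rank_mat A. e k $ i * c k)" if j: "j < m" for j
  proof -
    have "col A j \<in> set (cols A)" using j A by (auto simp: cols_def)
    then obtain a T where aT: "col A j = lincomb a T" "finite T" "T \<subseteq> S"
      using in_spanE[OF span] by blast
    \<comment> \<open>The linear combination may be supported on a proper subset \<open>T\<close> of
      the basis; its coefficients are extended by 0.\<close>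
    have "A $$ (i, j) = (\<Sum>k<rank_mat A. e k $ i * (if e k \<in> T then a (e k) else 0))" if i: "i < n" for i
    proof -
      have "A $$ (i, j) = col A j $ i" using i j A by simp
      also have "\<dots> = (\<Sum>x\<in>T. a x * x $ i)"
        unfolding aT(1) using aT Sc i by (intro lincomb_index) auto
      also have "\<dots> = (\<Sum>x\<in>S. if x \<in> T then a x * x $ i else 0)"
        using aT(3) S(1) by (simp add: sum.If_cases Int_absorb1)
      also have "\<dots> = (\<Sum>k<rank_mat A. if e k \<in> T then a (e k) * e k $ i else 0)"
        using sum.reindex_bij_betw[OF e, of "\<lambda>x. if x \<in> T then a x * x $ i else 0"] by simp
      finally show ?thesis by (simp add: if_distrib mult.commute cong: if_cong)
    qed
    then show ?thesis by (intro exI allI impI)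
  qed
  then obtain c where "\<And>i j. i < n \<Longrightarrow> j < m \<Longrightarrow> A $$ (i, j) = (\<Sum>k<rank_mat A. e k $ i * c j k)"
    by metis
  then show ?thesis
    by (intro exI[of _ "\<lambda>k i. e k $ i"] exI[of _ "\<lambda>k j. c j k"]) simp
qed

section \<open>The Rayleigh bound\<close>

lemma mat_app_add_scale:
  "mat_app m g (\<lambda>i. x i + t * y i) = (\<lambda>i. mat_app m g x i + t * mat_app m g y i)"
  by (rule ext) (simp add: mat_app_def algebra_simps sum.distrib sum_distrib_left)

text \<open>The minimum of the quadratic form on the unit sphere is attained, and stationarity there
  makes the minimizer an eigenvector. The minimum is thus one of the eigenvalues over which
  \<open>lambda_min\<close> ranges.\<close>

lemma lambda_min_Rayleigh:
  fixes A :: "real mat"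
  assumes A: "A \<in> carrier_mat N N"
    and sym: "\<And>i j. i < N \<Longrightarrow> j < N \<Longrightarrow> A $$ (i, j) = A $$ (j, i)"
    and N: "0 < N"
  shows "lambda_min A * sqnorm N z \<le> sdot N z (mat_app N (\<lambda>i j. A $$ (i, j)) z)"
proof -
  define g where "g = (\<lambda>i j. A $$ (i, j))"
  define Q where "Q x = sdot N x (mat_app N g x)" for x
  define B where "B = {x :: nat \<Rightarrow> real. \<forall>i. x i \<in> (if i < N then {-1..1} else {0})}"
  define S where "S = B \<inter> {x. sqnorm N x = 1}"
  have "continuous_on UNIV Q"
    unfolding Q_def sdot_def mat_app_def by (intro continuous_intros continuous_on_product_coordinates)
  then have Qcont: "continuous_on X Q" for X
    by (rule continuous_on_subset) simp
  have "compact B" unfolding B_def by (rule compact_Pi_UNIV) simp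
  moreover have "closed {x. sqnorm N x = 1}"
    unfolding sdot_def by (intro closed_Collect_eq continuous_intros continuous_on_product_coordinates)
  ultimately have "compact S" unfolding S_def by (rule compact_Int_closed)
  have Q_scale: "Q (\<lambda>i. c * x i) = c\<^sup>2 * Q x" for c x
    unfolding Q_def by (simp add: sdot_def mat_app_def sum_distrib_left power2_eq_square ac_simps)
  have norm: "\<exists>x\<in>S. Q z = sqnorm N z * Q x" if "sqnorm N z \<noteq> 0" for z
  proof -
    define c where "c = 1 / sqrt (sqnorm N z)"
    define x where "x i = (if i < N then c * z i else 0)" for i
    have pos: "sqnorm N z > 0" using that sdot_self_nonneg[of N z] by linarith
    have c2: "c\<^sup>2 * sqnorm N z = 1" using pos by (simp add: c_def power_divide)
    have "sqnorm N x = sqnorm N (\<lambda>i. c * z i)" by (simp add: sdot_def x_def)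
    also have "\<dots> = c\<^sup>2 * sqnorm N z" unfolding sdot_simps by (simp add: power2_eq_square)
    finally have xx: "sqnorm N x = 1" using c2 by simp
    have "\<bar>x i\<bar> \<le> 1" for i
    proof (cases "i < N")
      case True
      then have "(x i)\<^sup>2 \<le> sqnorm N x"
        unfolding sdot_def power2_eq_square by (intro member_le_sum) auto
      then show ?thesis using xx by (simp add: abs_square_le_1)
    qed (simp add: x_def)
    moreover have "x i = 0" if "\<not> i < N" for i using that by (simp add: x_def)
    ultimately have "x \<in> B" by (simp add: B_def abs_le_iff minus_le_iff)
    then have "x \<in> S" using xx by (simp add: S_def)
    moreover have "Q x = Q (\<lambda>i. c * z i)" by (simp add: Q_def sdot_def mat_app_def x_def)
    then have "sqnorm N z * Q x = (c\<^sup>2 * sqnorm N z) * Q z" by (simp add: Q_scale)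
    then have "Q z = sqnorm N z * Q x" using c2 by simp
    ultimately show ?thesis by blast
  qed
  have "sqnorm N (\<lambda>i. 1) \<noteq> 0" using N by (simp add: sdot_def)
  then have "S \<noteq> {}" using norm[of "\<lambda>i. 1"] by blast
  then obtain x0 where x0: "x0 \<in> S" "\<And>x. x \<in> S \<Longrightarrow> Q x0 \<le> Q x"
    using continuous_attains_inf[OF \<open>compact S\<close> _ Qcont] by blast
  define L where "L = Q x0"
  have low: "L * sqnorm N z \<le> Q z" for z
  proof (cases "sqnorm N z = 0")
    case True
    then have "Q z = 0" unfolding Q_def sdot_self_eq_0_iff by (simp add: sdot_def)
    then show ?thesis using True by simp
  next
    case False
    from norm[OF this] obtain x where x: "x \<in> S" "Q z = sqnorm N z * Q x" by blast
    have "sqnorm N z * L \<le> sqnorm N z * Q x"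
      using x0(2)[OF x(1)] by (intro mult_left_mono) (auto simp: L_def)
    then show ?thesis using x(2) by (simp add: mult.commute)
  qed
  have swap: "sdot N x (mat_app N g y) = sdot N y (mat_app N g x)" for x y
  proof -
    have "mat_app_t N g x i = mat_app N g x i" if "i < N" for i
      using sym that by (auto simp: mat_app_t_def mat_app_def g_def)
    then have "sdot N (mat_app_t N g x) y = sdot N (mat_app N g x) y" by (simp add: sdot_def)
    then show ?thesis by (simp add: sdot_mat_app[of N x] sdot_commute[of N y])
  qed
  have xx: "sqnorm N x0 = 1" using x0(1) by (simp add: S_def)
  have stat: "sdot N y (mat_app N g x0) = L * sdot N y x0" for y
  proof -
    have "t * (2 * (L * sdot N y x0 - sdot N y (mat_app N g x0))) + t\<^sup>2 * (L * sqnorm N y - Q y) \<le> 0" for t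
    proof -
      have "Q (\<lambda>i. x0 i + t * y i) = L + 2 * t * sdot N y (mat_app N g x0) + t\<^sup>2 * Q y"
        unfolding Q_def mat_app_add_scale sdot_simps swap[of x0 y]
        by (simp add: L_def Q_def power2_eq_square algebra_simps)
      moreover have "sqnorm N (\<lambda>i. x0 i + t * y i) = 1 + 2 * t * sdot N y x0 + t\<^sup>2 * sqnorm N y"
        unfolding sdot_simps sdot_commute[of N x0 y] using xx by (simp add: power2_eq_square algebra_simps)
      ultimately show ?thesis
        using low[of "\<lambda>i. x0 i + t * y i"] by (simp add: algebra_simps)
    qed
    from quadratic_stationary[OF this] show ?thesis by simp
  qed
  have "eigenvector A (vec N x0) L"
  proof -
    have "vec N x0 \<noteq> 0\<^sub>v N"
    proof
      assume "vec N x0 = 0\<^sub>v N"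
      then have "\<forall>i<N. x0 i = 0" by (metis index_vec index_zero_vec(1))
      then have "sqnorm N x0 = 0" by (simp add: sdot_self_eq_0_iff)
      then show False using xx by simp
    qed
    moreover have "A *\<^sub>v vec N x0 = L \<cdot>\<^sub>v vec N x0"
    proof (rule eq_vecI)
      fix i assume "i < dim_vec (L \<cdot>\<^sub>v vec N x0)"
      then have i: "i < N" by simp
      have 1: "sdot N (\<lambda>k. if k = i then 1 else 0) f = f i" for f
        using i by (simp add: sdot_def if_distrib[of "\<lambda>c. c * _"] cong: if_cong)
      have "(A *\<^sub>v vec N x0) $ i = mat_app N g x0 i"
        using i A by (simp add: scalar_prod_def mat_app_def g_def atLeast0LessThan)
      also have "\<dots> = L * x0 i"
        using stat[of "\<lambda>k. if k = i then 1 else 0"] unfolding 1 .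
      finally show "(A *\<^sub>v vec N x0) $ i = (L \<cdot>\<^sub>v vec N x0) $ i" using i by simp
    qed (use A in simp)
    ultimately show ?thesis using A by (simp add: eigenvector_def)
  qed
  then have "L \<in> {k. eigenvalue A k}" by (auto simp: eigenvalue_def)
  \<comment> \<open>Finiteness is what gives \<open>Min\<close> its meaning.\<close>
  moreover have "finite {k. eigenvalue A k}"
  proof -
    have "char_poly A \<noteq> 0" using degree_monic_char_poly[OF A] by auto
    then show ?thesis unfolding eigenvalue_root_char_poly[OF A] by (rule poly_roots_finite)
  qed
  ultimately have "lambda_min A \<le> L"
    unfolding lambda_min_def by (intro Min_le)
  then have "lambda_min A * sqnorm N z \<le> L * sqnorm N z"
    by (intro mult_right_mono) simp_all
  also have "\<dots> \<le> Q z" by (rule low)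
  finally show ?thesis unfolding Q_def g_def .
qed

section \<open>Derivatives of functions of a matrix\<close>

lemma fro_norm_sq:
  assumes "A \<in> carrier_mat p q"
  shows "(fro_norm A)\<^sup>2 = (\<Sum>i<p. \<Sum>j<q. (A $$ (i, j))\<^sup>2)"
  using assms by (auto simp: fro_norm_def fro_inner_def power2_eq_square sum_nonneg)

lemma fro_norm_nonneg [simp]: "0 \<le> fro_norm A"
  by (simp add: fro_norm_def fro_inner_def sum_nonneg)

lemma fro_norm_smult: "fro_norm (t \<cdot>\<^sub>m A) = \<bar>t\<bar> * fro_norm A"
proof -
  have "fro_inner (t \<cdot>\<^sub>m A) (t \<cdot>\<^sub>m A) = t\<^sup>2 * fro_inner A A"
    by (simp add: fro_inner_def sum_distrib_left power2_eq_square ac_simps)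
  then show ?thesis by (simp add: fro_norm_def real_sqrt_mult)
qed

lemma fro_norm_le:
  assumes "A \<in> carrier_mat p q" and "\<And>i j. i < p \<Longrightarrow> j < q \<Longrightarrow> \<bar>A $$ (i, j)\<bar> \<le> c" and "0 \<le> c"
  shows "fro_norm A \<le> real (p * q) * c"
proof (rule power2_le_imp_le)
  have "(fro_norm A)\<^sup>2 \<le> (\<Sum>i<p. \<Sum>j<q. c\<^sup>2)"
    unfolding fro_norm_sq[OF assms(1)] using assms(2,3)
    by (intro sum_mono) (simp add: power2_le_iff_abs_le)
  also have "\<dots> = real (p * q) * c\<^sup>2" by simp
  also have "\<dots> \<le> real (p * q) * (real (p * q) * c\<^sup>2)"
  proof (cases "p * q = 0")
    case False
    then have "1 \<le> real (p * q)" by linarith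
    then have "1 * c\<^sup>2 \<le> real (p * q) * c\<^sup>2" by (intro mult_right_mono) auto
    then show ?thesis by (intro mult_left_mono) auto
  qed auto
  also have "\<dots> = (real (p * q) * c)\<^sup>2" by (simp add: power2_eq_square)
  finally show "(fro_norm A)\<^sup>2 \<le> (real (p * q) * c)\<^sup>2" .
qed (use assms(3) in simp)

lemma mat_add_smult_assoc:
  fixes X K :: "real mat"
  assumes "X \<in> carrier_mat p q" "K \<in> carrier_mat p q"
  shows "X + (s + t) \<cdot>\<^sub>m K = (X + s \<cdot>\<^sub>m K) + t \<cdot>\<^sub>m K"
  using assms by (intro eq_matI) (auto simp: algebra_simps)

section \<open>Derivatives along lines\<close>

lemma line_derivative_0:
  assumes diff: "mat_differentiable p q F X" and X: "X \<in> carrier_mat p q" and K: "K \<in> carrier_mat p q"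
  shows "((\<lambda>t. F (X + t \<cdot>\<^sub>m K)) has_real_derivative
    (\<Sum>i<p. \<Sum>j<q. partial_deriv p q (i, j) F X * K $$ (i, j))) (at 0)"
proof -
  let ?D = "\<Sum>i<p. \<Sum>j<q. partial_deriv p q (i, j) F X * K $$ (i, j)"
  have X0: "X + 0 \<cdot>\<^sub>m K = X" using X K by (intro eq_matI) auto
  have inner: "fro_inner (gradient p q F X) (t \<cdot>\<^sub>m K) = t * ?D" for t
    using K by (simp add: fro_inner_def gradient_def sum_distrib_left ac_simps)
  \<comment> \<open>The summand 1 keeps the denominator nonzero for K = 0 and makes the estimate
    strict.\<close>
  define c where "c = fro_norm K + 1"
  have c: "c > 0" "fro_norm K < c" by (auto simp: c_def add_nonneg_pos)
  have "\<exists>d>0. \<forall>t. t \<noteq> 0 \<and> \<bar>t\<bar> < d \<longrightarrow> \<bar>(F (X + t \<cdot>\<^sub>m K) - F X) / t - ?D\<bar> < e" if e: "e > 0" for e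
  proof -
    have "e / c > 0" using e c by simp
    with diff obtain d where d: "d > 0"
      "\<And>H. H \<in> carrier_mat p q \<Longrightarrow> fro_norm H < d \<Longrightarrow>
        \<bar>F (X + H) - F X - fro_inner (gradient p q F X) H\<bar> \<le> e / c * fro_norm H"
      unfolding mat_differentiable_def by meson
    show ?thesis
    proof (intro exI[of _ "d / c"] conjI allI impI)
      show "d / c > 0" using d c by simp
      fix t assume t: "t \<noteq> 0 \<and> \<bar>t\<bar> < d / c"
      have "fro_norm (t \<cdot>\<^sub>m K) \<le> \<bar>t\<bar> * c"
        unfolding fro_norm_smult using c by (intro mult_left_mono) auto
      also have "\<dots> < d" using t c by (simp add: pos_less_divide_eq)
      finally have "\<bar>F (X + t \<cdot>\<^sub>m K) - F X - t * ?D\<bar> \<le> e / c * fro_norm (t \<cdot>\<^sub>m K)"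
        using d(2)[of "t \<cdot>\<^sub>m K"] K unfolding inner by simp
      also have "\<dots> = \<bar>t\<bar> * (e / c * fro_norm K)" by (simp add: fro_norm_smult)
      also have "\<dots> < \<bar>t\<bar> * e"
      proof -
        have "e / c * fro_norm K < e / c * c" using e c by (intro mult_strict_left_mono) auto
        then have "e / c * fro_norm K < e" using c by simp
        then show ?thesis using t by (intro mult_strict_left_mono) auto
      qed
      finally have "\<bar>F (X + t \<cdot>\<^sub>m K) - F X - t * ?D\<bar> / \<bar>t\<bar> < e"
        using t by (simp add: pos_divide_less_eq mult.commute)
      moreover have "(F (X + t \<cdot>\<^sub>m K) - F X) / t - ?D = (F (X + t \<cdot>\<^sub>m K) - F X - t * ?D) / t"
        using t by (simp add: diff_divide_distrib)
      ultimately show "\<bar>(F (X + t \<cdot>\<^sub>m K) - F X) / t - ?D\<bar> < e"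
        by (simp add: abs_divide)
    qed
  qed
  then show ?thesis
    unfolding DERIV_def LIM_def by (simp add: X0 dist_real_def)
qed

lemma line_derivative:
  assumes diff: "\<And>X. X \<in> carrier_mat p q \<Longrightarrow> mat_differentiable p q F X"
    and X: "X \<in> carrier_mat p q" and K: "K \<in> carrier_mat p q"
  shows "((\<lambda>t. F (X + t \<cdot>\<^sub>m K)) has_real_derivative
    (\<Sum>i<p. \<Sum>j<q. partial_deriv p q (i, j) F (X + t \<cdot>\<^sub>m K) * K $$ (i, j))) (at t)"
proof -
  have "((\<lambda>s. F ((X + t \<cdot>\<^sub>m K) + s \<cdot>\<^sub>m K)) has_real_derivative
    (\<Sum>i<p. \<Sum>j<q. partial_deriv p q (i, j) F (X + t \<cdot>\<^sub>m K) * K $$ (i, j))) (at 0)"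
    using X K by (intro line_derivative_0 diff) auto
  then have "((\<lambda>s. F (X + (s + t) \<cdot>\<^sub>m K)) has_real_derivative
    (\<Sum>i<p. \<Sum>j<q. partial_deriv p q (i, j) F (X + t \<cdot>\<^sub>m K) * K $$ (i, j))) (at 0)"
    unfolding mat_add_smult_assoc[OF X K, symmetric] by (simp add: add.commute)
  then show ?thesis
    using DERIV_shift[of "\<lambda>s. F (X + s \<cdot>\<^sub>m K)" _ 0 t] by simp
qed

lemma unit_mat_carrier [simp]: "unit_mat p q ij \<in> carrier_mat p q"
  by (simp add: unit_mat_def)

lemma unit_mat_index: "i < p \<Longrightarrow> j < q \<Longrightarrow> unit_mat p q ab $$ (i, j) = (if (i, j) = ab then 1 else 0)"
  by (simp add: unit_mat_def)

lemma sum_unit_mat: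
  assumes "a < p" "b < q"
  shows "(\<Sum>i<p. \<Sum>j<q. F i j * unit_mat p q (a, b) $$ (i, j)) = F a b"
proof -
  have "(\<Sum>i<p. \<Sum>j<q. F i j * unit_mat p q (a, b) $$ (i, j)) = (\<Sum>i<p. \<Sum>j<q. if j = b then (if i = a then F i j else 0) else 0)"
    by (intro sum.cong) (auto simp: unit_mat_index)
  also have "\<dots> = F a b" using assms by simp
  finally show ?thesis .
qed

lemma unit_line_derivative:
  assumes diff: "\<And>X. X \<in> carrier_mat p q \<Longrightarrow> mat_differentiable p q F X"
    and X: "X \<in> carrier_mat p q" and ab: "a < p" "b < q"
  shows "((\<lambda>t. F (X + t \<cdot>\<^sub>m unit_mat p q (a, b))) has_real_derivative
    partial_deriv p q (a, b) F (X + t \<cdot>\<^sub>m unit_mat p q (a, b))) (at t)"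
  using line_derivative[OF diff X unit_mat_carrier, of "(a, b)" t] unfolding sum_unit_mat[OF ab] by simp

lemma twice_cont_diffD:
  assumes "twice_cont_diff p q F" "X \<in> carrier_mat p q"
  shows "mat_differentiable p q F X"
    and "i < p \<Longrightarrow> j < q \<Longrightarrow> mat_differentiable p q (partial_deriv p q (i, j) F) X"
    and "i < p \<Longrightarrow> j < q \<Longrightarrow> k < p \<Longrightarrow> l < q \<Longrightarrow>
      mat_continuous p q (partial_deriv p q (k, l) (partial_deriv p q (i, j) F)) X"
  using assms unfolding twice_cont_diff_def by auto

text \<open>Two applications of the mean value theorem express the mixed second difference quotient as
  a value of \<open>\<partial>\<^sub>b \<partial>\<^sub>a F\<close> near \<open>X\<close>; the difference quotient is symmetric in \<open>a\<close> and \<open>b\<close>.\<close>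

lemma mixed_difference:
  assumes tcd: "twice_cont_diff p q F" and X: "X \<in> carrier_mat p q"
    and ij: "i < p" "j < q" and kl: "k < p" "l < q" and e: "e > 0"
  shows "\<exists>d>0. \<forall>h. 0 < h \<and> h < d \<longrightarrow>
    \<bar>(F ((X + h \<cdot>\<^sub>m unit_mat p q (i, j)) + h \<cdot>\<^sub>m unit_mat p q (k, l)) - F (X + h \<cdot>\<^sub>m unit_mat p q (i, j))
      - F (X + h \<cdot>\<^sub>m unit_mat p q (k, l)) + F X) / h\<^sup>2
     - partial_deriv p q (k, l) (partial_deriv p q (i, j) F) X\<bar> < e"
proof -
  let ?A = "unit_mat p q (i, j)" and ?B = "unit_mat p q (k, l)"
  let ?Fa = "partial_deriv p q (i, j) F"
  let ?Fab = "partial_deriv p q (k, l) ?Fa"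
  note dF = twice_cont_diffD(1)[OF tcd] and dFa = twice_cont_diffD(2)[OF tcd _ ij]
  obtain d where d: "d > 0" "\<And>Y. Y \<in> carrier_mat p q \<Longrightarrow> fro_norm (Y - X) < d \<Longrightarrow> \<bar>?Fab Y - ?Fab X\<bar> < e"
    using twice_cont_diffD(3)[OF tcd X ij kl] e unfolding mat_continuous_def by meson
  \<comment> \<open>The intermediate point differs from X by at most 2 h in each entry, the extreme
    case being two equal coordinate directions.\<close>
  define N where "N = 2 * real (p * q) + 1"
  have N: "N > 0" by (simp add: N_def add_nonneg_pos)
  show ?thesis
  proof (intro exI[of _ "d / N"] conjI allI impI)
    show "d / N > 0" using d N by simp
    fix h assume h: "0 < h \<and> h < d / N"
    define \<psi> where "\<psi> s = F ((X + h \<cdot>\<^sub>m ?B) + s \<cdot>\<^sub>m ?A) - F (X + s \<cdot>\<^sub>m ?A)" for s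
    have "(\<psi> has_real_derivative ?Fa ((X + h \<cdot>\<^sub>m ?B) + s \<cdot>\<^sub>m ?A) - ?Fa (X + s \<cdot>\<^sub>m ?A)) (at s)" for s
      unfolding \<psi>_def using X ij by (intro DERIV_diff unit_line_derivative dF) auto
    with h obtain \<xi> where xi: "0 < \<xi>" "\<xi> < h"
      "\<psi> h - \<psi> 0 = h * (?Fa ((X + h \<cdot>\<^sub>m ?B) + \<xi> \<cdot>\<^sub>m ?A) - ?Fa (X + \<xi> \<cdot>\<^sub>m ?A))"
      using MVT2[of 0 h \<psi> "\<lambda>s. ?Fa ((X + h \<cdot>\<^sub>m ?B) + s \<cdot>\<^sub>m ?A) - ?Fa (X + s \<cdot>\<^sub>m ?A)"] by auto
    define Y where "Y = X + \<xi> \<cdot>\<^sub>m ?A"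
    have Y: "Y \<in> carrier_mat p q" using X by (simp add: Y_def)
    have "((\<lambda>t. ?Fa (Y + t \<cdot>\<^sub>m ?B)) has_real_derivative ?Fab (Y + t \<cdot>\<^sub>m ?B)) (at t)" for t
      by (rule unit_line_derivative[OF dFa Y kl])
    with h obtain \<zeta> where ze: "0 < \<zeta>" "\<zeta> < h"
      "?Fa (Y + h \<cdot>\<^sub>m ?B) - ?Fa (Y + 0 \<cdot>\<^sub>m ?B) = h * ?Fab (Y + \<zeta> \<cdot>\<^sub>m ?B)"
      using MVT2[of 0 h "\<lambda>t. ?Fa (Y + t \<cdot>\<^sub>m ?B)" "\<lambda>t. ?Fab (Y + t \<cdot>\<^sub>m ?B)"] by auto
    have r1: "(X + h \<cdot>\<^sub>m ?B) + \<xi> \<cdot>\<^sub>m ?A = Y + h \<cdot>\<^sub>m ?B" and r2: "Y + 0 \<cdot>\<^sub>m ?B = Y"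
      and r3: "(X + h \<cdot>\<^sub>m ?B) + h \<cdot>\<^sub>m ?A = (X + h \<cdot>\<^sub>m ?A) + h \<cdot>\<^sub>m ?B"
      and r4: "(X + h \<cdot>\<^sub>m ?B) + 0 \<cdot>\<^sub>m ?A = X + h \<cdot>\<^sub>m ?B" and r5: "X + 0 \<cdot>\<^sub>m ?A = X"
      using X unfolding Y_def by (auto intro!: eq_matI simp: unit_mat_def)
    have "\<psi> h - \<psi> 0 = h\<^sup>2 * ?Fab (Y + \<zeta> \<cdot>\<^sub>m ?B)"
      using xi(3) ze(3) unfolding r1 r2 Y_def[symmetric] by (simp add: power2_eq_square)
    moreover have "\<psi> h - \<psi> 0 = F ((X + h \<cdot>\<^sub>m ?A) + h \<cdot>\<^sub>m ?B) - F (X + h \<cdot>\<^sub>m ?A) - F (X + h \<cdot>\<^sub>m ?B) + F X"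
      unfolding \<psi>_def r3 r4 r5 by simp
    moreover have "\<bar>?Fab (Y + \<zeta> \<cdot>\<^sub>m ?B) - ?Fab X\<bar> < e"
    proof (rule d(2))
      show "Y + \<zeta> \<cdot>\<^sub>m ?B \<in> carrier_mat p q" using Y by simp
      have "fro_norm (Y + \<zeta> \<cdot>\<^sub>m ?B - X) \<le> real (p * q) * (2 * h)"
      proof (rule fro_norm_le)
        show "\<bar>(Y + \<zeta> \<cdot>\<^sub>m ?B - X) $$ (a, b)\<bar> \<le> 2 * h" if "a < p" "b < q" for a b
          using that X xi ze h by (auto simp: Y_def unit_mat_def)
      qed (use X Y h in auto)
      also have "\<dots> \<le> N * h" using h by (simp add: N_def algebra_simps)
      also have "\<dots> < d" using h N by (simp add: pos_less_divide_eq mult.commute)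
      finally show "fro_norm (Y + \<zeta> \<cdot>\<^sub>m ?B - X) < d" .
    qed
    ultimately show "\<bar>(F ((X + h \<cdot>\<^sub>m ?A) + h \<cdot>\<^sub>m ?B) - F (X + h \<cdot>\<^sub>m ?A) - F (X + h \<cdot>\<^sub>m ?B) + F X) / h\<^sup>2 - ?Fab X\<bar> < e"
      using h by simp
  qed
qed

lemma partial_deriv_commute:
  assumes tcd: "twice_cont_diff p q F" and X: "X \<in> carrier_mat p q"
    and ij: "i < p" "j < q" and kl: "k < p" "l < q"
  shows "partial_deriv p q (k, l) (partial_deriv p q (i, j) F) X
    = partial_deriv p q (i, j) (partial_deriv p q (k, l) F) X"
proof (rule ccontr)
  let ?A = "unit_mat p q (i, j)" and ?B = "unit_mat p q (k, l)"
  let ?a = "partial_deriv p q (k, l) (partial_deriv p q (i, j) F) X"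
  let ?b = "partial_deriv p q (i, j) (partial_deriv p q (k, l) F) X"
  assume "?a \<noteq> ?b"
  then have e: "\<bar>?a - ?b\<bar> / 2 > 0" by simp
  from mixed_difference[OF tcd X ij kl e] obtain d1 where d1: "d1 > 0" "\<And>h. 0 < h \<and> h < d1 \<Longrightarrow>
    \<bar>(F ((X + h \<cdot>\<^sub>m ?A) + h \<cdot>\<^sub>m ?B) - F (X + h \<cdot>\<^sub>m ?A) - F (X + h \<cdot>\<^sub>m ?B) + F X) / h\<^sup>2 - ?a\<bar> < \<bar>?a - ?b\<bar> / 2"
    by blast
  from mixed_difference[OF tcd X kl ij e] obtain d2 where d2: "d2 > 0" "\<And>h. 0 < h \<and> h < d2 \<Longrightarrow>
    \<bar>(F ((X + h \<cdot>\<^sub>m ?B) + h \<cdot>\<^sub>m ?A) - F (X + h \<cdot>\<^sub>m ?B) - F (X + h \<cdot>\<^sub>m ?A) + F X) / h\<^sup>2 - ?b\<bar> < \<bar>?a - ?b\<bar> / 2"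
    by blast
  define h where "h = min d1 d2 / 2"
  have h: "0 < h \<and> h < d1" "0 < h \<and> h < d2" using d1(1) d2(1) by (auto simp: h_def min_def)
  have "(X + h \<cdot>\<^sub>m ?B) + h \<cdot>\<^sub>m ?A = (X + h \<cdot>\<^sub>m ?A) + h \<cdot>\<^sub>m ?B"
    using X by (auto intro!: eq_matI simp: unit_mat_def)
  then have eq: "F ((X + h \<cdot>\<^sub>m ?B) + h \<cdot>\<^sub>m ?A) - F (X + h \<cdot>\<^sub>m ?B) - F (X + h \<cdot>\<^sub>m ?A) + F X
     = F ((X + h \<cdot>\<^sub>m ?A) + h \<cdot>\<^sub>m ?B) - F (X + h \<cdot>\<^sub>m ?A) - F (X + h \<cdot>\<^sub>m ?B) + F X"
    by simp
  have no: False if "\<bar>x - ?a\<bar> < \<bar>?a - ?b\<bar> / 2" "\<bar>x - ?b\<bar> < \<bar>?a - ?b\<bar> / 2" for x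
  proof -
    have "\<bar>?a - ?b\<bar> \<le> \<bar>x - ?b\<bar> + \<bar>x - ?a\<bar>"
      using abs_triangle_ineq4[of "x - ?b" "x - ?a"] by simp
    also have "\<dots> < \<bar>?a - ?b\<bar> / 2 + \<bar>?a - ?b\<bar> / 2"
      by (rule add_strict_mono[OF that(2,1)])
    finally show False by simp
  qed
  show False by (rule no[OF d1(2)[OF h(1)] d2(2)[OF h(2), unfolded eq]])
qed

lemma sum_div_mod:
  fixes F :: "nat \<Rightarrow> nat \<Rightarrow> 'a::comm_monoid_add"
  shows "(\<Sum>a<p * q. F (a div q) (a mod q)) = (\<Sum>i<p. \<Sum>j<q. F i j)"
proof (cases "q = 0")
  case False
  have "(\<Sum>a<p * q. F (a div q) (a mod q)) = (\<Sum>(i, j)\<in>{..<p} \<times> {..<q}. F i j)"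
  proof (rule sum.reindex_bij_witness[of _ "\<lambda>(i, j). i * q + j" "\<lambda>a. (a div q, a mod q)"])
    fix a assume "a \<in> {..<p * q}"
    then show "(a div q, a mod q) \<in> {..<p} \<times> {..<q}"
      using False by (simp add: less_mult_imp_div_less)
  next
    fix b assume "b \<in> {..<p} \<times> {..<q}"
    then obtain i j where "b = (i, j)" "i < p" "j < q" by auto
    then have "i * q + j < Suc i * q" by simp
    also have "\<dots> \<le> p * q" using \<open>i < p\<close> by (intro mult_le_mono1) simp
    finally show "(case b of (i, j) \<Rightarrow> i * q + j) \<in> {..<p * q}"
      using \<open>b = (i, j)\<close> by simp
  qed (use False in auto)
  then show ?thesis by (simp add: sum.cartesian_product)
qed simp

section \<open>The factored objective\<close>

lemma sum_lessThan_add: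
  fixes F :: "nat \<Rightarrow> 'a::comm_monoid_add"
  shows "(\<Sum>c<n + m. F c) = (\<Sum>i<n. F i) + (\<Sum>j<m. F (n + j))"
  by (induction m) (simp_all add: add.assoc)

lemma sdot_cong: "(\<And>i. i < n \<Longrightarrow> x i = x' i) \<Longrightarrow> (\<And>i. i < n \<Longrightarrow> y i = y' i) \<Longrightarrow> sdot n x y = sdot n x' y'"
  by (simp add: sdot_def)

lemma pairing_outer:
  "(\<Sum>k<r. sdot n (x k) (mat_app m A (v k)) + sdot m (y k) (mat_app_t n A (u k)))
    = (\<Sum>i<n. \<Sum>j<m. A i j * (\<Sum>k<r. x k i * v k j + u k i * y k j))"
proof -
  have "sdot m (y k) (mat_app_t n A (u k)) = sdot n (u k) (mat_app m A (y k))" for k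
    unfolding sdot_mat_app by (rule sdot_commute)
  then show ?thesis
    by (simp add: sum.distrib sum_sdot_mat_app distrib_left)
qed

text \<open>Symmetry of T allows the pairing to be symmetrized, which is how the derivative of U^T U
  - V^T V, and the factor 1/2, enter.\<close>

lemma pairing_symmetric:
  fixes T :: "nat \<Rightarrow> nat \<Rightarrow> real"
  assumes T: "\<And>a b. T a b = T b a"
  shows "(\<Sum>k<r. sdot n (x k) (\<lambda>i. \<Sum>a<r. T a k * u a i) - sdot m (y k) (\<lambda>j. \<Sum>a<r. T a k * v a j))
    = (\<Sum>a<r. \<Sum>b<r. T a b * (sdot n (u a) (x b) + sdot n (x a) (u b) - sdot m (v a) (y b) - sdot m (y a) (v b))) / 2"
proof -
  define c where "c a b = sdot n (u a) (x b) - sdot m (v a) (y b)" for a b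
  have "(\<Sum>k<r. sdot n (x k) (\<lambda>i. \<Sum>a<r. T a k * u a i) - sdot m (y k) (\<lambda>j. \<Sum>a<r. T a k * v a j))
     = (\<Sum>k<r. \<Sum>a<r. T a k * c a k)"
    unfolding sdot_simps c_def
    by (simp add: sum_subtractf right_diff_distrib sdot_commute)
  moreover have "(\<Sum>k<r. \<Sum>a<r. T a k * c a k) = (\<Sum>a<r. \<Sum>k<r. T a k * c a k)"
    by (rule sum.swap)
  moreover have "(\<Sum>k<r. \<Sum>a<r. T a k * c a k) = (\<Sum>a<r. \<Sum>b<r. T a b * c b a)"
    by (intro sum.cong refl) (metis T)
  moreover have "(\<Sum>a<r. \<Sum>b<r. T a b * (sdot n (u a) (x b) + sdot n (x a) (u b) - sdot m (v a) (y b) - sdot m (y a) (v b)))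
     = (\<Sum>a<r. \<Sum>b<r. T a b * c a b) + (\<Sum>a<r. \<Sum>b<r. T a b * c b a)"
    unfolding sum.distrib[symmetric] c_def
    by (intro sum.cong refl) (simp add: sdot_commute algebra_simps)
  ultimately show ?thesis by simp
qed

section \<open>Gradient and Hessian of the regularized objective\<close>

locale factored_objective =
  fixes n m r :: nat and f :: "real mat \<Rightarrow> real" and \<mu> :: real
  assumes tcd: "twice_cont_diff n m f"
begin

abbreviation "\<rho> \<equiv> rho_stacked n m r f \<mu>"
abbreviation "factors \<equiv> carrier_mat (n + m) r"

text \<open>\<open>U\<close> and \<open>V\<close> are the columns of the two blocks, extended by zero so that they depend linearly on
  the matrix.  \<open>PM\<close> is the product \<open>U V\<^sup>T\<close> and \<open>DD\<close> is \<open>U\<^sup>T U - V\<^sup>T V\<close>; \<open>KK\<close>, \<open>dD\<close>, \<open>gd\<close> and \<open>hr\<close>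
  are the derivatives of \<open>PM\<close>, \<open>DD\<close>, of the gradient of \<open>f\<close> and of the gradient \<open>gr\<close> of \<open>\<rho>\<close> in the
  direction \<open>Z\<close>.\<close>

definition "U W k i = (if i < n \<and> k < r then W $$ (i, k) else 0)" for W :: "real mat"
definition "V W k j = (if j < m \<and> k < r then W $$ (n + j, k) else 0)" for W :: "real mat"
definition "PM W = mat n m (\<lambda>(i, j). \<Sum>k<r. U W k i * V W k j)"
abbreviation "DD W \<equiv> imbalance n m (U W) (V W)"
lemmas DD_def = imbalance_def
definition "dD W Z a b = sdot n (U W a) (U Z b) + sdot n (U Z a) (U W b)
  - sdot m (V W a) (V Z b) - sdot m (V Z a) (V W b)"
definition "KK W Z = mat n m (\<lambda>(i, j). \<Sum>k<r. U Z k i * V W k j + U W k i * V Z k j)"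
definition "g X i j = partial_deriv n m (i, j) f X"
definition "H X i j k l = partial_deriv n m (k, l) (partial_deriv n m (i, j) f) X"
abbreviation "gU W \<equiv> grad_left n m r \<mu> (g (PM W)) (U W) (V W)"
abbreviation "gV W \<equiv> grad_right n m r \<mu> (g (PM W)) (U W) (V W)"
lemmas gU_def = grad_left_def
lemmas gV_def = grad_right_def
definition "HF X K L = (\<Sum>i<n. \<Sum>j<m. K $$ (i, j) * (\<Sum>k<n. \<Sum>l<m. H X i j k l * L $$ (k, l)))"
definition "gr W c k = (if c < n then gU W k c else gV W k (c - n))"
definition "gd W Z i j = (\<Sum>k<n. \<Sum>l<m. H (PM W) i j k l * KK W Z $$ (k, l))"
definition "hU W Z k i = mat_app m (gd W Z) (V W k) i + mat_app m (g (PM W)) (V Z k) i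
  + \<mu> * (\<Sum>a<r. dD W Z a k * U W a i + DD W a k * U Z a i)"
definition "hV W Z k j = mat_app_t n (gd W Z) (U W k) j + mat_app_t n (g (PM W)) (U Z k) j
  - \<mu> * (\<Sum>a<r. dD W Z a k * V W a j + DD W a k * V Z a j)"
definition "hr W Z c k = (if c < n then hU W Z k c else hV W Z k (c - n))"

text \<open>Directions \<open>(X, Y)\<close> with \<open>X Y\<^sup>T = 0\<close>, such as the coordinate directions.  Along them \<open>U V\<^sup>T\<close>
  moves on a straight line, so no chain rule for \<open>f\<close> is needed.\<close>

definition "adm Z \<longleftrightarrow> Z \<in> factors \<and> (\<forall>i<n. \<forall>j<m. (\<Sum>k<r. U Z k i * V Z k j) = 0)"

lemma PM_carrier [simp]: "PM W \<in> carrier_mat n m" "KK W Z \<in> carrier_mat n m"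
  by (simp_all add: PM_def KK_def)

lemma DD_sym: "DD W a b = DD W b a" by (simp add: DD_def sdot_commute)
lemma dD_sym: "dD W Z a b = dD W Z b a" by (simp add: dD_def sdot_commute)

lemma U_line:
  assumes "W \<in> factors" "Z \<in> factors"
  shows "U (W + t \<cdot>\<^sub>m Z) k = (\<lambda>i. U W k i + t * U Z k i)"
    and "V (W + t \<cdot>\<^sub>m Z) k = (\<lambda>i. V W k i + t * V Z k i)"
  using assms by (auto simp: U_def V_def)

text \<open>A coordinate matrix meets only one of the two blocks, so one factor of X Y^T is
  zero.\<close>

lemma adm_unit:
  assumes "c < n + m" "k < r"
  shows "adm (unit_mat (n + m) r (c, k))"
  unfolding adm_def using assms
  by (auto simp: U_def V_def unit_mat_def intro!: sum.neutral)

lemma PM_line: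
  assumes W: "W \<in> factors" and Z: "adm Z"
  shows "PM (W + t \<cdot>\<^sub>m Z) = PM W + t \<cdot>\<^sub>m KK W Z"
proof (rule eq_matI)
  have Zc: "Z \<in> factors" using Z by (simp add: adm_def)
  fix i j assume "i < dim_row (PM W + t \<cdot>\<^sub>m KK W Z)" "j < dim_col (PM W + t \<cdot>\<^sub>m KK W Z)"
  then have ij: "i < n" "j < m" by (auto simp: KK_def)
  have "PM (W + t \<cdot>\<^sub>m Z) $$ (i, j) = (\<Sum>k<r. (U W k i + t * U Z k i) * (V W k j + t * V Z k j))"
    using ij by (simp add: PM_def U_line[OF W Zc])
  also have "\<dots> = (\<Sum>k<r. U W k i * V W k j) + t * (\<Sum>k<r. U Z k i * V W k j + U W k i * V Z k j)
      + t\<^sup>2 * (\<Sum>k<r. U Z k i * V Z k j)"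
    by (simp add: sum.distrib sum_distrib_left power2_eq_square algebra_simps)
  also have "(\<Sum>k<r. U Z k i * V Z k j) = 0" using Z ij by (simp add: adm_def)
  finally show "PM (W + t \<cdot>\<^sub>m Z) $$ (i, j) = (PM W + t \<cdot>\<^sub>m KK W Z) $$ (i, j)"
    using ij by (simp add: PM_def KK_def)
qed (simp_all add: PM_def KK_def)

lemma DD_line:
  assumes W: "W \<in> factors" and Z: "Z \<in> factors"
  shows "DD (W + t \<cdot>\<^sub>m Z) a b = DD W a b + t * dD W Z a b + t\<^sup>2 * DD Z a b"
  unfolding DD_def U_line[OF W Z] sdot_simps dD_def by (simp add: power2_eq_square algebra_simps)

lemma rho_eq:
  assumes W: "W \<in> factors"
  shows "\<rho> W = f (PM W) + \<mu> / 4 * (\<Sum>a<r. \<Sum>b<r. (DD W a b)\<^sup>2)"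
proof -
  let ?U = "upper_block n r W" and ?V = "lower_block n m r W"
  have carr: "?U \<in> carrier_mat n r" "?V \<in> carrier_mat m r"
    by (simp_all add: upper_block_def lower_block_def)
  have P: "?U * transpose_mat ?V = PM W"
    using W by (intro eq_matI)
      (auto simp: PM_def U_def V_def upper_block_def lower_block_def scalar_prod_def atLeast0LessThan)
  have D: "(transpose_mat ?U * ?U - transpose_mat ?V * ?V) $$ (a, b) = DD W a b" if "a < r" "b < r" for a b
    using that by (simp add: DD_def U_def V_def sdot_def upper_block_def lower_block_def scalar_prod_def
        atLeast0LessThan)
  have "(fro_norm (transpose_mat ?U * ?U - transpose_mat ?V * ?V))\<^sup>2 = (\<Sum>a<r. \<Sum>b<r. (DD W a b)\<^sup>2)"
    using carr D by (subst fro_norm_sq[of _ r r]) auto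
  then show ?thesis by (simp add: rho_stacked_def rho_def P)
qed

lemma g_line:
  assumes "X \<in> carrier_mat n m" "K \<in> carrier_mat n m"
  shows "((\<lambda>t. f (X + t \<cdot>\<^sub>m K)) has_real_derivative
      (\<Sum>i<n. \<Sum>j<m. g (X + t \<cdot>\<^sub>m K) i j * K $$ (i, j))) (at t)"
    and "i < n \<Longrightarrow> j < m \<Longrightarrow> ((\<lambda>t. g (X + t \<cdot>\<^sub>m K) i j) has_real_derivative
      (\<Sum>k<n. \<Sum>l<m. H (X + t \<cdot>\<^sub>m K) i j k l * K $$ (k, l))) (at t)"
  unfolding g_def H_def
  by (intro line_derivative twice_cont_diffD[OF tcd] assms; assumption)+

lemma line_0: "X \<in> carrier_mat p q \<Longrightarrow> K \<in> carrier_mat p q \<Longrightarrow> X + 0 \<cdot>\<^sub>m K = (X :: real mat)"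
  by (intro eq_matI) auto

lemma PM_0: "PM W + 0 \<cdot>\<^sub>m KK W Z = PM W"
  by (rule line_0[OF PM_carrier])

lemma rho_line_derivative:
  assumes W: "W \<in> factors" and Z: "adm Z"
  shows "((\<lambda>t. \<rho> (W + t \<cdot>\<^sub>m Z)) has_real_derivative
    (\<Sum>k<r. sdot n (U Z k) (gU W k) + sdot m (V Z k) (gV W k))) (at 0)"
proof -
  have Zc: "Z \<in> factors" using Z by (simp add: adm_def)
  have eq: "\<rho> (W + t \<cdot>\<^sub>m Z) = f (PM W + t \<cdot>\<^sub>m KK W Z)
      + \<mu> / 4 * (\<Sum>a<r. \<Sum>b<r. (DD W a b + t * dD W Z a b + t\<^sup>2 * DD Z a b)\<^sup>2)" for t
    using W Zc by (simp add: rho_eq PM_line[OF W Z] DD_line)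
  have 1: "((\<lambda>t. f (PM W + t \<cdot>\<^sub>m KK W Z)) has_real_derivative
      (\<Sum>i<n. \<Sum>j<m. g (PM W) i j * KK W Z $$ (i, j))) (at 0)"
    using g_line(1)[of "PM W" "KK W Z" 0] unfolding PM_0 by simp
  have 2: "((\<lambda>t. (DD W a b + t * dD W Z a b + t\<^sup>2 * DD Z a b)\<^sup>2) has_real_derivative
     2 * (DD W a b * dD W Z a b)) (at 0)" for a b
    by (auto intro!: derivative_eq_intros)
  have "((\<lambda>t. \<rho> (W + t \<cdot>\<^sub>m Z)) has_real_derivative (\<Sum>i<n. \<Sum>j<m. g (PM W) i j * KK W Z $$ (i, j))
     + \<mu> / 4 * (\<Sum>a<r. \<Sum>b<r. 2 * (DD W a b * dD W Z a b))) (at 0)"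
    unfolding eq by (intro DERIV_add 1 DERIV_cmult DERIV_sum 2)
  also have "(\<Sum>i<n. \<Sum>j<m. g (PM W) i j * KK W Z $$ (i, j)) + \<mu> / 4 * (\<Sum>a<r. \<Sum>b<r. 2 * (DD W a b * dD W Z a b))
     = (\<Sum>k<r. sdot n (U Z k) (mat_app m (g (PM W)) (V W k)) + sdot m (V Z k) (mat_app_t n (g (PM W)) (U W k)))
      + \<mu> * (\<Sum>k<r. sdot n (U Z k) (\<lambda>i. \<Sum>a<r. DD W a k * U W a i) - sdot m (V Z k) (\<lambda>j. \<Sum>a<r. DD W a k * V W a j))"
    unfolding pairing_outer pairing_symmetric[of "DD W", OF DD_sym] dD_def[symmetric]
    by (simp add: KK_def sum_distrib_left[symmetric])
  also have "\<dots> = (\<Sum>k<r. sdot n (U Z k) (gU W k) + sdot m (V Z k) (gV W k))"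
  proof -
    have "gU W k = (\<lambda>i. mat_app m (g (PM W)) (V W k) i + \<mu> * (\<Sum>a<r. DD W a k * U W a i))"
      "gV W k = (\<lambda>j. mat_app_t n (g (PM W)) (U W k) j - \<mu> * (\<Sum>a<r. DD W a k * V W a j))" for k
      by (simp_all add: gU_def gV_def)
    then have "sdot n (U Z k) (gU W k) = sdot n (U Z k) (mat_app m (g (PM W)) (V W k))
          + \<mu> * sdot n (U Z k) (\<lambda>i. \<Sum>a<r. DD W a k * U W a i)"
      "sdot m (V Z k) (gV W k) = sdot m (V Z k) (mat_app_t n (g (PM W)) (U W k))
          - \<mu> * sdot m (V Z k) (\<lambda>j. \<Sum>a<r. DD W a k * V W a j)" for k
      by (simp_all only: sdot_add_right sdot_diff_right sdot_scale_right)
    then show ?thesis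
      by (simp add: sum.distrib sum_subtractf sum_distrib_left right_diff_distrib)
  qed
  finally show ?thesis .
qed

lemma sum_stack:
  assumes Z: "Z \<in> factors"
  shows "(\<Sum>c<n + m. \<Sum>k<r. Z $$ (c, k) * F c k) = (\<Sum>k<r. sdot n (U Z k) (\<lambda>i. F i k) + sdot m (V Z k) (\<lambda>j. F (n + j) k))"
proof -
  have "(\<Sum>c<n + m. \<Sum>k<r. Z $$ (c, k) * F c k) = (\<Sum>k<r. \<Sum>c<n + m. Z $$ (c, k) * F c k)"
    by (rule sum.swap)
  also have "\<dots> = (\<Sum>k<r. sdot n (U Z k) (\<lambda>i. F i k) + sdot m (V Z k) (\<lambda>j. F (n + j) k))"
    unfolding sum_lessThan_add sdot_def by (intro sum.cong arg_cong2[where f = plus] refl) (auto simp: U_def V_def)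
  finally show ?thesis .
qed

lemma sum_stack_gr:
  assumes "Z \<in> factors"
  shows "(\<Sum>c<n + m. \<Sum>k<r. Z $$ (c, k) * gr W c k) = (\<Sum>k<r. sdot n (U Z k) (gU W k) + sdot m (V Z k) (gV W k))"
    and "(\<Sum>c<n + m. \<Sum>k<r. Z $$ (c, k) * hr W Y c k) = (\<Sum>k<r. sdot n (U Z k) (hU W Y k) + sdot m (V Z k) (hV W Y k))"
  unfolding sum_stack[OF assms]
  by (intro sum.cong arg_cong2[where f = plus] sdot_cong refl; simp add: gr_def hr_def)+

lemma sum_unit_stack:
  assumes "c < n + m" "k < r"
  shows "(\<Sum>c'<n + m. \<Sum>k'<r. unit_mat (n + m) r (c, k) $$ (c', k') * F c' k') = F c k"
  using sum_unit_mat[OF assms, of F] by (simp add: mult.commute)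

lemma partial_deriv_rho:
  assumes W: "W \<in> factors" and ck: "c < n + m" "k < r"
  shows "partial_deriv (n + m) r (c, k) \<rho> W = gr W c k"
proof -
  let ?Z = "unit_mat (n + m) r (c, k)"
  have "(\<Sum>k'<r. sdot n (U ?Z k') (gU W k') + sdot m (V ?Z k') (gV W k')) = gr W c k"
    unfolding sum_stack_gr(1)[OF unit_mat_carrier, symmetric] by (rule sum_unit_stack[OF ck])
  then show ?thesis
    using rho_line_derivative[OF W adm_unit[OF ck]]
    unfolding partial_deriv_def by (simp add: DERIV_imp_deriv)
qed

text \<open>The common shape of an entry of either gradient block along a line: gradient entries of
  f times a moving factor, plus the quadratically moving imbalance times a moving factor.\<close>

lemma bilinear_line_derivative:
  fixes p q s s' d d' d'' :: "nat \<Rightarrow> real"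
  assumes "\<And>j. j < N \<Longrightarrow> (G j has_real_derivative G' j) (at 0)"
  shows "((\<lambda>t. (\<Sum>j<N. G j t * (p j + t * q j))
      + c * (\<Sum>a<r. (d a + t * d' a + t\<^sup>2 * d'' a) * (s a + t * s' a))) has_real_derivative
    (\<Sum>j<N. G' j * p j) + (\<Sum>j<N. G j 0 * q j) + c * (\<Sum>a<r. d' a * s a + d a * s' a)) (at 0)"
proof -
  have 2: "((\<lambda>t. x + t * y + t\<^sup>2 * z) has_real_derivative y) (at 0)"
    and 3: "((\<lambda>t. x + t * y) has_real_derivative y) (at 0)" for x y z :: real
    by (auto intro!: derivative_eq_intros)
  have "((\<lambda>t. (\<Sum>j<N. G j t * (p j + t * q j))
      + c * (\<Sum>a<r. (d a + t * d' a + t\<^sup>2 * d'' a) * (s a + t * s' a))) has_real_derivative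
    (\<Sum>j<N. G' j * (p j + 0 * q j) + q j * G j 0)
      + c * (\<Sum>a<r. d' a * (s a + 0 * s' a) + s' a * (d a + 0 * d' a + 0\<^sup>2 * d'' a))) (at 0)"
    using assms by (intro DERIV_add DERIV_cmult DERIV_sum DERIV_mult 2 3) auto
  then show ?thesis by (simp add: sum.distrib mult.commute)
qed

lemma gr_line_derivative:
  assumes W: "W \<in> factors" and Z: "adm Z" and ck: "c < n + m" "k < r"
  shows "((\<lambda>t. gr (W + t \<cdot>\<^sub>m Z) c k) has_real_derivative hr W Z c k) (at 0)"
proof -
  have Zc: "Z \<in> factors" using Z by (simp add: adm_def)
  have 1: "((\<lambda>t. g (PM W + t \<cdot>\<^sub>m KK W Z) i j) has_real_derivative gd W Z i j) (at 0)" if "i < n" "j < m" for i j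
    using g_line(2)[of "PM W" "KK W Z" i j 0] that unfolding PM_0 gd_def by simp
  note lines = PM_line[OF W Z] DD_line[OF W Zc] U_line[OF W Zc]
  show ?thesis
  proof (cases "c < n")
    case True
    show ?thesis
      using bilinear_line_derivative[of m "\<lambda>j t. g (PM W + t \<cdot>\<^sub>m KK W Z) c j", OF 1[OF True],
          of "V W k" "V Z k" \<mu> "\<lambda>a. DD W a k" "\<lambda>a. dD W Z a k" "\<lambda>a. DD Z a k" "\<lambda>a. U W a c" "\<lambda>a. U Z a c"]
        True by (simp add: gr_def gU_def hr_def hU_def mat_app_def lines PM_0)
  next
    case False
    then have "c - n < m" using ck by simp
    then show ?thesis
      using bilinear_line_derivative[of n "\<lambda>i t. g (PM W + t \<cdot>\<^sub>m KK W Z) i (c - n)", OF 1,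
          of "U W k" "U Z k" "- \<mu>" "\<lambda>a. DD W a k" "\<lambda>a. dD W Z a k" "\<lambda>a. DD Z a k" "\<lambda>a. V W a (c - n)" "\<lambda>a. V Z a (c - n)"]
        False by (simp add: gr_def gV_def hr_def hV_def mat_app_t_def lines PM_0)
  qed
qed

lemma partial_deriv2_rho:
  assumes W: "W \<in> factors" and ck: "c < n + m" "k < r" and ck': "c' < n + m" "k' < r"
  shows "partial_deriv (n + m) r (c', k') (partial_deriv (n + m) r (c, k) \<rho>) W
    = hr W (unit_mat (n + m) r (c', k')) c k"
proof -
  let ?Z = "unit_mat (n + m) r (c', k')"
  have "partial_deriv (n + m) r (c, k) \<rho> (W + t \<cdot>\<^sub>m ?Z) = gr (W + t \<cdot>\<^sub>m ?Z) c k" for t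
    using W ck by (intro partial_deriv_rho) auto
  then show ?thesis
    using gr_line_derivative[OF W adm_unit[OF ck'] ck]
    unfolding partial_deriv_def[of _ _ _ "partial_deriv _ _ _ _"] by (simp add: DERIV_imp_deriv)
qed

text \<open>The second derivative of the objective as a bilinear form. The lines are: the Hessian of
  f on the first-order changes of U V^T; the gradient of f on its second-order change; and for the
  regularizer the product of first derivatives and the second derivative of the imbalance.\<close>

definition "hform W Z' Z = (\<Sum>i<n. \<Sum>j<m. gd W Z i j * KK W Z' $$ (i, j))
  + (\<Sum>k<r. sdot n (U Z' k) (mat_app m (g (PM W)) (V Z k)) + sdot n (U Z k) (mat_app m (g (PM W)) (V Z' k)))
  + \<mu> / 2 * (\<Sum>a<r. \<Sum>b<r. dD W Z a b * dD W Z' a b)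
  + \<mu> * (\<Sum>a<r. \<Sum>b<r. DD W a b * (sdot n (U Z' b) (U Z a) - sdot m (V Z' b) (V Z a)))"

lemma hform_eq:
  assumes Z': "Z' \<in> factors"
  shows "(\<Sum>c<n + m. \<Sum>k<r. Z' $$ (c, k) * hr W Z c k) = hform W Z' Z"
proof -
  let ?A = "(\<Sum>k<r. sdot n (U Z' k) (mat_app m (gd W Z) (V W k)) + sdot m (V Z' k) (mat_app_t n (gd W Z) (U W k)))"
  let ?B = "(\<Sum>k<r. sdot n (U Z' k) (\<lambda>i. \<Sum>a<r. dD W Z a k * U W a i) - sdot m (V Z' k) (\<lambda>j. \<Sum>a<r. dD W Z a k * V W a j))"
  let ?C = "(\<Sum>k<r. sdot n (U Z' k) (\<lambda>i. \<Sum>a<r. DD W a k * U Z a i) - sdot m (V Z' k) (\<lambda>j. \<Sum>a<r. DD W a k * V Z a j))"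
  have hU: "hU W Z k = (\<lambda>i. (mat_app m (gd W Z) (V W k) i + mat_app m (g (PM W)) (V Z k) i)
      + \<mu> * ((\<Sum>a<r. dD W Z a k * U W a i) + (\<Sum>a<r. DD W a k * U Z a i)))"
    and hV: "hV W Z k = (\<lambda>j. (mat_app_t n (gd W Z) (U W k) j + mat_app_t n (g (PM W)) (U Z k) j)
      - \<mu> * ((\<Sum>a<r. dD W Z a k * V W a j) + (\<Sum>a<r. DD W a k * V Z a j)))" for k
    by (simp_all add: hU_def[abs_def] hV_def[abs_def] sum.distrib)
  have b: "sdot m (V Z' k) (mat_app_t n (g (PM W)) (U Z k)) = sdot n (U Z k) (mat_app m (g (PM W)) (V Z' k))" for k
    unfolding sdot_mat_app by (rule sdot_commute)
  have "(\<Sum>c<n + m. \<Sum>k<r. Z' $$ (c, k) * hr W Z c k)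
    = ?A
     + (\<Sum>k<r. sdot n (U Z' k) (mat_app m (g (PM W)) (V Z k)) + sdot n (U Z k) (mat_app m (g (PM W)) (V Z' k)))
     + \<mu> * ?B
     + \<mu> * ?C"
  proof -
    have "sdot n (U Z' k) (hU W Z k) = sdot n (U Z' k) (mat_app m (gd W Z) (V W k))
        + sdot n (U Z' k) (mat_app m (g (PM W)) (V Z k))
        + \<mu> * (sdot n (U Z' k) (\<lambda>i. \<Sum>a<r. dD W Z a k * U W a i)
          + sdot n (U Z' k) (\<lambda>i. \<Sum>a<r. DD W a k * U Z a i))"
      "sdot m (V Z' k) (hV W Z k) = sdot m (V Z' k) (mat_app_t n (gd W Z) (U W k))
        + sdot m (V Z' k) (mat_app_t n (g (PM W)) (U Z k))
        - \<mu> * (sdot m (V Z' k) (\<lambda>j. \<Sum>a<r. dD W Z a k * V W a j)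
          + sdot m (V Z' k) (\<lambda>j. \<Sum>a<r. DD W a k * V Z a j))" for k
      unfolding hU hV by (simp_all only: sdot_add_right sdot_diff_right sdot_scale_right)
    then show ?thesis
      unfolding sum_stack_gr(2)[OF Z'] b[symmetric]
      by (simp add: sum.distrib sum_subtractf sum_distrib_left[symmetric] right_diff_distrib distrib_left)
  qed
  also have "?A
     = (\<Sum>i<n. \<Sum>j<m. gd W Z i j * KK W Z' $$ (i, j))"
    unfolding pairing_outer by (simp add: KK_def)
  also have "?B
     = (\<Sum>a<r. \<Sum>b<r. dD W Z a b * dD W Z' a b) / 2"
    unfolding pairing_symmetric[of "dD W Z", OF dD_sym] dD_def[of W Z', symmetric] ..
  also have "?C
     = (\<Sum>k<r. \<Sum>a<r. DD W a k * (sdot n (U Z' k) (U Z a) - sdot m (V Z' k) (V Z a)))"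
    unfolding sdot_sum_right sdot_scale_right by (simp add: sum_subtractf right_diff_distrib)
  also have "\<dots> = (\<Sum>a<r. \<Sum>b<r. DD W a b * (sdot n (U Z' b) (U Z a) - sdot m (V Z' b) (V Z a)))"
    by (rule sum.swap)
  finally show ?thesis by (simp add: hform_def)
qed

lemma HF_sym:
  assumes X: "X \<in> carrier_mat n m"
  shows "HF X K L = HF X L K"
proof -
  let ?I = "{..<n} \<times> {..<m}"
  have pairs: "(\<Sum>i<n. \<Sum>j<m. F i j) = (\<Sum>p\<in>?I. F (fst p) (snd p))" for F :: "nat \<Rightarrow> nat \<Rightarrow> real"
    by (simp add: sum.cartesian_product case_prod_beta)
  have e: "HF X K L = (\<Sum>p\<in>?I. \<Sum>q\<in>?I. K $$ (fst p, snd p) * (H X (fst p) (snd p) (fst q) (snd q) * L $$ (fst q, snd q)))" for K L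
    unfolding HF_def pairs sum_distrib_left ..
  have "HF X K L = (\<Sum>q\<in>?I. \<Sum>p\<in>?I. K $$ (fst p, snd p) * (H X (fst p) (snd p) (fst q) (snd q) * L $$ (fst q, snd q)))"
    unfolding e by (rule sum.swap)
  also have "\<dots> = (\<Sum>q\<in>?I. \<Sum>p\<in>?I. L $$ (fst q, snd q) * (H X (fst q) (snd q) (fst p) (snd p) * K $$ (fst p, snd p)))"
  proof (rule sum.cong[OF refl], rule sum.cong[OF refl])
    fix p q assume "q \<in> ?I" "p \<in> ?I"
    then have "H X (fst p) (snd p) (fst q) (snd q) = H X (fst q) (snd q) (fst p) (snd p)"
      unfolding H_def by (intro partial_deriv_commute[OF tcd X]) auto
    then show "K $$ (fst p, snd p) * (H X (fst p) (snd p) (fst q) (snd q) * L $$ (fst q, snd q))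
      = L $$ (fst q, snd q) * (H X (fst q) (snd q) (fst p) (snd p) * K $$ (fst p, snd p))" by simp
  qed
  finally show ?thesis unfolding e .
qed

lemma gd_pairing:
  "(\<Sum>i<n. \<Sum>j<m. gd W Z i j * KK W Z' $$ (i, j)) = HF (PM W) (KK W Z') (KK W Z)"
  by (simp add: HF_def gd_def mult.commute)

lemma hform_sym: "hform W Z' Z = hform W Z Z'"
proof -
  have "(\<Sum>a<r. \<Sum>b<r. DD W a b * (sdot n (U Z' b) (U Z a) - sdot m (V Z' b) (V Z a)))
    = (\<Sum>b<r. \<Sum>a<r. DD W a b * (sdot n (U Z' b) (U Z a) - sdot m (V Z' b) (V Z a)))"
    by (rule sum.swap)
  also have "\<dots> = (\<Sum>a<r. \<Sum>b<r. DD W a b * (sdot n (U Z b) (U Z' a) - sdot m (V Z b) (V Z' a)))"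
    by (intro sum.cong refl arg_cong2[where f = times] arg_cong2[where f = minus] DD_sym sdot_commute)
  finally show ?thesis
    unfolding hform_def gd_pairing HF_sym[OF PM_carrier(1), of W "KK W Z'"] by (simp add: mult.commute add.commute)
qed

lemma hr_unit_commute:
  assumes "c < n + m" "k < r" "c' < n + m" "k' < r"
  shows "hr W (unit_mat (n + m) r (c', k')) c k = hr W (unit_mat (n + m) r (c, k)) c' k'"
proof -
  have "hr W (unit_mat (n + m) r (c', k')) c k = hform W (unit_mat (n + m) r (c, k)) (unit_mat (n + m) r (c', k'))"
    unfolding hform_eq[OF unit_mat_carrier, symmetric] by (rule sum_unit_stack[OF assms(1,2), symmetric])
  also have "\<dots> = hform W (unit_mat (n + m) r (c', k')) (unit_mat (n + m) r (c, k))"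
    by (rule hform_sym)
  also have "\<dots> = hr W (unit_mat (n + m) r (c, k)) c' k'"
    unfolding hform_eq[OF unit_mat_carrier, symmetric] by (rule sum_unit_stack[OF assms(3,4)])
  finally show ?thesis .
qed

text \<open>Linearity in the direction comes for free from the symmetry of \<open>hform\<close>.\<close>

lemma hr_linear:
  assumes "c < n + m" "k < r" and Z: "Z \<in> factors"
  shows "(\<Sum>c'<n + m. \<Sum>k'<r. Z $$ (c', k') * hr W (unit_mat (n + m) r (c', k')) c k) = hr W Z c k"
proof -
  have "(\<Sum>c'<n + m. \<Sum>k'<r. Z $$ (c', k') * hr W (unit_mat (n + m) r (c', k')) c k)
    = (\<Sum>c'<n + m. \<Sum>k'<r. Z $$ (c', k') * hr W (unit_mat (n + m) r (c, k)) c' k')"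
    using assms(1,2) by (intro sum.cong refl arg_cong2[where f = times] hr_unit_commute) auto
  also have "\<dots> = hform W (unit_mat (n + m) r (c, k)) Z"
    unfolding hform_eq[OF Z] by (rule hform_sym)
  also have "\<dots> = hr W Z c k"
    unfolding hform_eq[OF unit_mat_carrier, symmetric] by (rule sum_unit_stack[OF assms(1,2)])
  finally show ?thesis .
qed

section \<open>Gradient norm and least eigenvalue in terms of columns\<close>

lemma gradient_norm:
  assumes W: "W \<in> factors"
  shows "(fro_norm (gradient (n + m) r \<rho> W))\<^sup>2 = (\<Sum>k<r. sqnorm n (gU W k) + sqnorm m (gV W k))"
proof -
  define Z where "Z = gradient (n + m) r \<rho> W"
  have Z: "Z \<in> factors" by (simp add: Z_def gradient_def)
  have Zi: "Z $$ (c, k) = gr W c k" if "c < n + m" "k < r" for c k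
    using that by (simp add: Z_def gradient_def partial_deriv_rho[OF W])
  have "(fro_norm Z)\<^sup>2 = (\<Sum>c<n + m. \<Sum>k<r. Z $$ (c, k) * gr W c k)"
    unfolding fro_norm_sq[OF Z] by (simp add: Zi power2_eq_square)
  also have "\<dots> = (\<Sum>k<r. sdot n (U Z k) (gU W k) + sdot m (V Z k) (gV W k))"
    by (rule sum_stack_gr(1)[OF Z])
  also have "\<dots> = (\<Sum>k<r. sqnorm n (gU W k) + sqnorm m (gV W k))"
    by (intro sum.cong arg_cong2[where f = plus] sdot_cong refl) (auto simp: U_def V_def Zi gr_def)
  finally show ?thesis by (simp add: Z_def)
qed

lemma lambda_min_hform:
  assumes W: "W \<in> factors" and Z: "Z \<in> factors"
    and pos: "0 < n + m" "0 < r"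
  shows "lambda_min (hessian (n + m) r \<rho> W) * (\<Sum>k<r. sqnorm n (U Z k) + sqnorm m (V Z k))
    \<le> hform W Z Z"
proof -
  let ?N = "(n + m) * r"
  let ?A = "hessian (n + m) r \<rho> W"
  define h where "h c k c' k' = hr W (unit_mat (n + m) r (c', k')) c k" for c k c' k'
  have A: "?A \<in> carrier_mat ?N ?N" by (simp add: hessian_def)
  have dm: "a div r < n + m" "a mod r < r" if "a < ?N" for a
    using that pos by (simp_all add: less_mult_imp_div_less)
  have Ai: "?A $$ (a, b) = h (a div r) (a mod r) (b div r) (b mod r)" if "a < ?N" "b < ?N" for a b
    using that dm[OF that(1)] dm[OF that(2)] by (simp add: hessian_def partial_deriv2_rho[OF W] h_def)
  define z where "z a = Z $$ (a div r, a mod r)" for a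
  have sym: "?A $$ (a, b) = ?A $$ (b, a)" if "a < ?N" "b < ?N" for a b
    using that dm[OF that(1)] dm[OF that(2)] by (simp add: Ai h_def hr_unit_commute)
  have Ray: "lambda_min ?A * sqnorm ?N z \<le> sdot ?N z (mat_app ?N (\<lambda>i j. ?A $$ (i, j)) z)"
    by (rule lambda_min_Rayleigh[OF A sym]) (use pos in auto)
  have zz: "sqnorm ?N z = (\<Sum>k<r. sqnorm n (U Z k) + sqnorm m (V Z k))"
  proof -
    have "sqnorm ?N z = (\<Sum>c<n + m. \<Sum>k<r. Z $$ (c, k) * Z $$ (c, k))"
      unfolding sdot_def z_def by (rule sum_div_mod)
    also have "\<dots> = (\<Sum>k<r. sdot n (U Z k) (\<lambda>i. Z $$ (i, k)) + sdot m (V Z k) (\<lambda>j. Z $$ (n + j, k)))"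
      by (rule sum_stack[OF Z])
    also have "\<dots> = (\<Sum>k<r. sqnorm n (U Z k) + sqnorm m (V Z k))"
      by (intro sum.cong arg_cong2[where f = plus] sdot_cong refl) (auto simp: U_def V_def)
    finally show ?thesis .
  qed
  have "mat_app ?N (\<lambda>i j. ?A $$ (i, j)) z a = hr W Z (a div r) (a mod r)" if a: "a < ?N" for a
  proof -
    have "mat_app ?N (\<lambda>i j. ?A $$ (i, j)) z a
      = (\<Sum>b<?N. Z $$ (b div r, b mod r) * h (a div r) (a mod r) (b div r) (b mod r))"
      unfolding mat_app_def z_def
    proof (rule sum.cong[OF refl])
      fix b assume "b \<in> {..<?N}"
      then have "?A $$ (a, b) = h (a div r) (a mod r) (b div r) (b mod r)" by (intro Ai a) simp
      then show "?A $$ (a, b) * Z $$ (b div r, b mod r)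
        = Z $$ (b div r, b mod r) * h (a div r) (a mod r) (b div r) (b mod r)" by simp
    qed
    also have "\<dots> = (\<Sum>c<n + m. \<Sum>k<r. Z $$ (c, k) * h (a div r) (a mod r) c k)"
      by (rule sum_div_mod)
    also have "\<dots> = hr W Z (a div r) (a mod r)"
      unfolding h_def by (rule hr_linear[OF dm[OF a] Z])
    finally show ?thesis .
  qed
  then have "sdot ?N z (mat_app ?N (\<lambda>i j. ?A $$ (i, j)) z) = (\<Sum>a<?N. Z $$ (a div r, a mod r) * hr W Z (a div r) (a mod r))"
    by (simp add: sdot_def z_def)
  also have "\<dots> = (\<Sum>c<n + m. \<Sum>k<r. Z $$ (c, k) * hr W Z c k)"
    by (rule sum_div_mod)
  also have "\<dots> = hform W Z Z" by (rule hform_eq[OF Z])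
  finally show ?thesis using Ray zz by simp
qed

end

section \<open>Consequences of the restricted isometry property\<close>

lemma sum_rotated_norms:
  assumes "orthonormal r r q"
  shows "(\<Sum>k<r. sqnorm n (rot r q u k)) = (\<Sum>k<r. sqnorm n (u k))"
proof -
  have "(\<Sum>k<r. sqnorm n (rot r q u k)) = (\<Sum>i<n. \<Sum>k<r. rot r q u k i * rot r q u k i)"
    unfolding sdot_def by (rule sum.swap)
  also have "\<dots> = (\<Sum>i<n. \<Sum>k<r. u k i * u k i)" by (simp only: rot_outer[OF assms])
  also have "\<dots> = (\<Sum>k<r. sqnorm n (u k))" unfolding sdot_def by (rule sum.swap)
  finally show ?thesis .
qed

locale low_rank_recovery = factored_objective +
  fixes \<delta> :: real and Ms :: "real mat"
  assumes r: "1 \<le> r" and rip: "RIP n m (2 * r) (2 * r) \<delta> f" and \<delta>_lt: "\<delta> < 1 / 3"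
    and Ms: "Ms \<in> carrier_mat n m" and crit: "gradient n m f Ms = 0\<^sub>m n m" and rank: "rank_mat Ms = r"
    and \<mu>_ge: "(1 - \<delta>) / 3 \<le> \<mu>" and \<mu>_lt: "\<mu> < 1 - \<delta>"
begin

lemma \<delta>: "0 \<le> \<delta>" "\<delta> < 1" using rip by (auto simp: RIP_def)

lemma \<mu>: "0 < \<mu>" "\<mu> \<le> 1" using \<mu>_ge \<mu>_lt \<delta> by auto

definition "FN K = (\<Sum>i<n. \<Sum>j<m. (K $$ (i, j))\<^sup>2)" for K :: "real mat"
definition "GP X L = (\<Sum>i<n. \<Sum>j<m. g X i j * L $$ (i, j))"

lemma hessian_form_eq:
  assumes K: "K \<in> carrier_mat n m" and L: "L \<in> carrier_mat n m"
  shows "hessian_form n m f X K L = HF X K L"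
proof -
  have "hessian_form n m f X K L = (\<Sum>a<n * m. K $$ (a div m, a mod m) *
      (\<Sum>b<n * m. H X (a div m) (a mod m) (b div m) (b mod m) * L $$ (b div m, b mod m)))"
    using K L unfolding hessian_form_def vectorize_def hessian_def
    by (simp add: scalar_prod_def atLeast0LessThan H_def)
  also have "\<dots> = (\<Sum>a<n * m. K $$ (a div m, a mod m) *
      (\<Sum>k<n. \<Sum>l<m. H X (a div m) (a mod m) k l * L $$ (k, l)))"
    by (simp only: sum_div_mod[of "\<lambda>k l. H X (_ div m) (_ mod m) k l * L $$ (k, l)"])
  also have "\<dots> = HF X K L"
    unfolding HF_def by (rule sum_div_mod)
  finally show ?thesis .
qed

lemma RIP_HF:
  assumes "X \<in> carrier_mat n m" "K \<in> carrier_mat n m" "rank_mat X \<le> 2 * r" "rank_mat K \<le> 2 * r"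
  shows "(1 - \<delta>) * FN K \<le> HF X K K" "HF X K K \<le> (1 + \<delta>) * FN K"
  using rip assms unfolding RIP_def hessian_form_eq[OF assms(2,2), symmetric] FN_def fro_norm_sq[OF assms(2), symmetric]
  by auto

lemma FN_nonneg: "0 \<le> FN K" unfolding FN_def by (intro sum_nonneg) simp

lemma HF_lincomb_right:
  assumes "\<And>i j. i < n \<Longrightarrow> j < m \<Longrightarrow> L $$ (i, j) = a * L1 $$ (i, j) + b * L2 $$ (i, j)"
  shows "HF X K L = a * HF X K L1 + b * HF X K L2"
proof -
  have "(\<Sum>k<n. \<Sum>l<m. H X i j k l * L $$ (k, l)) = a * (\<Sum>k<n. \<Sum>l<m. H X i j k l * L1 $$ (k, l))
     + b * (\<Sum>k<n. \<Sum>l<m. H X i j k l * L2 $$ (k, l))" for i j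
    using assms by (simp add: algebra_simps sum.distrib sum_distrib_left)
  then show ?thesis
    unfolding HF_def by (simp add: distrib_left sum.distrib sum_distrib_left mult.left_commute)
qed

text \<open>Stacking a factorization of the product and one of the target explains the order 2 r:
  every matrix in their span is then within reach of the isometry property.\<close>

lemma rank_comb:
  assumes X: "X \<in> carrier_mat n m"
    and eq: "\<And>i j. i < n \<Longrightarrow> j < m \<Longrightarrow> X $$ (i, j) = a * PM W $$ (i, j) + b * Ms $$ (i, j)"
  shows "rank_mat X \<le> 2 * r"
proof -
  obtain s c where sc: "\<And>i j. i < n \<Longrightarrow> j < m \<Longrightarrow> Ms $$ (i, j) = (\<Sum>k<r. s k i * c k j)"
    using rank_factorization[OF Ms] unfolding rank by blast
  define u' where "u' k i = (if k < r then a * U W k i else b * s (k - r) i)" for k i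
  define v' where "v' k j = (if k < r then V W k j else c (k - r) j)" for k j
  have "X $$ (i, j) = (\<Sum>k<r + r. u' k i * v' k j)" if "i < n" "j < m" for i j
    unfolding sum_lessThan_add using that
    by (simp add: eq sc PM_def u'_def v'_def sum_distrib_left mult.assoc)
  then have "rank_mat X \<le> r + r" by (intro rank_sum_outer_le[OF X])
  then show ?thesis by simp
qed

section \<open>The segment from the target to the current product\<close>

definition "E W = PM W - Ms"

lemma E: "E W \<in> carrier_mat n m" "i < n \<Longrightarrow> j < m \<Longrightarrow> E W $$ (i, j) = PM W $$ (i, j) - Ms $$ (i, j)"
  using Ms PM_carrier(1)[of W] by (auto simp: E_def)

definition "path W t = Ms + t \<cdot>\<^sub>m E W"

lemma path_entry:
  assumes "i < n" "j < m"
  shows "path W t $$ (i, j) = t * PM W $$ (i, j) + (1 - t) * Ms $$ (i, j)"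
  using assms carrier_matD[OF E(1)[of W]] carrier_matD[OF Ms] by (simp add: path_def E(2) algebra_simps)

lemma path: "path W t \<in> carrier_mat n m" "rank_mat (path W t) \<le> 2 * r" "path W 0 = Ms" "path W 1 = PM W"
proof -
  show c: "path W t \<in> carrier_mat n m" using Ms E(1) by (simp add: path_def)
  show "rank_mat (path W t) \<le> 2 * r"
    by (rule rank_comb[OF c path_entry])
  show "path W 0 = Ms" unfolding path_def by (rule line_0[OF Ms E(1)])
  have "path W 1 \<in> carrier_mat n m" using Ms E(1) by (simp add: path_def)
  then show "path W 1 = PM W" using carrier_matD[OF PM_carrier(1)[of W]] by (intro eq_matI) (auto simp: path_entry)
qed

lemma g_Ms: "i < n \<Longrightarrow> j < m \<Longrightarrow> g Ms i j = 0"
proof -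
  assume ij: "i < n" "j < m"
  then have "g Ms i j = gradient n m f Ms $$ (i, j)" by (simp add: g_def gradient_def)
  then show ?thesis using ij by (simp add: crit)
qed

text \<open>The gradient of f vanishes where the segment starts, so the mean value theorem leaves
  only a Hessian value on the line through M and the target.\<close>

lemma GP_path:
  assumes "0 < t"
  shows "\<exists>\<xi>. GP (path W t) L = t * HF (path W \<xi>) L (E W)"
proof -
  have "((\<lambda>t. GP (path W t) L) has_real_derivative HF (path W t) L (E W)) (at t)" for t
  proof -
    have "((\<lambda>t. GP (path W t) L) has_real_derivative
        (\<Sum>i<n. \<Sum>j<m. (\<Sum>k<n. \<Sum>l<m. H (path W t) i j k l * E W $$ (k, l)) * L $$ (i, j))) (at t)"
      unfolding GP_def path_def using Ms E(1) by (intro DERIV_sum DERIV_cmult_right g_line(2)) auto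
    then show ?thesis by (simp add: HF_def mult.commute)
  qed
  from MVT2[OF assms this] obtain \<xi> where "GP (path W t) L - GP (path W 0) L = (t - 0) * HF (path W \<xi>) L (E W)"
    by blast
  moreover have "GP (path W 0) L = 0" by (simp add: GP_def path(3) g_Ms)
  ultimately show ?thesis by auto
qed

lemma rank_E: "rank_mat (E W) \<le> 2 * r"
  by (rule rank_comb[OF E(1), of W 1 W "-1"]) (simp add: E(2))

lemma GP_E_ge: "(1 - \<delta>) * FN (E W) \<le> GP (PM W) (E W)"
proof -
  obtain \<xi> where "GP (path W 1) (E W) = 1 * HF (path W \<xi>) (E W) (E W)" using GP_path[of 1] by auto
  then show ?thesis using RIP_HF(1)[OF path(1) E(1) path(2) rank_E] by (simp add: path(4))
qed

text \<open>f need not be convex, but its Hessian is nonnegative on E at all points of this segment,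
  and its slope there starts from 0.\<close>

lemma f_ge: "f Ms \<le> f (PM W)"
proof -
  have "((\<lambda>t. f (path W t)) has_real_derivative GP (path W t) (E W)) (at t)" for t
    unfolding path_def GP_def by (rule g_line(1)[OF Ms E(1)])
  from MVT2[of 0 1, OF _ this] obtain z where z: "0 < z" "f (path W 1) - f (path W 0) = (1 - 0) * GP (path W z) (E W)"
    by auto
  obtain \<xi> where "GP (path W z) (E W) = z * HF (path W \<xi>) (E W) (E W)" using GP_path[OF z(1)] by auto
  moreover have "0 \<le> (1 - \<delta>) * FN (E W)" using \<delta> FN_nonneg by simp
  moreover have "(1 - \<delta>) * FN (E W) \<le> HF (path W \<xi>) (E W) (E W)"
    by (rule RIP_HF(1)[OF path(1) E(1) path(2) rank_E])
  ultimately have "0 \<le> GP (path W z) (E W)"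
    using z(1) by simp
  then show ?thesis using z(2) by (simp add: path(3,4))
qed

lemma FN_Ms: "FN Ms = (fro_norm Ms)\<^sup>2"
  by (simp add: FN_def fro_norm_sq[OF Ms])

text \<open>Polarization, since \<open>E + M = 2 M - M\<^sup>*\<close> and \<open>M - E = M\<^sup>*\<close> both have small rank.\<close>

lemma coercive: "(1 - \<delta>) / 2 * FN (PM W) - (fro_norm Ms)\<^sup>2 / 2 \<le> GP (PM W) (PM W)"
proof -
  obtain \<xi> where x: "GP (path W 1) (PM W) = 1 * HF (path W \<xi>) (PM W) (E W)" using GP_path[of 1] by auto
  define X where "X = path W \<xi>"
  define S where "S = PM W + E W"
  have Sc: "S \<in> carrier_mat n m" using E(1) by (simp add: S_def)
  have Si: "S $$ (i, j) = 1 * PM W $$ (i, j) + 1 * E W $$ (i, j)" if "i < n" "j < m" for i j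
    using that carrier_matD[OF E(1)[of W]] by (simp add: S_def)
  have Mi: "Ms $$ (i, j) = 1 * PM W $$ (i, j) + (-1) * E W $$ (i, j)" if "i < n" "j < m" for i j
    using that by (simp add: E(2))
  have sym: "HF X K L = HF X L K" for K L unfolding X_def by (rule HF_sym[OF path(1)])
  have "HF X S S = HF X S (PM W) + HF X S (E W)" using HF_lincomb_right[OF Si, of X S] by simp
  also have "\<dots> = HF X (PM W) (PM W) + 2 * HF X (PM W) (E W) + HF X (E W) (E W)"
    unfolding sym[of S] using HF_lincomb_right[OF Si, of X "PM W"] HF_lincomb_right[OF Si, of X "E W"] sym[of "E W" "PM W"] by simp
  finally have 1: "HF X S S = HF X (PM W) (PM W) + 2 * HF X (PM W) (E W) + HF X (E W) (E W)" .
  have "HF X Ms Ms = HF X Ms (PM W) - HF X Ms (E W)" using HF_lincomb_right[OF Mi, of X Ms] by simp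
  also have "\<dots> = HF X (PM W) (PM W) - 2 * HF X (PM W) (E W) + HF X (E W) (E W)"
    unfolding sym[of Ms] using HF_lincomb_right[OF Mi, of X "PM W"] HF_lincomb_right[OF Mi, of X "E W"] sym[of "E W" "PM W"] by simp
  finally have 2: "HF X Ms Ms = HF X (PM W) (PM W) - 2 * HF X (PM W) (E W) + HF X (E W) (E W)" .
  have "rank_mat S \<le> 2 * r"
    by (rule rank_comb[OF Sc, of 2 W "-1"]) (simp add: Si E(2))
  then have 3: "(1 - \<delta>) * FN S \<le> HF X S S"
    unfolding X_def by (intro RIP_HF path Sc)
  have "rank_mat Ms \<le> 2 * r" using rank by simp
  then have 4: "HF X Ms Ms \<le> (1 + \<delta>) * FN Ms"
    unfolding X_def by (intro RIP_HF path Ms)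
  have "2 * FN (PM W) - FN Ms \<le> FN S"
  proof -
    have "2 * (PM W $$ (i, j))\<^sup>2 - (Ms $$ (i, j))\<^sup>2 \<le> (S $$ (i, j))\<^sup>2" if "i < n" "j < m" for i j
    proof -
      define a where "a = PM W $$ (i, j)"
      define b where "b = Ms $$ (i, j)"
      have S: "S $$ (i, j) = 2 * a - b" using that by (simp add: Si E(2) a_def b_def)
      have "0 \<le> 2 * (a - b)\<^sup>2" by simp
      then show ?thesis
        unfolding S a_def[symmetric] b_def[symmetric] by (simp add: power2_eq_square algebra_simps)
    qed
    then have "(\<Sum>i<n. \<Sum>j<m. 2 * (PM W $$ (i, j))\<^sup>2 - (Ms $$ (i, j))\<^sup>2) \<le> FN S"
      unfolding FN_def by (intro sum_mono) auto
    then show ?thesis by (simp add: FN_def sum_subtractf sum_distrib_left)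
  qed
  then have "(1 - \<delta>) * (2 * FN (PM W) - FN Ms) \<le> (1 - \<delta>) * FN S"
    using \<delta> by (intro mult_left_mono) auto
  with 1 2 3 4 have "(1 - \<delta>) * (2 * FN (PM W) - FN Ms) - (1 + \<delta>) * FN Ms \<le> 4 * HF X (PM W) (E W)"
    by linarith
  moreover have "(1 - \<delta>) * (2 * FN (PM W) - FN Ms) - (1 + \<delta>) * FN Ms = 4 * ((1 - \<delta>) / 2 * FN (PM W) - FN Ms / 2)"
    by (simp add: field_simps)
  ultimately have "4 * ((1 - \<delta>) / 2 * FN (PM W) - FN Ms / 2) \<le> 4 * HF X (PM W) (E W)" by (simp only:)
  then have "(1 - \<delta>) / 2 * FN (PM W) - FN Ms / 2 \<le> HF X (PM W) (E W)"
    by (simp only: mult_le_cancel_left_pos zero_less_numeral)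
  then show ?thesis using x by (simp add: path(4) FN_Ms X_def)
qed

text \<open>The direction (x q^T, y q^T) changes U V^T to first order by x (V q)^T + (U q) y^T,
  which has rank at most 2, so the upper isometry bound applies. Its size in the factor space is
  |x|^2 + |y|^2 because q is a unit vector.\<close>

lemma second_order_direction:
  assumes W: "W \<in> factors" and q: "sqnorm r q = 1"
  defines "uq \<equiv> \<lambda>i. \<Sum>k<r. q k * U W k i" and "vq \<equiv> \<lambda>j. \<Sum>k<r. q k * V W k j"
  shows "lambda_min (hessian (n + m) r \<rho> W) * (sqnorm n x + sqnorm m y)
    \<le> (1 + \<delta>) * (sqnorm n x * sqnorm m vq + sqnorm n uq * sqnorm m y + 2 * (sdot n x uq * sdot m y vq))
      + 2 * sdot m (mat_app_t n (g (PM W)) x) y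
      + 2 * \<mu> * (\<Sum>k<r. (sdot n (U W k) x - sdot m (V W k) y)\<^sup>2)
      + \<mu> * (sqnorm n uq - sqnorm m vq) * (sqnorm n x - sqnorm m y)"
proof -
  define Z where "Z = mat (n + m) r (\<lambda>(c, k). if c < n then x c * q k else y (c - n) * q k)"
  have Z: "Z \<in> factors" by (simp add: Z_def)
  have UZ: "sdot n (U Z a) w = q a * sdot n x w" "sdot n w (U Z a) = q a * sdot n w x"
    and VZ: "sdot m (V Z a) w = q a * sdot m y w" "sdot m w (V Z a) = q a * sdot m w y" if "a < r" for a w
    using that by (simp_all add: sdot_def U_def V_def Z_def sum_distrib_left ac_simps)
  have qq: "(\<Sum>k<r. q k * (q k * c)) = c" for c
  proof -
    have "(\<Sum>k<r. q k * (q k * c)) = sqnorm r q * c" by (simp add: sdot_def sum_distrib_right mult.assoc)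
    then show ?thesis using q by simp
  qed
  have norm: "(\<Sum>k<r. sqnorm n (U Z k) + sqnorm m (V Z k)) = sqnorm n x + sqnorm m y"
    using UZ VZ by (simp add: sum.distrib qq)
  have Kij: "KK W Z $$ (i, j) = x i * vq j + uq i * y j" if "i < n" "j < m" for i j
  proof -
    have "U Z k i = x i * q k" "V Z k j = y j * q k" if "k < r" for k
      using \<open>i < n\<close> \<open>j < m\<close> that by (simp_all add: U_def V_def Z_def)
    then show ?thesis
      using that by (simp add: KK_def uq_def vq_def sum.distrib sum_distrib_left sum_distrib_right ac_simps)
  qed
  have FNK: "FN (KK W Z) = sqnorm n x * sqnorm m vq + sqnorm n uq * sqnorm m y + 2 * (sdot n x uq * sdot m y vq)"
  proof -
    have "FN (KK W Z) = (\<Sum>i<n. \<Sum>j<m. (x i * x i) * (vq j * vq j) + (uq i * uq i) * (y j * y j) + 2 * ((x i * uq i) * (y j * vq j)))"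
      unfolding FN_def by (intro sum.cong refl) (simp add: Kij power2_eq_square algebra_simps)
    also have "\<dots> = (\<Sum>i<n. \<Sum>j<m. (x i * x i) * (vq j * vq j)) + (\<Sum>i<n. \<Sum>j<m. (uq i * uq i) * (y j * y j))
       + 2 * (\<Sum>i<n. \<Sum>j<m. (x i * uq i) * (y j * vq j))"
      by (simp only: sum.distrib sum_distrib_left)
    finally show ?thesis by (simp add: sdot_def sum_product)
  qed
  have rM: "rank_mat (PM W) \<le> 2 * r"
    by (rule rank_comb[of _ 1 W 0]) simp_all
  have rK: "rank_mat (KK W Z) \<le> 2 * r"
  proof -
    have "rank_mat (KK W Z) \<le> Suc (Suc 0)"
    proof (rule rank_sum_outer_le[OF PM_carrier(2)])
      fix i j assume "i < n" "j < m"
      then show "KK W Z $$ (i, j) = (\<Sum>k<Suc (Suc 0). (if k = 0 then x else uq) i * (if k = 0 then vq else y) j)"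
        by (simp add: Kij)
    qed
    then show ?thesis using r by simp
  qed
  have t1: "(\<Sum>i<n. \<Sum>j<m. gd W Z i j * KK W Z $$ (i, j)) \<le> (1 + \<delta>) * FN (KK W Z)"
    unfolding gd_pairing by (rule RIP_HF(2)[OF PM_carrier rM rK])
  have t2: "(\<Sum>k<r. sdot n (U Z k) (mat_app m (g (PM W)) (V Z k)) + sdot n (U Z k) (mat_app m (g (PM W)) (V Z k)))
      = 2 * sdot m (mat_app_t n (g (PM W)) x) y"
  proof -
    have "sdot n (U Z k) (mat_app m (g (PM W)) (V Z k)) = q k * (q k * sdot m (mat_app_t n (g (PM W)) x) y)" if "k < r" for k
    proof -
      have "sdot n (U Z k) (mat_app m (g (PM W)) (V Z k)) = q k * sdot m (mat_app_t n (g (PM W)) x) (V Z k)"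
        unfolding sdot_mat_app[of n x, symmetric] by (rule UZ(1)[OF that])
      then show ?thesis using VZ(2)[OF that] by simp
    qed
    then have "(\<Sum>k<r. sdot n (U Z k) (mat_app m (g (PM W)) (V Z k))) = sdot m (mat_app_t n (g (PM W)) x) y"
      by (simp add: qq)
    then show ?thesis by (simp only: sum.distrib)
  qed
  define w where "w k = sdot n (U W k) x - sdot m (V W k) y" for k
  have dDw: "dD W Z a b = q b * w a + q a * w b" if "a < r" "b < r" for a b
  proof -
    have "sdot n x (U W b) = sdot n (U W b) x" "sdot m y (V W b) = sdot m (V W b) y"
      by (rule sdot_commute)+
    then show ?thesis using UZ VZ that by (simp add: dD_def w_def algebra_simps)
  qed
  \<comment> \<open>The derivative of the imbalance is w q^T + q w^T; its squared norm is at most 4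
    |w|^2 for a unit vector q.\<close>
  have t3: "(\<Sum>a<r. \<Sum>b<r. dD W Z a b * dD W Z a b) \<le> 4 * (\<Sum>k<r. (w k)\<^sup>2)"
  proof -
    have "(\<Sum>a<r. \<Sum>b<r. dD W Z a b * dD W Z a b) \<le> (\<Sum>a<r. \<Sum>b<r. 2 * (q b * (q b * (w a)\<^sup>2)) + 2 * (q a * (q a * (w b)\<^sup>2)))"
    proof (intro sum_mono)
      fix a b assume "a \<in> {..<r}" "b \<in> {..<r}"
      moreover have "0 \<le> (q b * w a - q a * w b)\<^sup>2" by simp
      ultimately show "dD W Z a b * dD W Z a b \<le> 2 * (q b * (q b * (w a)\<^sup>2)) + 2 * (q a * (q a * (w b)\<^sup>2))"
        by (simp add: dDw power2_eq_square algebra_simps)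
    qed
    also have "\<dots> = 2 * (\<Sum>a<r. \<Sum>b<r. q b * (q b * (w a)\<^sup>2)) + 2 * (\<Sum>a<r. \<Sum>b<r. q a * (q a * (w b)\<^sup>2))"
      by (simp only: sum.distrib sum_distrib_left)
    also have "(\<Sum>a<r. \<Sum>b<r. q a * (q a * (w b)\<^sup>2)) = (\<Sum>b<r. \<Sum>a<r. q a * (q a * (w b)\<^sup>2))"
      by (rule sum.swap)
    finally show ?thesis by (simp add: qq)
  qed
  have t4: "(\<Sum>a<r. \<Sum>b<r. DD W a b * (sdot n (U Z b) (U Z a) - sdot m (V Z b) (V Z a)))
     = (sqnorm n uq - sqnorm m vq) * (sqnorm n x - sqnorm m y)"
  proof -
    have "(\<Sum>a<r. \<Sum>b<r. DD W a b * (sdot n (U Z b) (U Z a) - sdot m (V Z b) (V Z a)))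
      = (\<Sum>a<r. \<Sum>b<r. (q a * (q b * DD W a b)) * (sqnorm n x - sqnorm m y))"
      using UZ VZ by (intro sum.cong refl) (simp add: algebra_simps)
    also have "\<dots> = (\<Sum>a<r. q a * (\<Sum>b<r. q b * DD W a b)) * (sqnorm n x - sqnorm m y)"
      by (simp add: sum_distrib_right sum_distrib_left mult.assoc)
    also have "(\<Sum>a<r. q a * (\<Sum>b<r. q b * DD W a b)) = sqnorm n uq - sqnorm m vq"
    proof -
      \<comment> \<open>A constant family of coefficient vectors turns \<open>sdot_rot\<close> into
        the expansion of one squared norm; its row index is then arbitrary.\<close>
      have "sqnorm n uq = (\<Sum>a<r. q a * (\<Sum>b<r. q b * sdot n (U W a) (U W b)))"
        unfolding uq_def using sdot_rot[of n r "\<lambda>_. q" "U W" undefined "U W" undefined] by (simp add: rot_def)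
      moreover have "sqnorm m vq = (\<Sum>a<r. q a * (\<Sum>b<r. q b * sdot m (V W a) (V W b)))"
        unfolding vq_def using sdot_rot[of m r "\<lambda>_. q" "V W" undefined "V W" undefined] by (simp add: rot_def)
      ultimately show ?thesis by (simp add: DD_def right_diff_distrib sum_subtractf)
    qed
    finally show ?thesis .
  qed
  have t3': "\<mu> / 2 * (\<Sum>a<r. \<Sum>b<r. dD W Z a b * dD W Z a b) \<le> 2 * \<mu> * (\<Sum>k<r. (w k)\<^sup>2)"
    using mult_left_mono[OF t3, of "\<mu> / 2"] \<mu> by simp
  have "lambda_min (hessian (n + m) r \<rho> W) * (sqnorm n x + sqnorm m y) \<le> hform W Z Z"
  proof -
    have "0 < m" using vec_space.rank_le_nc[OF Ms] rank r Ms by auto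
    then show ?thesis using lambda_min_hform[OF W Z] r unfolding norm by simp
  qed
  also have "\<dots> \<le> (1 + \<delta>) * FN (KK W Z) + 2 * sdot m (mat_app_t n (g (PM W)) x) y
      + 2 * \<mu> * (\<Sum>k<r. (w k)\<^sup>2) + \<mu> * ((sqnorm n uq - sqnorm m vq) * (sqnorm n x - sqnorm m y))"
    unfolding hform_def t2 t4 by (intro add_mono t1 t3' order_refl)
  finally show ?thesis unfolding FNK w_def by (simp only: mult.assoc)
qed

end

section \<open>The strict saddle property\<close>

text \<open>The fourth power of the distance will be at most 2 r (|D|^2 + 4 |E|^2), where |D|^2
  \<le> \<eta> and |E|^2 is at most 2 \<eta> / (1 - 3 \<delta>) times \<open>err_const\<close>;
  solving for \<eta> gives this formula.\<close>

definition eta_bound :: "real \<Rightarrow> nat \<Rightarrow> real \<Rightarrow> real \<Rightarrow> real \<Rightarrow> real" where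
  "eta_bound \<delta> r \<mu> F \<alpha> =
    min 1 (\<alpha> ^ 4 / (2 * r * (1 + 8 * err_const r (radius r \<mu> F) F / (1 - 3 * \<delta>))))"

definition omega_bound :: "real \<Rightarrow> nat \<Rightarrow> real \<Rightarrow> real \<Rightarrow> real \<Rightarrow> real" where
  "omega_bound \<delta> r \<mu> F \<alpha> = (eta_bound \<delta> r \<mu> F \<alpha>) ^ 3 / 3"

text \<open>\<omega> / (2 r) serves the bounds on G V and G^T U after a rotation, and \<mu>
  \<omega>^2 / R turns \<open>D_le\<close> into |D| \<le> \<omega>.\<close>

definition beta_bound :: "real \<Rightarrow> nat \<Rightarrow> real \<Rightarrow> real \<Rightarrow> real \<Rightarrow> real" where
  "beta_bound \<delta> r \<mu> F \<alpha> = min 1 (min (omega_bound \<delta> r \<mu> F \<alpha> / (2 * r))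
     (\<mu> * (omega_bound \<delta> r \<mu> F \<alpha>)\<^sup>2 / radius r \<mu> F))"

context low_rank_recovery
begin

abbreviation "F \<equiv> fro_norm Ms"

text \<open>Because the rank is exactly r, no column of an orthogonalized factor can vanish:
  dropping a zero column would leave r - 1 products. All columns can therefore be normalized, their
  lengths moving to the other factor.\<close>

lemma Ms_decomposition:
  obtains l nn where "orthonormal n r l"
    and "\<And>i j. i < n \<Longrightarrow> j < m \<Longrightarrow> Ms $$ (i, j) = (\<Sum>k<r. l k i * nn k j)"
    and "\<And>k. k < r \<Longrightarrow> sqnorm m (nn k) \<le> F\<^sup>2"
proof -
  obtain s c where sc: "\<And>i j. i < n \<Longrightarrow> j < m \<Longrightarrow> Ms $$ (i, j) = (\<Sum>k<r. s k i * c k j)"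
    using rank_factorization[OF Ms] unfolding rank by blast
  obtain q where q: "orthonormal r r q"
    and orth: "\<And>i j. i < r \<Longrightarrow> j < r \<Longrightarrow> i \<noteq> j \<Longrightarrow> sdot n (rot r q s i) (rot r q s j) = 0"
    using exists_orthogonalizing_rotation[of r n s] by blast
  define s' where "s' = rot r q s"
  define c' where "c' = rot r q c"
  have Ms': "Ms $$ (i, j) = (\<Sum>k<r. s' k i * c' k j)" if "i < n" "j < m" for i j
    unfolding s'_def c'_def rot_outer[OF q] by (rule sc[OF that])
  have pos: "sqnorm n (s' k) > 0" if k: "k < r" for k
  proof (rule ccontr)
    assume "\<not> sqnorm n (s' k) > 0"
    then have "sqnorm n (s' k) = 0" using sdot_self_nonneg[of n "s' k"] by linarith
    then have z: "s' k i = 0" if "i < n" for i using that by (simp add: sdot_self_eq_0_iff)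
    \<comment> \<open>\<open>e\<close> enumerates the indices other than k in increasing
      order.\<close>
    define e where "e j = (if j < k then j else Suc j)" for j
    have "rank_mat Ms \<le> r - 1"
    proof (rule rank_sum_outer_le[OF Ms])
      fix i j assume ij: "i < n" "j < m"
      have "Ms $$ (i, j) = (\<Sum>k\<in>{..<r} - {k}. s' k i * c' k j)"
        using Ms'[OF ij] k z[OF ij(1)] by (simp add: sum.remove[of "{..<r}" k])
      also have "\<dots> = (\<Sum>a<r - 1. s' (e a) i * c' (e a) j)"
        by (rule sum.reindex_bij_witness[of _ e "\<lambda>a. if a < k then a else a - 1"])
          (use k in \<open>auto simp: e_def split: if_splits\<close>)
      finally show "Ms $$ (i, j) = (\<Sum>a<r - 1. s' (e a) i * c' (e a) j)" .
    qed
    then show False using rank r by simp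
  qed
  define b where "b k = sqrt (sqnorm n (s' k))" for k
  have b: "b k > 0" "b k * b k = sqnorm n (s' k)" if "k < r" for k
    using pos[OF that] by (simp_all add: b_def)
  define l where "l k = (\<lambda>i. (1 / b k) * s' k i)" for k
  define nn where "nn k = (\<lambda>j. b k * c' k j)" for k
  have l: "orthonormal n r l"
    unfolding orthonormal_def
  proof (intro allI impI)
    fix i j assume ij: "i < r" "j < r"
    show "sdot n (l i) (l j) = (if i = j then 1 else 0)"
    proof (cases "i = j")
      case True
      have "sqnorm n (l i) = sqnorm n (s' i) / (b i * b i)"
        unfolding l_def sdot_simps by simp
      then show ?thesis using True b[OF ij(1)] pos[OF ij(1)] by simp
    next
      case False
      then show ?thesis using orth[OF ij False] unfolding l_def sdot_simps s'_def by simp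
    qed
  qed
  have Mln: "Ms $$ (i, j) = (\<Sum>k<r. l k i * nn k j)" if "i < n" "j < m" for i j
    unfolding Ms'[OF that] using b by (intro sum.cong refl) (force simp: l_def nn_def)
  have "(fro_norm Ms)\<^sup>2 = (\<Sum>i<n. \<Sum>j<m. (\<Sum>k<r. l k i * nn k j) * (\<Sum>k<r. l k i * nn k j))"
    unfolding fro_norm_sq[OF Ms] by (simp add: Mln power2_eq_square)
  also have "\<dots> = (\<Sum>k<r. \<Sum>k'<r. if k = k' then sqnorm m (nn k) else 0)"
    unfolding sum_outer_products using l by (intro sum.cong refl) (auto simp: orthonormal_def)
  also have "\<dots> = (\<Sum>k<r. sqnorm m (nn k))" by simp
  finally have F2: "F\<^sup>2 = (\<Sum>k<r. sqnorm m (nn k))" .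
  have "sqnorm m (nn k) \<le> F\<^sup>2" if "k < r" for k
    unfolding F2 using that by (intro member_le_sum[of k "{..<r}" "\<lambda>k. sqnorm m (nn k)"]) auto
  with l Mln show thesis by (rule that)
qed

lemma balanced_global_minimum:
  assumes W: "W \<in> factors" and M: "PM W = Ms" and bal: "balanced n m r (U W) (V W)"
  shows "W \<in> global_minima (n + m) r \<rho>"
proof -
  have "\<rho> W = f Ms"
    using bal by (simp add: rho_eq[OF W] M imbalance_def balanced_def)
  moreover have "f Ms \<le> \<rho> Y" if "Y \<in> factors" for Y
  proof -
    have "0 \<le> \<mu> / 4 * (\<Sum>a<r. \<Sum>b<r. (DD Y a b)\<^sup>2)"
      using \<mu> by (intro mult_nonneg_nonneg sum_nonneg) auto
    then show ?thesis using f_ge[of Y] by (simp add: rho_eq[OF that])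
  qed
  ultimately show ?thesis using W by (simp add: global_minima_def)
qed

lemma radius_ge_1: "1 \<le> radius r \<mu> F"
  using \<mu> by (simp add: radius_def)

lemma err_const_nonneg: "0 \<le> err_const r (radius r \<mu> F) F"
  using radius_ge_1 unfolding err_const_def by (intro add_nonneg_nonneg mult_nonneg_nonneg) auto

lemma bounds_pos:
  assumes "0 < \<alpha>"
  shows "0 < eta_bound \<delta> r \<mu> F \<alpha>" "eta_bound \<delta> r \<mu> F \<alpha> \<le> 1"
    "0 < omega_bound \<delta> r \<mu> F \<alpha>" "0 < beta_bound \<delta> r \<mu> F \<alpha>"
proof -
  have "0 < 1 + 8 * err_const r (radius r \<mu> F) F / (1 - 3 * \<delta>)"
    using err_const_nonneg \<delta>_lt by (intro add_pos_nonneg divide_nonneg_nonneg) auto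
  then show e: "0 < eta_bound \<delta> r \<mu> F \<alpha>"
    using assms r unfolding eta_bound_def by simp
  show "eta_bound \<delta> r \<mu> F \<alpha> \<le> 1" by (simp add: eta_bound_def)
  show o: "0 < omega_bound \<delta> r \<mu> F \<alpha>" using e by (simp add: omega_bound_def)
  show "0 < beta_bound \<delta> r \<mu> F \<alpha>"
    using o r \<mu> radius_ge_1 by (simp add: beta_bound_def)
qed

lemma near_minimum:
  assumes \<alpha>: "0 < \<alpha>" and W: "W \<in> factors"
    and grad: "fro_norm (gradient (n + m) r \<rho> W) \<le> beta_bound \<delta> r \<mu> F \<alpha>"
    and hess: "- omega_bound \<delta> r \<mu> F \<alpha> \<le> lambda_min (hessian (n + m) r \<rho> W)"
  shows "\<exists>Y\<in>global_minima (n + m) r \<rho>. fro_norm (W - Y) \<le> \<alpha>"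
proof -
  define \<eta> where "\<eta> = eta_bound \<delta> r \<mu> F \<alpha>"
  define \<omega> where "\<omega> = omega_bound \<delta> r \<mu> F \<alpha>"
  define \<beta> where "\<beta> = beta_bound \<delta> r \<mu> F \<alpha>"
  define R where "R = radius r \<mu> F"
  have \<eta>: "0 < \<eta>" "\<eta> \<le> 1" and \<omega>0: "0 < \<omega>" and \<beta>0: "0 < \<beta>"
    using bounds_pos[OF \<alpha>] by (simp_all add: \<eta>_def \<omega>_def \<beta>_def)
  have R1: "1 \<le> R" using radius_ge_1 by (simp add: R_def)
  have \<omega>: "\<omega> \<le> \<eta> ^ 3" "3 * \<omega> \<le> \<eta>"
  proof -
    have w: "3 * \<omega> = \<eta> ^ 3" by (simp add: \<omega>_def omega_bound_def \<eta>_def)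
    then show "\<omega> \<le> \<eta> ^ 3" using \<omega>0 by linarith
    have "\<eta> ^ 3 \<le> \<eta>" using \<eta> power_decreasing[of 1 3 \<eta>] by simp
    then show "3 * \<omega> \<le> \<eta>" using w by simp
  qed
  have \<beta>: "\<beta> \<le> 1" "2 * r * \<beta> \<le> \<omega>" "R * \<beta> \<le> \<mu> * \<omega>\<^sup>2"
  proof -
    show "\<beta> \<le> 1" by (simp add: \<beta>_def beta_bound_def)
    have "\<beta> \<le> \<omega> / (2 * r)" by (simp add: \<beta>_def beta_bound_def \<omega>_def)
    then show "2 * r * \<beta> \<le> \<omega>" using r by (simp add: field_simps)
    have "\<beta> \<le> \<mu> * \<omega>\<^sup>2 / R" by (simp add: \<beta>_def beta_bound_def \<omega>_def R_def)
    then show "R * \<beta> \<le> \<mu> * \<omega>\<^sup>2" using R1 by (simp add: field_simps)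
  qed
  let ?G = "g (PM W)"
  have sg: "small_gradient n m r (U W) (V W) ?G \<mu> \<beta> (1 - \<delta>) F"
  proof
    show "(\<Sum>k<r. sqnorm n (gU W k) + sqnorm m (gV W k)) \<le> \<beta>\<^sup>2"
      unfolding gradient_norm[OF W, symmetric] using grad by (simp add: \<beta>_def power_mono)
    show "(1 - \<delta>) / 2 * (\<Sum>i<n. \<Sum>j<m. (\<Sum>k<r. U W k i * V W k j)\<^sup>2) - F\<^sup>2 / 2
      \<le> (\<Sum>k<r. sdot n (U W k) (mat_app m ?G (V W k)))"
      using coercive[of W] unfolding sum_sdot_mat_app by (simp add: FN_def GP_def PM_def)
  qed (use r \<mu> \<mu>_lt \<beta> \<beta>0 in auto)
  have T_le: "(\<Sum>k<r. sqnorm n (U W k) + sqnorm m (V W k)) \<le> R\<^sup>2"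
    using small_gradient.T_le[OF sg] unfolding R_def[symmetric] small_gradient.T_def[OF sg] .
  have D_le: "(\<Sum>a<r. \<Sum>b<r. (DD W a b)\<^sup>2) \<le> \<omega>\<^sup>2"
  proof -
    have "\<mu> * (\<Sum>a<r. \<Sum>b<r. (DD W a b)\<^sup>2) \<le> \<mu> * \<omega>\<^sup>2"
      using small_gradient.D_le[OF sg] \<beta>(3) unfolding R_def[symmetric] by linarith
    then show ?thesis using \<mu> by simp
  qed
  obtain q where q: "orthonormal r r q"
    and orth: "\<And>i j. i < r \<Longrightarrow> j < r \<Longrightarrow> i \<noteq> j \<Longrightarrow> sdot n (rot r q (U W) i) (rot r q (U W) j) = 0"
    using exists_orthogonalizing_rotation[of r n "U W"] by blast
  define u where "u = rot r q (U W)"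
  define v where "v = rot r q (V W)"
  obtain l nn where l: "orthonormal n r l"
    and Mln: "\<And>i j. i < n \<Longrightarrow> j < m \<Longrightarrow> Ms $$ (i, j) = (\<Sum>k<r. l k i * nn k j)"
    and nF: "\<And>k. k < r \<Longrightarrow> sqnorm m (nn k) \<le> F\<^sup>2"
    using Ms_decomposition by blast
  have rot_le: "sqnorm N (rot r q y k) \<le> (\<Sum>k<r. sqnorm N (y k))" if "k < r" for N y k
    unfolding sum_rotated_norms[OF q, of N y, symmetric] using that by (intro member_le_sum) auto
  have sum_u: "(\<Sum>k<r. sqnorm n (U W k)) \<le> R\<^sup>2"
  proof -
    have "0 \<le> (\<Sum>k<r. sqnorm m (V W k))"
      by (intro sum_nonneg) simp
    then show ?thesis using T_le unfolding sum.distrib by linarith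
  qed
  \<comment> \<open>A rotated column is bounded only by the sum over all r original columns, hence
    the extra factor r.\<close>
  have r\<beta>: "r * (2 * \<beta>)\<^sup>2 \<le> \<omega>\<^sup>2"
  proof -
    have "1 * (real r * (2 * \<beta>)\<^sup>2) \<le> r * (r * (2 * \<beta>)\<^sup>2)"
      using r by (intro mult_right_mono) auto
    also have "\<dots> = (2 * r * \<beta>)\<^sup>2" by (simp add: power2_eq_square)
    also have "\<dots> \<le> \<omega>\<^sup>2" using \<beta> \<beta>0 by (intro power_mono) auto
    finally show ?thesis by simp
  qed
  have mat_app_rot: "mat_app m ?G (v k) = rot r q (\<lambda>k. mat_app m ?G (V W k)) k"
    and mat_app_t_rot: "mat_app_t n ?G (u k) = rot r q (\<lambda>k. mat_app_t n ?G (U W k)) k" for k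
    unfolding u_def v_def rot_def mat_app_def mat_app_t_def
    by (rule ext, simp only: sum_distrib_left mult.left_commute, rule sum.swap)+
  interpret ac: approx_critical n m r u v l nn ?G \<delta> \<mu> \<eta> \<omega> R F
  proof
    show "sdot n (u k) (u k') = 0" if "k < r" "k' < r" "k \<noteq> k'" for k k'
      unfolding u_def by (rule orth[OF that])
    show "sqnorm n (u k) \<le> R\<^sup>2" if "k < r" for k
      unfolding u_def by (rule order_trans[OF rot_le[OF that] sum_u])
    show "sqnorm n (mat_app m ?G (v k)) \<le> \<omega>\<^sup>2" if "k < r" for k
    proof -
      have "(\<Sum>k<r. sqnorm n (mat_app m ?G (V W k))) \<le> (\<Sum>k<r. (2 * \<beta>)\<^sup>2)"
        using small_gradient.g_bound(1)[OF sg] by (intro sum_mono) auto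
      then show ?thesis
        unfolding mat_app_rot using rot_le[OF that, of n "\<lambda>k. mat_app m ?G (V W k)"] r\<beta> by simp
    qed
    show "sqnorm m (mat_app_t n ?G (u k)) \<le> \<omega>\<^sup>2" if "k < r" for k
    proof -
      have "(\<Sum>k<r. sqnorm m (mat_app_t n ?G (U W k))) \<le> (\<Sum>k<r. (2 * \<beta>)\<^sup>2)"
        using small_gradient.g_bound(2)[OF sg] by (intro sum_mono) auto
      then show ?thesis
        unfolding mat_app_t_rot using rot_le[OF that, of m "\<lambda>k. mat_app_t n ?G (U W k)"] r\<beta> by simp
    qed
    show "\<bar>sdot n (u k) (u k') - sdot m (v k) (v k')\<bar> \<le> \<omega>" if k: "k < r" "k' < r" for k k'
    proof -
      let ?D = "\<lambda>k k'. \<Sum>a<r. q k a * (\<Sum>b<r. q k' b * DD W a b)"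
      have eq: "sdot n (u k) (u k') - sdot m (v k) (v k') = ?D k k'"
        unfolding u_def v_def sdot_rot imbalance_def by (simp add: right_diff_distrib sum_subtractf)
      have "(?D k k')\<^sup>2 \<le> (\<Sum>k'<r. (?D k k')\<^sup>2)"
        using k(2) member_le_sum[of k' "{..<r}" "\<lambda>k'. (?D k k')\<^sup>2"] by simp
      moreover have "(\<Sum>k'<r. (?D k k')\<^sup>2) \<le> (\<Sum>k<r. \<Sum>k'<r. (?D k k')\<^sup>2)"
        using k(1) member_le_sum[of k "{..<r}" "\<lambda>k. \<Sum>k'<r. (?D k k')\<^sup>2"] by (simp add: sum_nonneg)
      moreover have "(\<Sum>k<r. \<Sum>k'<r. (?D k k')\<^sup>2) \<le> \<omega>\<^sup>2"
        unfolding sum_sq_rot2[OF q] by (rule D_le)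
      ultimately have "(sdot n (u k) (u k') - sdot m (v k) (v k'))\<^sup>2 \<le> \<omega>\<^sup>2"
        unfolding eq by linarith
      then show ?thesis using \<omega>0 by (simp add: power2_le_iff_abs_le)
    qed
    show "0 \<le> (1 + \<delta>) * (sqnorm n x * sqnorm m (v p) + sqnorm n (u p) * sqnorm m y
              + 2 * (sdot n x (u p) * sdot m y (v p)))
        + 2 * sdot m (mat_app_t n ?G x) y
        + 2 * \<mu> * (\<Sum>k<r. (sdot n (u k) x - sdot m (v k) y)\<^sup>2)
        + \<mu> * (sqnorm n (u p) - sqnorm m (v p)) * (sqnorm n x - sqnorm m y)
        + \<omega> * (sqnorm n x + sqnorm m y)" if p: "p < r" for p x y
    proof -
      have qp: "sqnorm r (q p) = 1" using q p by (simp add: orthonormal_def)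
      have S: "(\<Sum>k<r. (sdot n (u k) x - sdot m (v k) y)\<^sup>2) = (\<Sum>k<r. (sdot n (U W k) x - sdot m (V W k) y)\<^sup>2)"
      proof -
        have "sdot n (u k) x - sdot m (v k) y = (\<Sum>a<r. q k a * (sdot n (U W a) x - sdot m (V W a) y))" for k
          unfolding u_def v_def rot_def sdot_simps by (simp add: right_diff_distrib sum_subtractf)
        then show ?thesis by (simp only: power2_eq_square orthonormal_parseval[OF q])
      qed
      have "- \<omega> * (sqnorm n x + sqnorm m y)
          \<le> lambda_min (hessian (n + m) r \<rho> W) * (sqnorm n x + sqnorm m y)"
        using hess by (intro mult_right_mono) (simp_all add: \<omega>_def)
      then show ?thesis
        using second_order_direction[OF W qp, of x y]
        unfolding S rot_def[symmetric] u_def[symmetric] v_def[symmetric] by linarith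
    qed
  qed (use r \<delta> \<mu> \<eta> \<omega>0 \<omega> R1 l nF in auto)
  define e where "e = FN (E W)"
  have acM: "ac.M i j = PM W $$ (i, j)" if "i < n" "j < m" for i j
    unfolding ac.M_def unfolding u_def v_def rot_outer[OF q] using that by (simp add: PM_def)
  have acN: "ac.N i j = Ms $$ (i, j)" if "i < n" "j < m" for i j
    unfolding ac.N_def using that by (simp add: Mln)
  have eE: "(\<Sum>i<n. \<Sum>j<m. (ac.M i j - ac.N i j)\<^sup>2) = e"
    by (simp add: e_def FN_def E(2) acM acN)
  have "(\<Sum>k<r. sdot n (u k) (mat_app m ?G (v k))) - (\<Sum>j<r. sdot n (l j) (mat_app m ?G (nn j))) = GP (PM W) (E W)"
  proof -
    have "(\<Sum>k<r. sdot n (u k) (mat_app m ?G (v k))) = (\<Sum>i<n. \<Sum>j<m. ?G i j * PM W $$ (i, j))"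
      unfolding sum_sdot_mat_app using acM by (simp add: ac.M_def)
    moreover have "(\<Sum>j<r. sdot n (l j) (mat_app m ?G (nn j))) = (\<Sum>i<n. \<Sum>j<m. ?G i j * Ms $$ (i, j))"
      unfolding sum_sdot_mat_app by (simp add: Mln)
    ultimately show ?thesis by (simp add: GP_def E(2) right_diff_distrib sum_subtractf)
  qed
  then have "2 * ac.t * GP (PM W) (E W) \<le> e + err_const r R F * \<eta>"
    using ac.gradient_pairing_le unfolding eE by simp
  moreover have "2 * ac.t * ((1 - \<delta>) * e) \<le> 2 * ac.t * GP (PM W) (E W)"
    using GP_E_ge[of W] ac.t unfolding e_def by (intro mult_left_mono) auto
  ultimately have 1: "2 * ac.t * ((1 - \<delta>) * e) \<le> e + err_const r R F * \<eta>" by linarith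
  have C0: "0 \<le> err_const r R F" using err_const_nonneg by (simp add: R_def)
  \<comment> \<open>Multiplying by 1 + \<delta> leaves the coefficient 2 (1 - \<delta>) - (1 +
    \<delta>) = 1 - 3 \<delta> in front of |E|^2.\<close>
  have e_le: "(1 - 3 * \<delta>) * e \<le> 2 * (err_const r R F * \<eta>)"
  proof -
    have "(1 + \<delta>) * (2 * ac.t * ((1 - \<delta>) * e)) \<le> (1 + \<delta>) * (e + err_const r R F * \<eta>)"
      using 1 \<delta> by (intro mult_left_mono) auto
    moreover have "(1 + \<delta>) * (2 * ac.t * ((1 - \<delta>) * e)) = ((1 + \<delta>) * ac.t) * (2 * ((1 - \<delta>) * e))"
      by simp
    ultimately have "2 * ((1 - \<delta>) * e) \<le> (1 + \<delta>) * (e + err_const r R F * \<eta>)"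
      unfolding ac.t(3) by simp
    then have "(1 - 3 * \<delta>) * e \<le> (1 + \<delta>) * (err_const r R F * \<eta>)" by (simp add: algebra_simps)
    also have "\<dots> \<le> 2 * (err_const r R F * \<eta>)" using \<delta> C0 \<eta> by (intro mult_right_mono) auto
    finally show ?thesis .
  qed
  \<comment> \<open>Any balanced factorization of the target can serve here; the next step rotates
    it towards the original, unrotated (U, V).\<close>
  obtain us vs where bs: "balanced n m r us vs"
    and Mbs: "\<And>i j. i < n \<Longrightarrow> j < m \<Longrightarrow> (\<Sum>k<r. us k i * vs k j) = (\<Sum>k<r. l k i * nn k j)"
    using exists_balanced_factor[OF l, of m nn] by blast
  from exists_near_balanced_factor[OF bs, of "U W" "V W"]
  obtain u' v' where Mu': "\<forall>i j. (\<Sum>k<r. u' k i * v' k j) = (\<Sum>k<r. us k i * vs k j)"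
    and bal': "balanced n m r u' v'"
    and near: "(\<Sum>k<r. sqnorm n (\<lambda>i. U W k i - u' k i)
        + sqnorm m (\<lambda>i. V W k i - v' k i))\<^sup>2
      \<le> 2 * real r * ((\<Sum>k<r. \<Sum>k'<r. (sdot n (U W k) (U W k') - sdot m (V W k) (V W k'))\<^sup>2)
      + 4 * (\<Sum>i<n. \<Sum>j<m. ((\<Sum>k<r. U W k i * V W k j) - (\<Sum>k<r. us k i * vs k j))\<^sup>2))"
    by (elim exE conjE) (rule that; assumption)
  define Y where "Y = mat (n + m) r (\<lambda>(c, k). if c < n then u' k c else v' k (c - n))"
  have Y: "Y \<in> factors" by (simp add: Y_def)
  have UY: "U Y k i = u' k i" if "i < n" "k < r" for i k
    using that by (simp add: U_def Y_def)
  have VY: "V Y k j = v' k j" if "j < m" "k < r" for j k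
    using that by (simp add: V_def Y_def)
  have "PM Y = Ms"
    using Ms by (intro eq_matI) (auto simp: PM_def UY VY Mu' Mbs Mln)
  moreover have "balanced n m r (U Y) (V Y)"
    unfolding balanced_def
  proof (intro allI impI)
    fix k k' assume k: "k < r" "k' < r"
    have "sdot n (U Y k) (U Y k') = sdot n (u' k) (u' k')" by (rule sdot_cong) (simp_all add: UY k)
    moreover have "sdot m (V Y k) (V Y k') = sdot m (v' k) (v' k')" by (rule sdot_cong) (simp_all add: VY k)
    ultimately show "sdot n (U Y k) (U Y k') = sdot m (V Y k) (V Y k')"
      using bal' k by (simp add: balanced_def)
  qed
  ultimately have min: "Y \<in> global_minima (n + m) r \<rho>"
    by (rule balanced_global_minimum[OF Y])
  have dist: "(fro_norm (W - Y))\<^sup>2 = (\<Sum>k<r. sqnorm n (\<lambda>i. U W k i - u' k i)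
        + sqnorm m (\<lambda>i. V W k i - v' k i))"
  proof -
    have Z: "W - Y \<in> factors" by (rule minus_carrier_mat[OF Y])
    have "(fro_norm (W - Y))\<^sup>2 = (\<Sum>c<n + m. \<Sum>k<r. (W - Y) $$ (c, k) * (W - Y) $$ (c, k))"
      unfolding fro_norm_sq[OF Z] by (simp add: power2_eq_square)
    also have "\<dots> = (\<Sum>k<r. sdot n (U (W - Y) k) (\<lambda>i. (W - Y) $$ (i, k)) + sdot m (V (W - Y) k) (\<lambda>j. (W - Y) $$ (n + j, k)))"
      by (rule sum_stack[OF Z])
    also have "\<dots> = (\<Sum>k<r. sqnorm n (\<lambda>i. U W k i - u' k i)
        + sqnorm m (\<lambda>i. V W k i - v' k i))"
      by (intro sum.cong arg_cong2[where f = plus] sdot_cong refl) (use W Y in \<open>auto simp: U_def V_def Y_def\<close>)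
    finally show ?thesis .
  qed
  have "(\<Sum>i<n. \<Sum>j<m. ((\<Sum>k<r. U W k i * V W k j) - (\<Sum>k<r. us k i * vs k j))\<^sup>2) = e"
    by (simp add: e_def FN_def E(2) Mbs Mln PM_def)
  then have "((fro_norm (W - Y))\<^sup>2)\<^sup>2 \<le> 2 * r * ((\<Sum>k<r. \<Sum>k'<r. (DD W k k')\<^sup>2) + 4 * e)"
    using near unfolding dist imbalance_def by simp
  also have "\<dots> \<le> 2 * r * (\<eta> + 4 * (2 * (err_const r R F * \<eta>) / (1 - 3 * \<delta>)))"
  proof (intro mult_left_mono add_mono)
    have "\<omega>\<^sup>2 \<le> \<eta> * 1"
      unfolding power2_eq_square using \<omega> \<omega>0 \<eta> by (intro mult_mono) auto
    then show "(\<Sum>k<r. \<Sum>k'<r. (DD W k k')\<^sup>2) \<le> \<eta>" using D_le by linarith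
    show "e \<le> 2 * (err_const r R F * \<eta>) / (1 - 3 * \<delta>)"
      using e_le \<delta>_lt by (simp add: pos_le_divide_eq mult.commute)
  qed auto
  also have "\<dots> = 2 * r * (1 + 8 * err_const r R F / (1 - 3 * \<delta>)) * \<eta>"
    by (simp add: algebra_simps)
  also have "\<dots> \<le> \<alpha> ^ 4"
  proof -
    define K where "K = 2 * r * (1 + 8 * err_const r R F / (1 - 3 * \<delta>))"
    have "0 < 1 + 8 * err_const r R F / (1 - 3 * \<delta>)"
      using C0 \<delta>_lt by (intro add_pos_nonneg divide_nonneg_nonneg) auto
    then have K: "K > 0" using r by (simp add: K_def)
    have "\<eta> \<le> \<alpha> ^ 4 / K" by (simp add: \<eta>_def eta_bound_def K_def R_def)
    then have "K * \<eta> \<le> \<alpha> ^ 4" using K by (simp add: pos_le_divide_eq mult.commute)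
    then show ?thesis by (simp add: K_def)
  qed
  also have "\<alpha> ^ 4 = (\<alpha>\<^sup>2)\<^sup>2" by (simp flip: power_mult)
  finally have "(fro_norm (W - Y))\<^sup>2 \<le> \<alpha>\<^sup>2"
    by (rule power2_le_imp_le) simp
  then have "fro_norm (W - Y) \<le> \<alpha>"
    by (rule power2_le_imp_le) (use \<alpha> in simp)
  then show ?thesis using min by blast
qed

end

theorem theorem6:
  shows "\<exists>(eps1 :: real \<Rightarrow> nat \<Rightarrow> real \<Rightarrow> real \<Rightarrow> real \<Rightarrow> real \<Rightarrow> real) (lam1 :: real \<Rightarrow> nat \<Rightarrow> real \<Rightarrow> real \<Rightarrow> real \<Rightarrow> real \<Rightarrow> real).
    \<forall>(n :: nat) (m :: nat) (r :: nat) (\<delta> :: real) (\<mu> :: real) (\<alpha> :: real)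
       (f :: real mat \<Rightarrow> real) (Ms :: real mat).
      1 \<le> r \<longrightarrow>
      twice_cont_diff n m f \<longrightarrow>
      RIP n m (2 * r) (2 * r) \<delta> f \<longrightarrow>
      \<delta> < 1 / 3 \<longrightarrow>
      Ms \<in> carrier_mat n m \<longrightarrow>
      gradient n m f Ms = 0\<^sub>m n m \<longrightarrow>
      rank_mat Ms = r \<longrightarrow>
      0 < \<alpha> \<longrightarrow>
      (1 - \<delta>) / 3 \<le> \<mu> \<longrightarrow>
      \<mu> < 1 - \<delta> \<longrightarrow>
      0 < eps1 \<delta> r \<mu> (sing_val r Ms) (fro_norm Ms) \<alpha> \<and>
      0 < lam1 \<delta> r \<mu> (sing_val r Ms) (fro_norm Ms) \<alpha> \<and>
      (\<forall>(eps :: real) (lam :: real).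
        0 < eps \<longrightarrow> eps \<le> eps1 \<delta> r \<mu> (sing_val r Ms) (fro_norm Ms) \<alpha> \<longrightarrow>
        0 < lam \<longrightarrow> lam \<le> lam1 \<delta> r \<mu> (sing_val r Ms) (fro_norm Ms) \<alpha> \<longrightarrow>
        strict_saddle (n + m) r (rho_stacked n m r f \<mu>)
          \<alpha> (min (\<mu> * (eps / real r) powr (3 / 2)) lam) (\<mu> * eps))"
proof (rule exI[of _ "\<lambda>\<delta> r \<mu> _ F \<alpha>. omega_bound \<delta> r \<mu> F \<alpha> / \<mu>"],
    rule exI[of _ "\<lambda>\<delta> r \<mu> _ F \<alpha>. beta_bound \<delta> r \<mu> F \<alpha>"], intro allI impI)
  fix n m r :: nat and \<delta> \<mu> \<alpha> :: real and f :: "real mat \<Rightarrow> real" and Ms :: "real mat"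
  assume r: "1 \<le> r" and "twice_cont_diff n m f" and "RIP n m (2 * r) (2 * r) \<delta> f" and "\<delta> < 1 / 3"
    and "Ms \<in> carrier_mat n m" and "gradient n m f Ms = 0\<^sub>m n m" and "rank_mat Ms = r" and \<alpha>: "0 < \<alpha>"
    and "(1 - \<delta>) / 3 \<le> \<mu>" and "\<mu> < 1 - \<delta>"
  then interpret low_rank_recovery n m r f \<mu> \<delta> Ms
    by unfold_locales
  \<comment> \<open>The witnesses make \<gamma> = \<mu> eps at most \<open>omega_bound\<close> and
    lam at most \<open>beta_bound\<close>, the two tolerances of
    \<open>near_minimum\<close>.\<close>
  show "0 < omega_bound \<delta> r \<mu> F \<alpha> / \<mu> \<and> 0 < beta_bound \<delta> r \<mu> F \<alpha> \<and>
      (\<forall>eps lam. 0 < eps \<longrightarrow> eps \<le> omega_bound \<delta> r \<mu> F \<alpha> / \<mu> \<longrightarrow>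
        0 < lam \<longrightarrow> lam \<le> beta_bound \<delta> r \<mu> F \<alpha> \<longrightarrow>
        strict_saddle (n + m) r \<rho> \<alpha> (min (\<mu> * (eps / real r) powr (3 / 2)) lam) (\<mu> * eps))"
  proof (intro conjI allI impI)
    show "0 < omega_bound \<delta> r \<mu> F \<alpha> / \<mu>" "0 < beta_bound \<delta> r \<mu> F \<alpha>"
      using bounds_pos[OF \<alpha>] \<mu> by auto
    fix eps lam :: real
    assume eps: "0 < eps" "eps \<le> omega_bound \<delta> r \<mu> F \<alpha> / \<mu>" and lam: "0 < lam" "lam \<le> beta_bound \<delta> r \<mu> F \<alpha>"
    define \<beta> where "\<beta> = min (\<mu> * (eps / real r) powr (3 / 2)) lam"
    have "0 < \<beta>" using \<mu> eps lam r by (simp add: \<beta>_def)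
    moreover have "0 < \<mu> * eps" using \<mu> eps by simp
    moreover have "(global_minima (n + m) r \<rho> \<noteq> {} \<and> fro_infdist W (global_minima (n + m) r \<rho>) \<le> \<alpha>) \<or>
        \<beta> \<le> fro_norm (gradient (n + m) r \<rho> W) \<or> lambda_min (hessian (n + m) r \<rho> W) \<le> - (\<mu> * eps)"
      if W: "W \<in> carrier_mat (n + m) r" for W
    proof (rule ccontr)
      assume no: "\<not> ?thesis"
      have "\<mu> * eps \<le> omega_bound \<delta> r \<mu> F \<alpha>"
        using eps \<mu> by (simp add: pos_le_divide_eq mult.commute)
      moreover have "\<beta> \<le> beta_bound \<delta> r \<mu> F \<alpha>" using lam by (simp add: \<beta>_def)
      moreover have "fro_norm (gradient (n + m) r \<rho> W) < \<beta>" "- (\<mu> * eps) < lambda_min (hessian (n + m) r \<rho> W)"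
        using no by auto
      ultimately have "fro_norm (gradient (n + m) r \<rho> W) \<le> beta_bound \<delta> r \<mu> F \<alpha>"
        "- omega_bound \<delta> r \<mu> F \<alpha> \<le> lambda_min (hessian (n + m) r \<rho> W)"
        by linarith+
      from near_minimum[OF \<alpha> W this]
      obtain Y where Y: "Y \<in> global_minima (n + m) r \<rho>" "fro_norm (W - Y) \<le> \<alpha>"
        by blast
      have "fro_infdist W (global_minima (n + m) r \<rho>) \<le> fro_norm (W - Y)"
        unfolding fro_infdist_def using Y(1) by (intro cINF_lower bdd_belowI2[of _ 0]) auto
      then show False using no Y by auto
    qed
    ultimately show "strict_saddle (n + m) r \<rho> \<alpha> (min (\<mu> * (eps / real r) powr (3 / 2)) lam) (\<mu> * eps)"
      unfolding strict_saddle_def \<beta>_def[symmetric] using \<alpha> by blast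
  qed
qed

end
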